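(* Let $h$ be a formal parameter. The DSR algebra $\mathcal{U}_h(\mathfrak{an}^3)\rtimes \mathcal{U}_{\mathfrak{io}(1,3)}[[h]]^{\mathrm{DJ}}$ is isomorphic, as a $\mathbb{C}[[h]]$-algebra, to the $h$-adic extension $\mathfrak{X}^4[[h]]\rtimes \mathcal{U}_{\mathfrak{io}(1,3)}[[h]]$ of the undeformed algebra, by an isomorphism that is congruent to the identity modulo $h$. In other words, the deformed algebra can be realized by a (nonlinear, invertible) change of generators in the undeformed one.
   Context: All algebras are unital and associative, over $\mathbb{C}[[h]]$, complete in the $h$-adic topology; tensor products are $h$-adically completed. Indices $\mu,\nu,\ldots\in\{0,1,2,3\}$, $i,j,k,l\in\{1,2,3\}$; the metric $\eta_{\mu\nu}=\mathrm{diag}(-,+,+,+)$ raises and lowers indices; repeated indices are summed; $\epsilon_{ijk}$ is totally antisymmetric with $\epsilon_{123}=1$; $\imath=\sqrt{-1}$. Smash product: for a left module algebra $\mathcal{A}$ over a Hopf algebra $\mathcal{H}$ (action $\triangleright$), $\mathcal{A}\rtimes\mathcal{H}$ is the vector space $\mathcal{A}\otimes\mathcal{H}$ with product $(f\otimes L)(g\otimes M)=f(L_{(1)}\triangleright g)\otimes L_{(2)}M$ (Sweedler notation). Poincaré Lie algebra $\mathfrak{io}(1,3)$: generators $M_i,N_i,P_\mu$ with $[M_i,M_j]=\imath\epsilon_{ijk}M_k$, $[M_i,N_j]=\imath\epsilon_{ijk}N_k$, $[N_i,N_j]=-\imath\epsilon_{ijk}M_k$, $[P_\mu,P_\nu]=0$,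 $[M_j,P_0]=0$, $[M_j,P_k]=\imath\epsilon_{jkl}P_l$, $[N_j,P_k]=-\imath\delta_{jk}P_0$, $[N_j,P_0]=-\imath P_j$. One writes $N_i=M_{0i}$ and $\epsilon_{ijk}M_k=M_{ij}$. Undeformed algebra: $\mathfrak{X}^4=\mathbb{C}[x^0,x^1,x^2,x^3]$, and $\mathfrak{X}^4[[h]]\rtimes\mathcal{U}_{\mathfrak{io}(1,3)}[[h]]$ is the ($h$-adically extended) smash product for the primitive coproduct on $\mathcal{U}_{\mathfrak{io}(1,3)}$ and the classical action $P_\mu\triangleright x^\nu=-\imath\delta_\mu^\nu$, $M_{\mu\nu}\triangleright x^\rho=\imath x_\nu\delta_\mu^\rho-\imath x_\mu\delta_\nu^\rho$. Thus its cross relations are $[P_\mu,x_\nu]=-\imath\eta_{\mu\nu}$, $[M_{\mu\nu},x_\lambda]=\imath\eta_{\mu\lambda}x_\nu-\imath\eta_{\nu\lambda}x_\mu$, $[x_\mu,x_\nu]=0$. Deformed algebra: $\mathcal{U}_h(\mathfrak{an}^3)$ is the universal $h$-adic unital algebra with generators $\mathcal{X}_\mu$ and relations $[\mathcal{X}_0,\mathcal{X}_i]=-\imath h\mathcal{X}_i$, $[\mathcal{X}_j,\mathcal{X}_k]=0$ ($\kappa$-Minkowski spacetime). $\mathcal{U}_{\mathfrak{io}(1,3)}[[h]]^{\mathrm{DJ}}$ ($\kappa$-Poincaré) is the algebra $\mathcal{U}_{\mathfrak{io}(1,3)}[[h]]$ with undeformed multiplication and, with $P^2=\vec P^2-P_0^2$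 and $\Xi=hP_0+\sqrt{1-h^2P^2}$ (a formal power series in $h$), the coproduct $\Delta(M_i)=M_i\otimes1+1\otimes M_i$, $\Delta(N_i)=N_i\otimes 1+\Xi^{-1}\otimes N_i-h\epsilon_{ijm}P_j\Xi^{-1}\otimes M_m$, $\Delta(P_i)=P_i\otimes\Xi+1\otimes P_i$, $\Delta(P_0)=P_0\otimes\Xi+\Xi^{-1}\otimes P_0+hP_m\Xi^{-1}\otimes P^m$, and undeformed counit (vanishing on $M_i,N_i,P_\mu$). It acts on $\mathcal{U}_h(\mathfrak{an}^3)$ by $P_\mu\triangleright\mathcal{X}^\nu=-\imath\delta_\mu^\nu$, $M_{\mu\nu}\triangleright\mathcal{X}^\rho=\imath\mathcal{X}_\nu\delta_\mu^\rho-\imath\mathcal{X}_\mu\delta_\nu^\rho$, making it a module algebra. The DSR algebra is the resulting smash product $\mathcal{U}_h(\mathfrak{an}^3)\rtimes\mathcal{U}_{\mathfrak{io}(1,3)}[[h]]^{\mathrm{DJ}}$. Its cross relations are $[M_i,\mathcal{X}_0]=0$, $[N_i,\mathcal{X}_0]=-\imath\mathcal{X}_i-\imath hN_i$, $[M_i,\mathcal{X}_j]=\imath\epsilon_{ijk}\mathcal{X}_k$, $[N_i,\mathcal{X}_j]=-\imath\delta_{ij}\mathcal{X}_0+\imath h\epsilon_{ijk}M_k$, $[P_k,\mathcal{X}_0]=0$, $[P_k,\mathcal{X}_j]=-\imath\delta_{jk}\Xi$, $[P_0,\mathcal{X}_j]=-\imath hP_j$, $[P_0,\mathcal{X}_0]=\imath\sqrt{1-h^2P^2}$.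 Setting $h=0$ in these relations (with $\mathcal{X}_\mu$ identified with $x_\mu$) gives the relations of the undeformed algebra; "congruent to the identity modulo $h$" refers to this identification of the two algebras modulo $h$. *)

theory Defs
  imports Complex_Main "HOL-Library.Poly_Mapping"
    "HOL-Computational_Algebra.Formal_Power_Series"
begin

unbundle fps_syntax

section \<open>Complex vector spaces, and modules and algebras over complex formal power series\<close>

text \<open>The formal parameter \<open>h\<close> is \<^term>\<open>fps_X :: complex fps\<close>, and for a complex vector space
  or algebra \<open>A\<close> the \<open>h\<close>-adic extension \<open>A[[h]]\<close> is the type of formal power series over \<open>A\<close>, whose
  library metric induces the \<open>h\<close>-adic topology.\<close>

class cvec = ab_group_add +
  fixes cscale :: "complex \<Rightarrow> 'a \<Rightarrow> 'a" (infixr "*\<^sub>c" 75)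
  assumes cscale_add_right: "a *\<^sub>c (x + y) = a *\<^sub>c x + a *\<^sub>c y"
    and cscale_add_left: "(a + b) *\<^sub>c x = a *\<^sub>c x + b *\<^sub>c x"
    and cscale_cscale: "a *\<^sub>c (b *\<^sub>c x) = (a * b) *\<^sub>c x"
    and cscale_one: "1 *\<^sub>c x = x"

class calgebra = ring_1 + cvec +
  assumes cscale_mult_left: "(a *\<^sub>c x) * y = a *\<^sub>c (x * y)"
    and cscale_mult_right: "x * (a *\<^sub>c y) = a *\<^sub>c (x * y)"

class hmodule = ab_group_add +
  fixes hscale :: "complex fps \<Rightarrow> 'a \<Rightarrow> 'a" (infixr "*\<^sub>h" 75)
  assumes hscale_add_right: "a *\<^sub>h (x + y) = a *\<^sub>h x + a *\<^sub>h y"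
    and hscale_add_left: "(a + b) *\<^sub>h x = a *\<^sub>h x + b *\<^sub>h x"
    and hscale_hscale: "a *\<^sub>h (b *\<^sub>h x) = (a * b) *\<^sub>h x"
    and hscale_one: "1 *\<^sub>h x = x"

class halgebra = ring_1 + hmodule +
  assumes hscale_mult_left: "(a *\<^sub>h x) * y = a *\<^sub>h (x * y)"
    and hscale_mult_right: "x * (a *\<^sub>h y) = a *\<^sub>h (x * y)"

lemma cscale_zero_right [simp]: "a *\<^sub>c (0::'a::cvec) = 0"
  using cscale_add_right[of a 0 0] by simp

lemma cscale_zero_left [simp]: "0 *\<^sub>c (x::'a::cvec) = 0"
  using cscale_add_left[of 0 0 x] by simp

lemma cscale_minus_right: "a *\<^sub>c (- (x::'a::cvec)) = - (a *\<^sub>c x)"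
  using cscale_add_right[of a x "- x"] by (simp add: eq_neg_iff_add_eq_0 add.commute)

lemma cscale_diff_right: "a *\<^sub>c ((x::'a::cvec) - y) = a *\<^sub>c x - a *\<^sub>c y"
  using cscale_add_right[of a x "- y"] by (simp add: cscale_minus_right)

lemma cscale_sum_right: "a *\<^sub>c (\<Sum>i\<in>I. f i) = (\<Sum>i\<in>I. a *\<^sub>c (f i :: 'a::cvec))"
  by (induction I rule: infinite_finite_induct) (simp_all add: cscale_add_right)

lemma cscale_sum_left: "(\<Sum>i\<in>I. f i) *\<^sub>c x = (\<Sum>i\<in>I. f i *\<^sub>c (x :: 'a::cvec))"
  by (induction I rule: infinite_finite_induct) (simp_all add: cscale_add_left)

lemma hscale_zero_right [simp]: "a *\<^sub>h (0::'a::hmodule) = 0"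
  using hscale_add_right[of a 0 0] by simp

lemma hscale_minus_right: "a *\<^sub>h (- (x::'a::hmodule)) = - (a *\<^sub>h x)"
  using hscale_add_right[of a x "- x"] by (simp add: eq_neg_iff_add_eq_0 add.commute)

lemma hscale_diff_right: "a *\<^sub>h ((x::'a::hmodule) - y) = a *\<^sub>h x - a *\<^sub>h y"
  using hscale_add_right[of a x "- y"] by (simp add: hscale_minus_right)

instantiation complex :: calgebra
begin
definition cscale_complex :: "complex \<Rightarrow> complex \<Rightarrow> complex" where "cscale_complex a x = a * x"
instance by standard (simp_all add: cscale_complex_def algebra_simps)
end

lemma lookup_map_zero: "f 0 = 0 \<Longrightarrow> Poly_Mapping.lookup (Poly_Mapping.map f p) k = f (Poly_Mapping.lookup p k)"
  by (transfer fixing: f) (simp add: when_def)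

instantiation poly_mapping :: (type, cvec) cvec
begin
definition cscale_poly_mapping :: "complex \<Rightarrow> ('a \<Rightarrow>\<^sub>0 'b) \<Rightarrow> ('a \<Rightarrow>\<^sub>0 'b)"
  where "cscale_poly_mapping a p = Poly_Mapping.map (cscale a) p"

lemma lookup_cscale: "Poly_Mapping.lookup (a *\<^sub>c p) k = a *\<^sub>c Poly_Mapping.lookup (p :: 'a \<Rightarrow>\<^sub>0 'b) k"
  unfolding cscale_poly_mapping_def
  by (rule lookup_map_zero[where f = "cscale a", OF cscale_zero_right])

instance
  by standard (rule poly_mapping_eqI; simp add: lookup_cscale lookup_add cscale_add_right
      cscale_add_left cscale_cscale cscale_one)+
end

lemma cscale_single: "a *\<^sub>c Poly_Mapping.single k x = Poly_Mapping.single k (a *\<^sub>c (x::'b::cvec))"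
  by (rule poly_mapping_eqI) (simp add: lookup_cscale lookup_single when_def)

instance poly_mapping :: (monoid_add, calgebra) calgebra
proof
  fix a :: complex and x y :: "'a \<Rightarrow>\<^sub>0 'b"
  have l: "a *\<^sub>c p = Poly_Mapping.single 0 (a *\<^sub>c 1) * p" for p :: "'a \<Rightarrow>\<^sub>0 'b"
  proof -
    have "a *\<^sub>c p = Poly_Mapping.map ((*) (a *\<^sub>c 1)) p"
      by (rule poly_mapping_eqI)
        (simp add: lookup_cscale lookup_map_zero cscale_mult_left)
    thus ?thesis by (simp add: mult_map_scale_conv_mult)
  qed
  show "(a *\<^sub>c x) * y = a *\<^sub>c (x * y)" by (simp add: l mult.assoc)
  have c: "p * Poly_Mapping.single 0 (a *\<^sub>c 1) = Poly_Mapping.single 0 (a *\<^sub>c 1) * p"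
    for p :: "'a \<Rightarrow>\<^sub>0 'b"
  proof (induction p rule: update_induct)
    case const show ?case by simp
  next
    case (update f k v)
    have "Poly_Mapping.update k v f = f + Poly_Mapping.single k v"
      using update by (intro poly_mapping_eqI)
        (auto simp: lookup_update lookup_add lookup_single in_keys_iff)
    thus ?case using update
      by (simp add: algebra_simps mult_single cscale_mult_left cscale_mult_right)
  qed
  show "x * (a *\<^sub>c y) = a *\<^sub>c (x * y)"
    by (simp only: l mult.assoc[symmetric] c)
qed

instantiation fps :: (cvec) hmodule
begin
definition hscale_fps :: "complex fps \<Rightarrow> 'a fps \<Rightarrow> 'a fps"
  where "hscale_fps a f = Abs_fps (\<lambda>n. \<Sum>i=0..n. (a $ i) *\<^sub>c (f $ (n - i)))"

lemma hscale_nth: "(a *\<^sub>h f) $ n = (\<Sum>i=0..n. (a $ i) *\<^sub>c ((f :: 'a fps) $ (n - i)))"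
  by (simp add: hscale_fps_def)

instance
proof
  fix a b :: "complex fps" and x y :: "'a fps"
  show "a *\<^sub>h (x + y) = a *\<^sub>h x + a *\<^sub>h y"
    by (rule fps_ext) (simp add: hscale_nth cscale_add_right sum.distrib)
  show "(a + b) *\<^sub>h x = a *\<^sub>h x + b *\<^sub>h x"
    by (rule fps_ext) (simp add: hscale_nth cscale_add_left sum.distrib)
  show "1 *\<^sub>h x = x"
  proof (rule fps_ext)
    fix n
    have "(1 *\<^sub>h x) $ n = (\<Sum>i=0..n. if i = 0 then x $ n else 0)"
      unfolding hscale_nth by (rule sum.cong) (auto simp: cscale_one)
    thus "(1 *\<^sub>h x) $ n = x $ n" by simp
  qed
  show "a *\<^sub>h (b *\<^sub>h x) = (a * b) *\<^sub>h x"
  proof (rule fps_ext)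
    fix n
    have "(a *\<^sub>h (b *\<^sub>h x)) $ n
        = (\<Sum>j=0..n. \<Sum>i=0..n-j. (a $ j * b $ i) *\<^sub>c x $ (n - j - i))"
      by (simp add: hscale_nth cscale_sum_right cscale_cscale)
    also have "\<dots> = (\<Sum>j=0..n. \<Sum>i=0..j. (a $ i * b $ (j - i)) *\<^sub>c x $ (n - j))"
      by (rule fps_mult_assoc_lemma[symmetric])
    also have "\<dots> = ((a * b) *\<^sub>h x) $ n"
      by (simp add: hscale_nth fps_mult_nth cscale_sum_left)
    finally show "(a *\<^sub>h (b *\<^sub>h x)) $ n = ((a * b) *\<^sub>h x) $ n" .
  qed
qed
end

instance fps :: (calgebra) halgebra
proof
  fix a :: "complex fps" and x y :: "'a fps"
  have L: "(a *\<^sub>h (x * y)) $ n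
      = (\<Sum>j=0..n. \<Sum>i=0..j. (a $ i) *\<^sub>c (x $ (j - i) * y $ (n - j)))" for n
    unfolding hscale_nth fps_mult_nth cscale_sum_right
    by (rule fps_mult_assoc_lemma[symmetric])
  show "(a *\<^sub>h x) * y = a *\<^sub>h (x * y)"
    by (rule fps_ext) (simp only: L,
      simp add: hscale_nth fps_mult_nth sum_distrib_right cscale_mult_left)
  show "x * (a *\<^sub>h y) = a *\<^sub>h (x * y)"
  proof (rule fps_ext)
    fix n
    have "(x * (a *\<^sub>h y)) $ n
        = (\<Sum>j=0..n. \<Sum>i=0..n-j. (a $ i) *\<^sub>c (x $ j * y $ (n - j - i)))"
      by (simp add: hscale_nth fps_mult_nth sum_distrib_left cscale_mult_right)
    also have "\<dots> = (\<Sum>j=0..n. \<Sum>i=0..j. (a $ (j - i)) *\<^sub>c (x $ i * y $ (n - j)))"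
      by (rule fps_mult_assoc_lemma[symmetric])
    also have "\<dots> = (\<Sum>j=0..n. \<Sum>i=0..j. (a $ i) *\<^sub>c (x $ (j - i) * y $ (n - j)))"
    proof (rule sum.cong[OF refl])
      fix j
      show "(\<Sum>i=0..j. (a $ (j - i)) *\<^sub>c (x $ i * y $ (n - j)))
          = (\<Sum>i=0..j. (a $ i) *\<^sub>c (x $ (j - i) * y $ (n - j)))"
        by (rule sum.reindex_bij_witness[where i="\<lambda>i. j - i" and j="\<lambda>i. j - i"]) auto
    qed
    finally show "(x * (a *\<^sub>h y)) $ n = (a *\<^sub>h (x * y)) $ n" by (simp only: L)
  qed
qed

lemma equivp_cosets:
  fixes K :: "'a::ab_group_add set"
  assumes "0 \<in> K" "\<And>x y. x \<in> K \<Longrightarrow> y \<in> K \<Longrightarrow> x + y \<in> K" "\<And>x. x \<in> K \<Longrightarrow> - x \<in> K"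
  shows "equivp (\<lambda>x y. x - y \<in> K)"
proof (rule equivpI)
  show "reflp (\<lambda>x y. x - y \<in> K)" by (simp add: reflp_def assms(1))
  show "symp (\<lambda>x y. x - y \<in> K)" using assms(3) by (force intro!: sympI)
  show "transp (\<lambda>x y. x - y \<in> K)" using assms(2) by (force intro!: transpI)
qed

text \<open>An \<open>h\<close>-linear map commutes with multiplication by \<open>h\<close> and hence is automatically \<open>h\<close>-adically
  continuous; so on the separated modules used below it is determined by its values on pure tensors
  or, if multiplicative, on algebra generators. This is what makes the definite descriptions below
  unique.\<close>

definition hlinear :: "('a::hmodule \<Rightarrow> 'b::hmodule) \<Rightarrow> bool"
  where "hlinear f \<longleftrightarrow> (\<forall>x y. f (x + y) = f x + f y) \<and> (\<forall>c x. f (c *\<^sub>h x) = c *\<^sub>h f x)"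

definition hbilinear :: "('a::hmodule \<Rightarrow> 'b::hmodule \<Rightarrow> 'c::hmodule) \<Rightarrow> bool"
  where "hbilinear f \<longleftrightarrow> (\<forall>x. hlinear (f x)) \<and> (\<forall>y. hlinear (\<lambda>x. f x y))"

definition hcong :: "'a::hmodule \<Rightarrow> 'a \<Rightarrow> bool"
  where "hcong x y \<longleftrightarrow> (\<exists>z. x - y = fps_X *\<^sub>h z)"


section \<open>The completed tensor product\<close>

text \<open>The completed tensor product of \<open>A\<close> and \<open>B\<close> over \<open>\<complex>[[h]]\<close> is the \<open>h\<close>-adic completion of the free
  \<open>\<complex>[[h]]\<close>-module on \<open>A \<times> B\<close>, which is \<open>V[[h]]\<close> for the free complex vector space \<open>V\<close> on \<open>A \<times> B\<close>,
  modulo the \<open>h\<close>-adic closure of the submodule generated by the bilinearity relations. For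
  \<open>A = F[[h]]\<close> and \<open>B = G[[h]]\<close> it is \<open>(F \<otimes> G)[[h]]\<close>.\<close>

definition hsubmodule :: "'a::hmodule set \<Rightarrow> bool"
  where "hsubmodule S \<longleftrightarrow> 0 \<in> S \<and> (\<forall>x\<in>S. \<forall>y\<in>S. x + y \<in> S) \<and> (\<forall>c. \<forall>x\<in>S. c *\<^sub>h x \<in> S)"

definition hpair :: "'a \<Rightarrow> 'b \<Rightarrow> ('a \<times> 'b \<Rightarrow>\<^sub>0 complex) fps"
  where "hpair a b = fps_const (Poly_Mapping.single (a, b) 1)"

definition tensor_relators :: "('a::hmodule \<times> 'b::hmodule \<Rightarrow>\<^sub>0 complex) fps set"
  where "tensor_relators =
      {hpair (a + a') b - hpair a b - hpair a' b | a a' b. True}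
    \<union> {hpair a (b + b') - hpair a b - hpair a b' | a b b'. True}
    \<union> {hpair (c *\<^sub>h a) b - c *\<^sub>h hpair a b | c a b. True}
    \<union> {hpair a (c *\<^sub>h b) - c *\<^sub>h hpair a b | c a b. True}"

definition tensor_kernel :: "('a::hmodule \<times> 'b::hmodule \<Rightarrow>\<^sub>0 complex) fps set"
  where "tensor_kernel = (\<lambda>S. hsubmodule S \<and> closed S) hull tensor_relators"

lemma hsubmodule_tensor_kernel: "hsubmodule tensor_kernel"
  unfolding tensor_kernel_def hull_def hsubmodule_def by blast

lemma tensor_kernel_closure:
  shows "0 \<in> tensor_kernel"
    and "x \<in> tensor_kernel \<Longrightarrow> y \<in> tensor_kernel \<Longrightarrow> x + y \<in> tensor_kernel"
    and "x \<in> tensor_kernel \<Longrightarrow> c *\<^sub>h x \<in> tensor_kernel"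
    and "x \<in> tensor_kernel \<Longrightarrow> - x \<in> tensor_kernel"
proof -
  show "0 \<in> tensor_kernel"
    and "x \<in> tensor_kernel \<Longrightarrow> y \<in> tensor_kernel \<Longrightarrow> x + y \<in> tensor_kernel"
    and s: "x \<in> tensor_kernel \<Longrightarrow> c *\<^sub>h x \<in> tensor_kernel" for c
    using hsubmodule_tensor_kernel unfolding hsubmodule_def by blast+
  have "(- 1) *\<^sub>h x = - x"
    using hscale_add_left[of 1 "- 1" x] hscale_add_left[of 0 0 x]
    by (simp add: hscale_one eq_neg_iff_add_eq_0 add.commute)
  thus "x \<in> tensor_kernel \<Longrightarrow> - x \<in> tensor_kernel" using s[of "- 1"] by simp
qed

definition tensor_eq ::
  "('a::hmodule \<times> 'b::hmodule \<Rightarrow>\<^sub>0 complex) fps \<Rightarrow> ('a \<times> 'b \<Rightarrow>\<^sub>0 complex) fps \<Rightarrow> bool"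
  where "tensor_eq x y \<longleftrightarrow> x - y \<in> tensor_kernel"

lemma equivp_tensor_eq: "equivp tensor_eq"
  unfolding tensor_eq_def[abs_def] by (rule equivp_cosets) (rule tensor_kernel_closure; assumption)+

lemma tensor_eqI: "x = y \<Longrightarrow> tensor_eq x y"
  by (simp add: tensor_eq_def tensor_kernel_closure)

quotient_type (overloaded) ('a, 'b) htensor =
  "('a::hmodule \<times> 'b::hmodule \<Rightarrow>\<^sub>0 complex) fps" / tensor_eq
  by (rule equivp_tensor_eq)

instantiation htensor :: (hmodule, hmodule) hmodule
begin

lift_definition zero_htensor :: "('a, 'b) htensor" is 0 .

lift_definition plus_htensor :: "('a, 'b) htensor \<Rightarrow> ('a, 'b) htensor \<Rightarrow> ('a, 'b) htensor" is "(+)"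
  unfolding tensor_eq_def by (subst add_diff_add) (rule tensor_kernel_closure(2))

lift_definition uminus_htensor :: "('a, 'b) htensor \<Rightarrow> ('a, 'b) htensor" is uminus
  unfolding tensor_eq_def by (subst minus_diff_minus) (rule tensor_kernel_closure(4))

lift_definition minus_htensor :: "('a, 'b) htensor \<Rightarrow> ('a, 'b) htensor \<Rightarrow> ('a, 'b) htensor" is "(-)"
proof -
  fix x x' y y' :: "('a \<times> 'b \<Rightarrow>\<^sub>0 complex) fps"
  assume "tensor_eq x x'" "tensor_eq y y'"
  hence "(x - x') + - (y - y') \<in> tensor_kernel"
    unfolding tensor_eq_def by (intro tensor_kernel_closure(2,4))
  thus "tensor_eq (x - y) (x' - y')" by (simp add: tensor_eq_def algebra_simps)
qed

lift_definition hscale_htensor :: "complex fps \<Rightarrow> ('a, 'b) htensor \<Rightarrow> ('a, 'b) htensor" is hscale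
  unfolding tensor_eq_def by (subst hscale_diff_right[symmetric]) (rule tensor_kernel_closure(3))

instance
  by standard (transfer, rule tensor_eqI, simp add: hscale_add_right hscale_add_left
      hscale_hscale hscale_one)+

end

lift_definition htens :: "'a::hmodule \<Rightarrow> 'b::hmodule \<Rightarrow> ('a, 'b) htensor" (infixr "\<otimes>\<^sub>h" 73) is hpair .

lemma hbilinear_htens: "hbilinear (htens :: 'a::hmodule \<Rightarrow> 'b::hmodule \<Rightarrow> _)"
proof -
  have r: "x \<in> tensor_relators \<Longrightarrow> x \<in> tensor_kernel" for x :: "('a \<times> 'b \<Rightarrow>\<^sub>0 complex) fps"
    unfolding tensor_kernel_def by (rule hull_inc)
  have "hpair (a + a') b - (hpair a b + hpair a' b) \<in> tensor_kernel" for a a' :: 'a and b :: 'b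
    unfolding diff_diff_eq[symmetric] by (rule r, unfold tensor_relators_def)
      (rule UnI1, rule UnI1, rule UnI1, rule CollectI, rule exI[of _ a], rule exI[of _ a'],
        rule exI[of _ b], rule conjI[OF refl TrueI])
  hence "(a + a') \<otimes>\<^sub>h b = a \<otimes>\<^sub>h b + a' \<otimes>\<^sub>h b" for a a' :: 'a and b :: 'b
    by transfer (simp only: tensor_eq_def)
  moreover have "hpair a (b + b') - (hpair a b + hpair a b') \<in> tensor_kernel" for a :: 'a and b b' :: 'b
    unfolding diff_diff_eq[symmetric] by (rule r, unfold tensor_relators_def)
      (rule UnI1, rule UnI1, rule UnI2, rule CollectI, rule exI[of _ a], rule exI[of _ b], rule exI[of _ b'],
        rule conjI[OF refl TrueI])
  hence "a \<otimes>\<^sub>h (b + b') = a \<otimes>\<^sub>h b + a \<otimes>\<^sub>h b'" for a :: 'a and b b' :: 'b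
    by transfer (simp only: tensor_eq_def)
  moreover have "hpair (c *\<^sub>h a) b - c *\<^sub>h hpair a b \<in> tensor_kernel" for c and a :: 'a and b :: 'b
    by (rule r, unfold tensor_relators_def)
      (rule UnI1, rule UnI2, rule CollectI, rule exI[of _ c], rule exI[of _ a], rule exI[of _ b],
        rule conjI[OF refl TrueI])
  hence "(c *\<^sub>h a) \<otimes>\<^sub>h b = c *\<^sub>h (a \<otimes>\<^sub>h b)" for c and a :: 'a and b :: 'b
    by transfer (simp only: tensor_eq_def)
  moreover have "hpair a (c *\<^sub>h b) - c *\<^sub>h hpair a b \<in> tensor_kernel" for c and a :: 'a and b :: 'b
    by (rule r, unfold tensor_relators_def)
      (rule UnI2, rule CollectI, rule exI[of _ c], rule exI[of _ a], rule exI[of _ b],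
        rule conjI[OF refl TrueI])
  hence "a \<otimes>\<^sub>h (c *\<^sub>h b) = c *\<^sub>h (a \<otimes>\<^sub>h b)" for c and a :: 'a and b :: 'b
    by transfer (simp only: tensor_eq_def)
  ultimately show ?thesis by (simp add: hbilinear_def hlinear_def)
qed

text \<open>Sweedler notation: \<open>sweedler b t\<close> is \<open>\<Sum> b t\<^sub>(\<^sub>1\<^sub>) t\<^sub>(\<^sub>2\<^sub>)\<close>, the extension of the bilinear map
  \<open>b\<close> (into an \<open>h\<close>-adically complete module) to the completed tensor product.\<close>

definition sweedler ::
  "('a::hmodule \<Rightarrow> 'b::hmodule \<Rightarrow> 'c::hmodule) \<Rightarrow> ('a, 'b) htensor \<Rightarrow> 'c"
  where "sweedler b = (THE F. hlinear F \<and> (\<forall>x y. F (x \<otimes>\<^sub>h y) = b x y))"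

definition tensor_mult ::
  "('a::halgebra, 'b::halgebra) htensor \<Rightarrow> ('a, 'b) htensor \<Rightarrow> ('a, 'b) htensor"
  where "tensor_mult = (THE m. hbilinear m \<and>
    (\<forall>a b c d. m (a \<otimes>\<^sub>h b) (c \<otimes>\<^sub>h d) = (a * c) \<otimes>\<^sub>h (b * d)))"


section \<open>Module algebras and smash products\<close>

definition halgebra_hom ::
  "('a::hmodule \<Rightarrow> 'a \<Rightarrow> 'a) \<Rightarrow> 'a \<Rightarrow> ('b::hmodule \<Rightarrow> 'b \<Rightarrow> 'b) \<Rightarrow> 'b \<Rightarrow> ('a \<Rightarrow> 'b) \<Rightarrow> bool"
  where "halgebra_hom mA oneA mB oneB f \<longleftrightarrow>
    hlinear f \<and> f oneA = oneB \<and> (\<forall>x y. f (mA x y) = mB (f x) (f y))"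

definition halgebra_iso ::
  "('a::hmodule \<Rightarrow> 'a \<Rightarrow> 'a) \<Rightarrow> 'a \<Rightarrow> ('b::hmodule \<Rightarrow> 'b \<Rightarrow> 'b) \<Rightarrow> 'b \<Rightarrow> ('a \<Rightarrow> 'b) \<Rightarrow> bool"
  where "halgebra_iso mA oneA mB oneB f \<longleftrightarrow> halgebra_hom mA oneA mB oneB f \<and> bij f"

definition module_algebra ::
  "('h::halgebra \<Rightarrow> ('h, 'h) htensor) \<Rightarrow> ('h \<Rightarrow> complex fps) \<Rightarrow> ('h \<Rightarrow> 'a::halgebra \<Rightarrow> 'a) \<Rightarrow> bool"
  where "module_algebra \<Delta> \<epsilon> act \<longleftrightarrow> hbilinear act
    \<and> (\<forall>a. act 1 a = a)
    \<and> (\<forall>L M a. act (L * M) a = act L (act M a))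
    \<and> (\<forall>L. act L 1 = \<epsilon> L *\<^sub>h 1)
    \<and> (\<forall>L a b. act L (a * b) = sweedler (\<lambda>L1 L2. act L1 a * act L2 b) (\<Delta> L))"

definition smash_mult ::
  "('h::halgebra \<Rightarrow> ('h, 'h) htensor) \<Rightarrow> ('h \<Rightarrow> 'a::halgebra \<Rightarrow> 'a)
    \<Rightarrow> ('a, 'h) htensor \<Rightarrow> ('a, 'h) htensor \<Rightarrow> ('a, 'h) htensor"
  where "smash_mult \<Delta> act = (THE m. hbilinear m \<and>
    (\<forall>f L g M. m (f \<otimes>\<^sub>h L) (g \<otimes>\<^sub>h M)
       = sweedler (\<lambda>L1 L2. (f * act L1 g) \<otimes>\<^sub>h (L2 * M)) (\<Delta> L)))"


section \<open>Free algebras and two-sided ideals\<close>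

datatype 'g word = Word (letters: "'g list")

instantiation word :: (type) monoid_add
begin
definition zero_word :: "'a word" where "0 = Word []"
definition plus_word :: "'a word \<Rightarrow> 'a word \<Rightarrow> 'a word" where "v + w = Word (letters v @ letters w)"
instance by standard (auto simp: zero_word_def plus_word_def)
end

type_synonym 'g free_algebra = "'g word \<Rightarrow>\<^sub>0 complex"

definition free_gen :: "'g \<Rightarrow> 'g free_algebra"
  where "free_gen g = Poly_Mapping.single (Word [g]) 1"

definition comm :: "'a::ring \<Rightarrow> 'a \<Rightarrow> 'a"
  where "comm x y = x * y - y * x"

definition two_sided_ideal :: "'a::ring_1 set \<Rightarrow> bool"
  where "two_sided_ideal I \<longleftrightarrow>
    0 \<in> I \<and> (\<forall>x\<in>I. \<forall>y\<in>I. x + y \<in> I) \<and> (\<forall>r. \<forall>x\<in>I. r * x \<in> I \<and> x * r \<in> I)"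

lemma two_sided_idealD:
  assumes "two_sided_ideal I"
  shows "0 \<in> I" "x \<in> I \<Longrightarrow> y \<in> I \<Longrightarrow> x + y \<in> I" "x \<in> I \<Longrightarrow> r * x \<in> I" "x \<in> I \<Longrightarrow> x * r \<in> I"
    "x \<in> I \<Longrightarrow> - x \<in> I" "x \<in> I \<Longrightarrow> y \<in> I \<Longrightarrow> x - y \<in> I"
proof -
  show *: "0 \<in> I" "x \<in> I \<Longrightarrow> y \<in> I \<Longrightarrow> x + y \<in> I" "x \<in> I \<Longrightarrow> r * x \<in> I" "x \<in> I \<Longrightarrow> x * r \<in> I" for x y r
    using assms unfolding two_sided_ideal_def by blast+
  show n: "x \<in> I \<Longrightarrow> - x \<in> I" for x using *(3)[of x "- 1"] by simp
  show "x \<in> I \<Longrightarrow> y \<in> I \<Longrightarrow> x - y \<in> I" using *(2)[of x "- y"] n by simp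
qed

lemma ideal_cscale: "two_sided_ideal I \<Longrightarrow> x \<in> I \<Longrightarrow> a *\<^sub>c (x::'a::calgebra) \<in> I"
  using two_sided_idealD(3)[of I x "a *\<^sub>c 1"] by (simp add: cscale_mult_left)

lemma ideal_hscale: "two_sided_ideal I \<Longrightarrow> x \<in> I \<Longrightarrow> a *\<^sub>h (x::'a::halgebra) \<in> I"
  using two_sided_idealD(3)[of I x "a *\<^sub>h 1"] by (simp add: hscale_mult_left)

lemma equivp_ideal: "two_sided_ideal I \<Longrightarrow> equivp (\<lambda>x y. x - y \<in> I)"
  by (rule equivp_cosets) (rule two_sided_idealD; assumption)+

lemma ideal_congruence:
  assumes "two_sided_ideal I" "x - x' \<in> I" "y - y' \<in> I"
  shows "(x + y) - (x' + y') \<in> I" "(x - y) - (x' - y') \<in> I" "(- x) - (- x') \<in> I"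
    "x * y - x' * y' \<in> I"
proof -
  note I = two_sided_idealD[OF assms(1)]
  show "(x + y) - (x' + y') \<in> I" using I(2)[OF assms(2,3)] by (simp add: algebra_simps)
  show "(x - y) - (x' - y') \<in> I" using I(6)[OF assms(2,3)] by (simp add: algebra_simps)
  show "(- x) - (- x') \<in> I" using I(5)[OF assms(2)] by (simp add: algebra_simps)
  have "(x - x') * y + x' * (y - y') \<in> I" using I assms by blast
  thus "x * y - x' * y' \<in> I" by (simp add: algebra_simps)
qed

text \<open>The constant term is multiplicative, so ideals generated by relators without constant term
  are proper (as required by \<^class>\<open>ring_1\<close>).\<close>

lemma lookup_mult_zero_word:
  "Poly_Mapping.lookup (p * q) 0 = Poly_Mapping.lookup p 0 * Poly_Mapping.lookup (q :: 'g free_algebra) 0"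
proof -
  have z: "(0 :: 'g word) = k + q \<longleftrightarrow> k = 0 \<and> q = 0" for k q :: "'g word"
    by (cases k; cases q) (auto simp: zero_word_def plus_word_def)
  have inner: "(\<Sum>q'. Poly_Mapping.lookup q q' when (0::'g word) = k + q') = (Poly_Mapping.lookup q 0 when k = 0)" for k
    unfolding z by (cases "k = 0") (simp_all add: when_def)
  show ?thesis
    unfolding lookup_mult inner by (simp add: when_def if_distrib cong: if_cong)
qed

lemma lookup_free_gen_zero: "Poly_Mapping.lookup (free_gen g) 0 = 0"
  by (simp add: free_gen_def lookup_single zero_word_def)

lemmas constant_term_simps = comm_def lookup_minus lookup_sum lookup_cscale lookup_mult_zero_word
  lookup_free_gen_zero

lemma two_sided_ideal_augmentation: "two_sided_ideal {p :: 'g free_algebra. Poly_Mapping.lookup p 0 = 0}"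
  by (simp add: two_sided_ideal_def lookup_add lookup_mult_zero_word)

lemma two_sided_ideal_fps_augmentation:
  "two_sided_ideal {f :: 'g free_algebra fps. Poly_Mapping.lookup (f $ 0) 0 = 0}"
  by (simp add: two_sided_ideal_def lookup_add lookup_mult_zero_word)

lemma closed_fps_augmentation: "closed {f :: 'g free_algebra fps. Poly_Mapping.lookup (f $ 0) 0 = 0}"
  unfolding closed_def open_fps_def
proof (intro ballI exI conjI)
  fix f :: "'g free_algebra fps"
  assume f: "f \<in> - {f. Poly_Mapping.lookup (f $ 0) 0 = 0}"
  show "(1::real) > 0" by simp
  show "{g. dist g f < 1} \<subseteq> - {f. Poly_Mapping.lookup (f $ 0) 0 = 0}"
  proof
    fix g assume "g \<in> {g. dist g f < 1}"
    hence "g = f \<or> subdegree (g - f) \<noteq> 0"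
      by (cases "subdegree (g - f) = 0") (auto simp: dist_fps_def split: if_splits)
    hence "(g - f) $ 0 = 0" using nth_less_subdegree_zero[of 0 "g - f"] by auto
    thus "g \<in> - {f. Poly_Mapping.lookup (f $ 0) 0 = 0}" using f by auto
  qed
qed


section \<open>Indices\<close>

datatype space = I1 | I2 | I3

datatype spacetime = Tm | Sp space

lemma UNIV_space: "UNIV = {I1, I2, I3}"
  using space.exhaust by auto

lemma UNIV_spacetime: "UNIV = {Tm, Sp I1, Sp I2, Sp I3}"
proof -
  have "x \<in> {Tm, Sp I1, Sp I2, Sp I3}" for x
  proof (cases x)
    case (Sp i)
    thus ?thesis by (cases i) simp_all
  qed simp
  thus ?thesis by blast
qed

instance space :: finite by standard (simp add: UNIV_space)
instance spacetime :: finite by standard (simp add: UNIV_spacetime)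

text \<open>The diagonal entries of the metric.\<close>

fun eta :: "spacetime \<Rightarrow> complex" where
  "eta Tm = - 1"
| "eta (Sp _) = 1"

definition delta :: "'i \<Rightarrow> 'i \<Rightarrow> complex"
  where "delta i j = (if i = j then 1 else 0)"

fun eps :: "space \<Rightarrow> space \<Rightarrow> space \<Rightarrow> complex" where
  "eps I1 I2 I3 = 1"
| "eps I2 I3 I1 = 1"
| "eps I3 I1 I2 = 1"
| "eps I1 I3 I2 = - 1"
| "eps I3 I2 I1 = - 1"
| "eps I2 I1 I3 = - 1"
| "eps _ _ _ = 0"

lemma eps_antisym: "eps j i k = - eps i j k" "eps i k j = - eps i j k"
  by (cases i; cases j; cases k; simp)+


section \<open>The enveloping algebra of the Poincare Lie algebra\<close>

datatype io_gen = GM space | GN space | GP spacetime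

definition io_relators :: "io_gen free_algebra set" where
  "io_relators = (let M = (\<lambda>i. free_gen (GM i)); N = (\<lambda>i. free_gen (GN i)); P = (\<lambda>\<mu>. free_gen (GP \<mu>)) in
      {comm (M i) (M j) - (\<Sum>k\<in>UNIV. (\<i> * eps i j k) *\<^sub>c M k) | i j. True}
    \<union> {comm (M i) (N j) - (\<Sum>k\<in>UNIV. (\<i> * eps i j k) *\<^sub>c N k) | i j. True}
    \<union> {comm (N i) (N j) - (\<Sum>k\<in>UNIV. (- \<i> * eps i j k) *\<^sub>c M k) | i j. True}
    \<union> {comm (P \<mu>) (P \<nu>) | \<mu> \<nu>. True}
    \<union> {comm (M j) (P Tm) | j. True}
    \<union> {comm (M j) (P (Sp k)) - (\<Sum>l\<in>UNIV. (\<i> * eps j k l) *\<^sub>c P (Sp l)) | j k. True}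
    \<union> {comm (N j) (P (Sp k)) - (- \<i> * delta j k) *\<^sub>c P Tm | j k. True}
    \<union> {comm (N j) (P Tm) - (- \<i>) *\<^sub>c P (Sp j) | j. True})"

definition io_ideal :: "io_gen free_algebra set"
  where "io_ideal = two_sided_ideal hull io_relators"

lemma two_sided_ideal_io: "two_sided_ideal io_ideal"
  unfolding io_ideal_def hull_def two_sided_ideal_def by blast

lemma one_notin_io_ideal: "1 \<notin> io_ideal"
proof -
  have "io_relators \<subseteq> {p. Poly_Mapping.lookup p 0 = 0}"
    unfolding io_relators_def Let_def
    by (intro Un_least subsetI CollectI; elim CollectE exE conjE)
      (simp_all add: constant_term_simps)
  hence "io_ideal \<subseteq> {p. Poly_Mapping.lookup p 0 = 0}"
    unfolding io_ideal_def by (rule hull_minimal) (rule two_sided_ideal_augmentation)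
  thus ?thesis by (auto simp: lookup_one)
qed

definition io_eq :: "io_gen free_algebra \<Rightarrow> io_gen free_algebra \<Rightarrow> bool"
  where "io_eq x y \<longleftrightarrow> x - y \<in> io_ideal"

lemma io_eqI: "x = y \<Longrightarrow> io_eq x y"
  by (simp add: io_eq_def two_sided_idealD(1)[OF two_sided_ideal_io])

quotient_type uio = "io_gen free_algebra" / io_eq
  using equivp_ideal[OF two_sided_ideal_io] by (simp add: io_eq_def[abs_def])

instantiation uio :: calgebra
begin

lift_definition zero_uio :: uio is 0 .
lift_definition one_uio :: uio is 1 .
lift_definition plus_uio :: "uio \<Rightarrow> uio \<Rightarrow> uio" is "(+)"
  unfolding io_eq_def by (rule ideal_congruence[OF two_sided_ideal_io])
lift_definition minus_uio :: "uio \<Rightarrow> uio \<Rightarrow> uio" is "(-)"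
  unfolding io_eq_def by (rule ideal_congruence[OF two_sided_ideal_io])
lift_definition uminus_uio :: "uio \<Rightarrow> uio" is uminus
  unfolding io_eq_def by (rule ideal_congruence[OF two_sided_ideal_io])
lift_definition times_uio :: "uio \<Rightarrow> uio \<Rightarrow> uio" is "(*)"
  unfolding io_eq_def by (rule ideal_congruence[OF two_sided_ideal_io])
lift_definition cscale_uio :: "complex \<Rightarrow> uio \<Rightarrow> uio" is cscale
  unfolding io_eq_def
  by (subst cscale_diff_right[symmetric]) (rule ideal_cscale[OF two_sided_ideal_io])

instance
proof
  show "(0::uio) \<noteq> 1"
    using one_notin_io_ideal two_sided_idealD(5)[OF two_sided_ideal_io, of "- 1"]
    by transfer (auto simp: io_eq_def)
qed (transfer, rule io_eqI, simp add: algebra_simps cscale_add_right cscale_add_left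
      cscale_cscale cscale_one cscale_mult_left
      cscale_mult_right)+

end

lift_definition io :: "io_gen \<Rightarrow> uio" is free_gen .

type_synonym uio_h = "uio fps"

definition Mg :: "space \<Rightarrow> uio_h" where "Mg i = fps_const (io (GM i))"
definition Ng :: "space \<Rightarrow> uio_h" where "Ng i = fps_const (io (GN i))"
definition Pg :: "spacetime \<Rightarrow> uio_h" where "Pg \<mu> = fps_const (io (GP \<mu>))"

text \<open>The antisymmetric tensor with components \<open>M\<^sub>0\<^sub>i = N\<^sub>i\<close> and \<open>M\<^sub>i\<^sub>j = \<epsilon>\<^sub>i\<^sub>j\<^sub>k M\<^sub>k\<close>.\<close>

fun Mten :: "spacetime \<Rightarrow> spacetime \<Rightarrow> uio_h" where
  "Mten Tm Tm = 0"
| "Mten Tm (Sp i) = Ng i"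
| "Mten (Sp i) Tm = - Ng i"
| "Mten (Sp i) (Sp j) = (\<Sum>k\<in>UNIV. fps_const (eps i j k) *\<^sub>h Mg k)"

definition counit :: "uio_h \<Rightarrow> complex fps"
  where "counit = (THE \<epsilon>. halgebra_hom (*) 1 (*) 1 \<epsilon> \<and>
    (\<forall>i. \<epsilon> (Mg i) = 0) \<and> (\<forall>i. \<epsilon> (Ng i) = 0) \<and> (\<forall>\<mu>. \<epsilon> (Pg \<mu>) = 0))"

text \<open>The values of the action on generators; here \<open>X \<mu>\<close> is the generator with lower index, so that
  \<open>X\<^sup>\<mu>\<close> is \<open>fps_const (eta \<mu>) *\<^sub>h X \<mu>\<close>.\<close>

definition vector_action :: "(spacetime \<Rightarrow> 'a::halgebra) \<Rightarrow> (uio_h \<Rightarrow> 'a \<Rightarrow> 'a) \<Rightarrow> bool"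
  where "vector_action X act \<longleftrightarrow>
      (\<forall>\<mu> \<nu>. act (Pg \<mu>) (fps_const (eta \<nu>) *\<^sub>h X \<nu>) = fps_const (- \<i> * delta \<mu> \<nu>) *\<^sub>h 1)
    \<and> (\<forall>\<mu> \<nu> \<rho>. act (Mten \<mu> \<nu>) (fps_const (eta \<rho>) *\<^sub>h X \<rho>)
        = fps_const (\<i> * delta \<mu> \<rho>) *\<^sub>h X \<nu> - fps_const (\<i> * delta \<nu> \<rho>) *\<^sub>h X \<mu>)"


section \<open>The undeformed algebra\<close>

definition primitive_coproduct :: "uio_h \<Rightarrow> (uio_h, uio_h) htensor"
  where "primitive_coproduct = (THE \<Delta>. halgebra_hom (*) 1 tensor_mult (1 \<otimes>\<^sub>h 1) \<Delta> \<and>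
    (\<forall>g. \<Delta> (fps_const (io g)) = fps_const (io g) \<otimes>\<^sub>h 1 + 1 \<otimes>\<^sub>h fps_const (io g)))"

type_synonym x4 = "(spacetime \<Rightarrow>\<^sub>0 nat) \<Rightarrow>\<^sub>0 complex"

text \<open>The polynomial variables are the \<open>x\<^sup>\<mu>\<close>; \<open>xg \<mu>\<close> is \<open>x\<^sub>\<mu>\<close>.\<close>

definition xg :: "spacetime \<Rightarrow> x4 fps"
  where "xg \<mu> = fps_const (eta \<mu> *\<^sub>c Poly_Mapping.single (Poly_Mapping.single \<mu> 1) 1)"

definition classical_action :: "uio_h \<Rightarrow> x4 fps \<Rightarrow> x4 fps"
  where "classical_action =
    (THE act. module_algebra primitive_coproduct counit act \<and> vector_action xg act)"

type_synonym undeformed = "(x4 fps, uio_h) htensor"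

definition undeformed_mult :: "undeformed \<Rightarrow> undeformed \<Rightarrow> undeformed"
  where "undeformed_mult = smash_mult primitive_coproduct classical_action"


section \<open>Kappa-Minkowski spacetime\<close>

definition an3_relators :: "spacetime free_algebra fps set" where
  "an3_relators = (let X = (\<lambda>\<mu>. fps_const (free_gen \<mu>)) in
      {comm (X Tm) (X (Sp i)) - (- fps_const \<i> * fps_X) *\<^sub>h X (Sp i) | i. True}
    \<union> {comm (X (Sp j)) (X (Sp k)) | j k. True})"

definition an3_ideal :: "spacetime free_algebra fps set"
  where "an3_ideal = (\<lambda>I. two_sided_ideal I \<and> closed I) hull an3_relators"

lemma two_sided_ideal_an3: "two_sided_ideal an3_ideal"
  unfolding an3_ideal_def hull_def two_sided_ideal_def by blast

lemma one_notin_an3_ideal: "1 \<notin> an3_ideal"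
proof -
  have "an3_relators \<subseteq> {f. Poly_Mapping.lookup (f $ 0) 0 = 0}"
    unfolding an3_relators_def Let_def
    by (intro Un_least subsetI CollectI; elim CollectE exE conjE)
      (simp_all add: constant_term_simps hscale_nth)
  hence "an3_ideal \<subseteq> {f. Poly_Mapping.lookup (f $ 0) 0 = 0}"
    unfolding an3_ideal_def
    by (rule hull_minimal) (simp add: two_sided_ideal_fps_augmentation closed_fps_augmentation)
  thus ?thesis by (auto simp: lookup_one)
qed

definition an3_eq :: "spacetime free_algebra fps \<Rightarrow> spacetime free_algebra fps \<Rightarrow> bool"
  where "an3_eq x y \<longleftrightarrow> x - y \<in> an3_ideal"

lemma an3_eqI: "x = y \<Longrightarrow> an3_eq x y"
  by (simp add: an3_eq_def two_sided_idealD(1)[OF two_sided_ideal_an3])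

quotient_type uan3 = "spacetime free_algebra fps" / an3_eq
  using equivp_ideal[OF two_sided_ideal_an3] by (simp add: an3_eq_def[abs_def])

instantiation uan3 :: halgebra
begin

lift_definition zero_uan3 :: uan3 is 0 .
lift_definition one_uan3 :: uan3 is 1 .
lift_definition plus_uan3 :: "uan3 \<Rightarrow> uan3 \<Rightarrow> uan3" is "(+)"
  unfolding an3_eq_def by (rule ideal_congruence[OF two_sided_ideal_an3])
lift_definition minus_uan3 :: "uan3 \<Rightarrow> uan3 \<Rightarrow> uan3" is "(-)"
  unfolding an3_eq_def by (rule ideal_congruence[OF two_sided_ideal_an3])
lift_definition uminus_uan3 :: "uan3 \<Rightarrow> uan3" is uminus
  unfolding an3_eq_def by (rule ideal_congruence[OF two_sided_ideal_an3])
lift_definition times_uan3 :: "uan3 \<Rightarrow> uan3 \<Rightarrow> uan3" is "(*)"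
  unfolding an3_eq_def by (rule ideal_congruence[OF two_sided_ideal_an3])
lift_definition hscale_uan3 :: "complex fps \<Rightarrow> uan3 \<Rightarrow> uan3" is hscale
  unfolding an3_eq_def
  by (subst hscale_diff_right[symmetric]) (rule ideal_hscale[OF two_sided_ideal_an3])

instance
proof
  show "(0::uan3) \<noteq> 1"
    using one_notin_an3_ideal two_sided_idealD(5)[OF two_sided_ideal_an3, of "- 1"]
    by transfer (auto simp: an3_eq_def)
qed (transfer, rule an3_eqI, simp add: algebra_simps hscale_add_right hscale_add_left
      hscale_hscale hscale_one hscale_mult_left
      hscale_mult_right)+

end

lift_definition Xg :: "spacetime \<Rightarrow> uan3" is "\<lambda>\<mu>. fps_const (free_gen \<mu>)" .


section \<open>The kappa-Poincare coproduct and the DSR algebra\<close>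

definition P2 :: uio
  where "P2 = (\<Sum>i\<in>UNIV. io (GP (Sp i)) ^ 2) - io (GP Tm) ^ 2"

text \<open>The binomial series of \<open>\<surd>(1 - h\<^sup>2 P\<^sup>2)\<close>.\<close>

definition sqrtP :: uio_h
  where "sqrtP = Abs_fps (\<lambda>n. if even n then ((1/2) gchoose (n div 2)) *\<^sub>c ((- P2) ^ (n div 2)) else 0)"

definition Xi :: uio_h
  where "Xi = fps_X *\<^sub>h Pg Tm + sqrtP"

definition Xi_inv :: uio_h
  where "Xi_inv = fps_left_inverse Xi 1"

lemma Xi_inv: "Xi_inv * Xi = 1" "Xi * Xi_inv = 1"
proof -
  have "Xi $ 0 = 1" by (simp add: Xi_def hscale_nth sqrtP_def cscale_one)
  thus "Xi_inv * Xi = 1" "Xi * Xi_inv = 1"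
    using fps_left_inverse[of 1 Xi] fps_right_inverse[of Xi 1]
      fps_left_inverse_eq_fps_right_inverse[of 1 Xi 1] by (simp_all add: Xi_inv_def)
qed

definition kappa_coproduct :: "uio_h \<Rightarrow> (uio_h, uio_h) htensor"
  where "kappa_coproduct = (THE \<Delta>. halgebra_hom (*) 1 tensor_mult (1 \<otimes>\<^sub>h 1) \<Delta>
    \<and> (\<forall>i. \<Delta> (Mg i) = Mg i \<otimes>\<^sub>h 1 + 1 \<otimes>\<^sub>h Mg i)
    \<and> (\<forall>i. \<Delta> (Ng i) = Ng i \<otimes>\<^sub>h 1 + Xi_inv \<otimes>\<^sub>h Ng i
          - fps_X *\<^sub>h (\<Sum>j\<in>UNIV. \<Sum>m\<in>UNIV.
              fps_const (eps i j m) *\<^sub>h ((Pg (Sp j) * Xi_inv) \<otimes>\<^sub>h Mg m)))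
    \<and> (\<forall>i. \<Delta> (Pg (Sp i)) = Pg (Sp i) \<otimes>\<^sub>h Xi + 1 \<otimes>\<^sub>h Pg (Sp i))
    \<and> \<Delta> (Pg Tm) = Pg Tm \<otimes>\<^sub>h Xi + Xi_inv \<otimes>\<^sub>h Pg Tm
          + fps_X *\<^sub>h (\<Sum>m\<in>UNIV. (Pg (Sp m) * Xi_inv) \<otimes>\<^sub>h Pg (Sp m)))"

definition kappa_action :: "uio_h \<Rightarrow> uan3 \<Rightarrow> uan3"
  where "kappa_action =
    (THE act. module_algebra kappa_coproduct counit act \<and> vector_action Xg act)"

type_synonym dsr = "(uan3, uio_h) htensor"

definition dsr_mult :: "dsr \<Rightarrow> dsr \<Rightarrow> dsr"
  where "dsr_mult = smash_mult kappa_coproduct kappa_action"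

text \<open>Modulo \<open>h\<close>, the tensors \<open>X\<^sub>\<mu>\<^sub>1 \<cdots> X\<^sub>\<mu>\<^sub>n \<otimes> L\<close> span the DSR algebra, and the identification
  with the undeformed algebra sends them to \<open>x\<^sub>\<mu>\<^sub>1 \<cdots> x\<^sub>\<mu>\<^sub>n \<otimes> L\<close>.\<close>

definition congruent_to_identity :: "(dsr \<Rightarrow> undeformed) \<Rightarrow> bool"
  where "congruent_to_identity \<phi> \<longleftrightarrow>
    (\<forall>\<mu>s L. hcong (\<phi> (prod_list (map Xg \<mu>s) \<otimes>\<^sub>h L)) (prod_list (map xg \<mu>s) \<otimes>\<^sub>h L))"

end

theory Submission
  imports Defs
begin

text \<open>Let \<open>S = \<surd>(1 - h\<^sup>2 P\<^sup>2)\<close>. In terms of \<open>Y\<^sub>0 = X\<^sub>0\<close> and \<open>Y\<^sub>j = X\<^sub>j + h N\<^sub>j\<close> the cross relations of the DSR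
  algebra become Lorentz covariant: \<open>Y\<close> is a Lorentz vector with \<open>[P\<^sub>\<mu>, Y\<^sub>\<nu>] = - \<i> \<eta>\<^sub>\<mu>\<^sub>\<nu> S\<close> and
  \<open>[Y\<^sub>\<mu>, Y\<^sub>\<nu>] = \<i> h\<^sup>2 M\<^sub>\<mu>\<^sub>\<nu>\<close> (Snyder space). In the undeformed algebra the spin part
  \<open>\<Sigma>\<^sub>\<mu>\<^sub>\<nu> = M\<^sub>\<mu>\<^sub>\<nu> - x\<^sub>\<mu> P\<^sub>\<nu> + x\<^sub>\<nu> P\<^sub>\<mu>\<close> of the Lorentz generators commutes with all \<open>x\<close> and \<open>P\<close>, and
  \<open>Y\<^sub>\<mu> = x\<^sub>\<mu> S - h\<^sup>2 (1 + S)\<^sup>-\<^sup>1 \<Sigma>\<^sub>\<mu>\<^sub>\<rho> P\<^sup>\<rho>\<close> solves these relations; the second term is the spin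
  connection of the de Sitter momentum space. Applying this realization to the unit and projecting
  to polynomials identifies kappa-Minkowski space with polynomials linearly, and transports the
  classical action to the deformed one. The resulting homomorphism is the identity modulo \<open>h\<close>, hence
  bijective by \<open>h\<close>-adic completeness.\<close>

section \<open>Complete and separated modules\<close>

text \<open>Extensions to tensor products, coproducts, actions and both smash products are definite
  descriptions, so each calls for existence and uniqueness. Operators on the undeformed tensor
  product circumvent this: composition is associative, cross relations become commutators, and a
  linear identity is checked on generators and passes to \<open>h\<close>-adic closures. The factor
  \<open>(1 + S)^-1\<close> is forced. With a spin term \<open>h^2 c(S) Sig P\<close> the
  coefficient of the spin tensor in \<open>[Y, Y]\<close> is right iff
  \<open>2 c S + c^2 (1 - S^2) = 1\<close>; the roots are \<open>1/(1 + S)\<close> and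
  \<open>-1/(1 - S)\<close>, and only the first is regular at \<open>h = 0\<close>. The kappa
  coproduct enters through the cross relations: induction over products of coordinates turns the
  commutators of the symmetries with the realized coordinates into a Sweedler sum. Evaluated on the
  polynomial 1 this sum is the product rule of the transported action; evaluated on the unit of the
  undeformed algebra it identifies the DSR product as the undeformed one pulled back.\<close>

definition hsmall :: "nat \<Rightarrow> 'a::hmodule \<Rightarrow> bool"
  where "hsmall n x \<longleftrightarrow> (\<exists>z. x = fps_X ^ n *\<^sub>h z)"

lemma hscale_zero_left [simp]: "0 *\<^sub>h (x::'a::hmodule) = 0"
  using hscale_add_left[of 0 0 x] by simp

lemma hscale_minus_left: "(- a) *\<^sub>h (x::'a::hmodule) = - (a *\<^sub>h x)"
  using hscale_add_left[of a "- a" x] by (simp add: eq_neg_iff_add_eq_0 add.commute)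

lemma hscale_sum_right: "a *\<^sub>h (\<Sum>i\<in>I. f i) = (\<Sum>i\<in>I. a *\<^sub>h (f i :: 'a::hmodule))"
  by (induction I rule: infinite_finite_induct) (simp_all add: hscale_add_right)

lemma hscale_left_commute: "a *\<^sub>h b *\<^sub>h (x::'a::hmodule) = b *\<^sub>h a *\<^sub>h x"
  by (simp add: hscale_hscale mult.commute)

lemma hsmall_0 [simp]: "hsmall n 0"
  unfolding hsmall_def by (rule exI[of _ 0]) simp

lemma hsmall_zero_index [simp]: "hsmall 0 x"
  unfolding hsmall_def by (rule exI[of _ x]) (simp add: hscale_one)

lemma hsmall_add: "hsmall n x \<Longrightarrow> hsmall n y \<Longrightarrow> hsmall n (x + y)"
  unfolding hsmall_def by (auto simp: hscale_add_right[symmetric])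

lemma hsmall_minus: "hsmall n x \<Longrightarrow> hsmall n (- x)"
  unfolding hsmall_def by (auto simp: hscale_minus_right[symmetric])

lemma hsmall_diff: "hsmall n x \<Longrightarrow> hsmall n y \<Longrightarrow> hsmall n (x - y)"
  unfolding hsmall_def by (auto simp: hscale_diff_right[symmetric])

lemma hsmall_diff_commute: "hsmall n (x - y) \<longleftrightarrow> hsmall n (y - x)"
  using hsmall_minus[of n "x - y"] hsmall_minus[of n "y - x"] by auto

lemma hsmall_scale: "hsmall n x \<Longrightarrow> hsmall n (a *\<^sub>h x)"
  unfolding hsmall_def by (metis hscale_left_commute)

lemma hsmall_X: "hsmall n (fps_X ^ n *\<^sub>h x)"
  unfolding hsmall_def by blast

lemma hsmall_X_mult: "hsmall n x \<Longrightarrow> hsmall (m + n) (fps_X ^ m *\<^sub>h x)"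
  unfolding hsmall_def by (auto simp: hscale_hscale power_add)

lemma hsmall_Suc: "hsmall n x \<Longrightarrow> hsmall (Suc n) (fps_X *\<^sub>h x)"
  using hsmall_X_mult[of n x 1] by simp

lemma hsmall_mono: "hsmall n x \<Longrightarrow> m \<le> n \<Longrightarrow> hsmall m x"
  unfolding hsmall_def by (metis hscale_hscale le_iff_add power_add)

lemma hsmall_1: "hsmall 1 (fps_X *\<^sub>h x)"
  using hsmall_X[of 1 x] by simp

lemma hsmall_1E: assumes "hsmall 1 x" obtains z where "x = fps_X *\<^sub>h z"
  using assms by (auto simp: hsmall_def)

lemma hsmall_trans: "hsmall n (x - y) \<Longrightarrow> hsmall n (y - z) \<Longrightarrow> hsmall n (x - z)"
  using hsmall_add[of n "x - y" "y - z"] by simp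

lemma hsmall_mult_left: "hsmall n x \<Longrightarrow> hsmall n (y * (x::'a::halgebra))"
  unfolding hsmall_def by (auto simp: hscale_mult_right)

lemma hsmall_mult_right: "hsmall n x \<Longrightarrow> hsmall n ((x::'a::halgebra) * y)"
  unfolding hsmall_def by (auto simp: hscale_mult_left)

lemma hsmall_mult_cong:
  assumes "hsmall n (x - x')" "hsmall n (y - (y'::'a::halgebra))" shows "hsmall n (x * y - x' * y')"
proof -
  have "x * y - x' * y' = (x - x') * y + x' * (y - y')" by (simp add: algebra_simps)
  thus ?thesis using assms by (metis hsmall_add hsmall_mult_left hsmall_mult_right)
qed

lemma hcong_iff_hsmall: "hcong x y \<longleftrightarrow> hsmall 1 (x - y)"
  by (simp add: hcong_def hsmall_def)

text \<open>Separatedness and convergence of series with terms \<open>h^n u_n\<close>, phrased by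
  divisibility alone: the tensor products and endomorphism algebras below carry no metric, but they
  satisfy this.\<close>

class hcomplete = hmodule +
  assumes h_separated: "(\<And>n. \<exists>z. x = fps_X ^ n *\<^sub>h z) \<Longrightarrow> x = 0"
    and h_complete: "\<exists>s. \<forall>N. \<exists>z. s - (\<Sum>n<N. fps_X ^ n *\<^sub>h u n) = fps_X ^ N *\<^sub>h z"

lemma hsmall_all: "(\<And>n. hsmall n x) \<Longrightarrow> x = (0::'a::hcomplete)"
  unfolding hsmall_def by (rule h_separated)

lemma hsum_ex: "\<exists>s. \<forall>N. hsmall N (s - (\<Sum>n<N. fps_X ^ n *\<^sub>h (u n :: 'a::hcomplete)))"
  unfolding hsmall_def by (rule h_complete)

lemma hsmall_eq: "(\<And>n. hsmall n (x - y)) \<Longrightarrow> x = (y::'a::hcomplete)"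
  using hsmall_all[of "x - y"] by simp

definition hsum :: "(nat \<Rightarrow> 'a::hcomplete) \<Rightarrow> 'a"
  where "hsum u = (SOME s. \<forall>N. hsmall N (s - (\<Sum>n<N. fps_X ^ n *\<^sub>h u n)))"

lemma hsum: "hsmall N (hsum u - (\<Sum>n<N. fps_X ^ n *\<^sub>h u n))"
  unfolding hsum_def using someI_ex[OF hsum_ex[of u]] by blast

lemma hsum_unique:
  assumes "\<And>N. hsmall N (s - (\<Sum>n<N. fps_X ^ n *\<^sub>h u n))" shows "hsum u = s"
  by (rule hsmall_eq) (metis assms hsmall_diff_commute hsmall_trans hsum)

lemma hsum_add: "hsum (\<lambda>n. u n + v n) = hsum u + hsum v"
proof (rule hsum_unique)
  fix N
  show "hsmall N (hsum u + hsum v - (\<Sum>n<N. fps_X ^ n *\<^sub>h (u n + v n)))"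
    using hsmall_add[OF hsum[of N u] hsum[of N v]]
    by (simp add: hscale_add_right sum.distrib algebra_simps)
qed

lemma hsum_scale: "hsum (\<lambda>n. a *\<^sub>h u n) = a *\<^sub>h hsum u"
proof (rule hsum_unique)
  fix N
  show "hsmall N (a *\<^sub>h hsum u - (\<Sum>n<N. fps_X ^ n *\<^sub>h a *\<^sub>h u n))"
    using hsmall_scale[OF hsum[of N u], of a]
    by (simp add: hscale_diff_right hscale_sum_right hscale_left_commute)
qed

text \<open>A Horner step. The coefficients of \<open>h f\<close> are those of \<open>f\<close>
  shifted by one, so it gives the compatibility of \<open>hext\<close> with multiplication by
  \<open>h\<close>.\<close>

lemma hsum_split: "hsum u = u 0 + fps_X *\<^sub>h hsum (\<lambda>n. u (Suc n))"
proof (rule hsum_unique)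
  fix N
  show "hsmall N (u 0 + fps_X *\<^sub>h hsum (\<lambda>n. u (Suc n)) - (\<Sum>n<N. fps_X ^ n *\<^sub>h u n))"
  proof (cases N)
    case (Suc M)
    have "(\<Sum>n<N. fps_X ^ n *\<^sub>h u n) = u 0 + fps_X *\<^sub>h (\<Sum>n<M. fps_X ^ n *\<^sub>h u (Suc n))"
      unfolding Suc sum.lessThan_Suc_shift
      by (simp add: hscale_one hscale_sum_right hscale_hscale)
    thus ?thesis using hsmall_Suc[OF hsum[of M "\<lambda>n. u (Suc n)"]]
      by (simp add: Suc hscale_diff_right)
  qed simp
qed


subsection \<open>Linear maps and closed submodules\<close>

lemma hlinearI:
  assumes "\<And>x y. f (x + y) = f x + f y" "\<And>c x. f (c *\<^sub>h x) = c *\<^sub>h f x" shows "hlinear f"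
  using assms by (simp add: hlinear_def)

lemma hlinear_add: "hlinear f \<Longrightarrow> f (x + y) = f x + f y"
  and hlinear_scale: "hlinear f \<Longrightarrow> f (c *\<^sub>h x) = c *\<^sub>h f x"
  by (simp_all add: hlinear_def)

lemma hlinear_0: "hlinear f \<Longrightarrow> f 0 = 0"
  using hlinear_add[of f 0 0] by simp

lemma hlinear_minus: "hlinear f \<Longrightarrow> f (- x) = - f x"
  using hlinear_add[of f x "- x"] by (simp add: hlinear_0 eq_neg_iff_add_eq_0 add.commute)

lemma hlinear_diff: "hlinear f \<Longrightarrow> f (x - y) = f x - f y"
  using hlinear_add[of f x "- y"] by (simp add: hlinear_minus)

lemma hlinear_sum: "hlinear f \<Longrightarrow> f (\<Sum>i\<in>I. g i) = (\<Sum>i\<in>I. f (g i))"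
  by (induction I rule: infinite_finite_induct) (simp_all add: hlinear_0 hlinear_add)

lemmas hlinear_simps = hlinear_add hlinear_scale hlinear_0 hlinear_minus hlinear_diff hlinear_sum

lemma hlinear_id [simp]: "hlinear (\<lambda>x. x)" by (rule hlinearI) simp_all

lemma hlinear_comp: "hlinear f \<Longrightarrow> hlinear g \<Longrightarrow> hlinear (\<lambda>x. f (g x))"
  by (rule hlinearI) (simp_all add: hlinear_simps)

lemma hlinear_plus: "hlinear f \<Longrightarrow> hlinear g \<Longrightarrow> hlinear (\<lambda>x. f x + g x)"
  by (rule hlinearI) (simp_all add: hlinear_simps hscale_add_right)

lemma hlinear_uminus: "hlinear f \<Longrightarrow> hlinear (\<lambda>x. - f x)"
  by (rule hlinearI) (simp_all add: hlinear_simps hscale_minus_right)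

lemma hlinear_sub: "hlinear f \<Longrightarrow> hlinear g \<Longrightarrow> hlinear (\<lambda>x. f x - g x)"
  by (rule hlinearI) (simp_all add: hlinear_simps hscale_diff_right)

lemma hlinear_zero: "hlinear (\<lambda>x. 0)"
  by (rule hlinearI) simp_all

lemma hlinear_hscale: "hlinear f \<Longrightarrow> hlinear (\<lambda>x. a *\<^sub>h f x)"
  by (rule hlinearI) (simp_all add: hlinear_simps hscale_add_right hscale_left_commute)

lemma hlinear_mult_left: "hlinear f \<Longrightarrow> hlinear (\<lambda>x. (a::'a::halgebra) * f x)"
  by (rule hlinearI) (simp_all add: hlinear_simps algebra_simps hscale_mult_right)

lemma hlinear_mult_right: "hlinear f \<Longrightarrow> hlinear (\<lambda>x. f x * (a::'a::halgebra))"
  by (rule hlinearI) (simp_all add: hlinear_simps algebra_simps hscale_mult_left)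

lemma hlinear_setsum: "(\<And>i. hlinear (\<lambda>x. f i x)) \<Longrightarrow> hlinear (\<lambda>x. \<Sum>i\<in>I. f i x)"
  by (rule hlinearI) (simp_all add: hlinear_simps sum.distrib hscale_sum_right)

lemma hsmall_hlinear: "hlinear f \<Longrightarrow> hsmall n x \<Longrightarrow> hsmall n (f x)"
  unfolding hsmall_def by (auto simp: hlinear_scale)

lemma hbilinearI:
  assumes "\<And>x. hlinear (f x)" "\<And>y. hlinear (\<lambda>x. f x y)" shows "hbilinear f"
  using assms by (simp add: hbilinear_def)

lemma hbilinearD: "hbilinear f \<Longrightarrow> hlinear (f x)" "hbilinear f \<Longrightarrow> hlinear (\<lambda>x. f x y)"
  by (simp_all add: hbilinear_def)

text \<open>Scalar multiplication by \<open>h\<close> controls the multiplication by a whole power series, since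
  both sides may be compared modulo every power of \<open>h\<close>.\<close>

lemma hlinear_if_X:
  fixes F :: "'a::hmodule \<Rightarrow> 'b::hcomplete"
  assumes add: "\<And>x y. F (x + y) = F x + F y"
    and const: "\<And>a x. F (fps_const a *\<^sub>h x) = fps_const a *\<^sub>h F x"
    and X: "\<And>x. F (fps_X *\<^sub>h x) = fps_X *\<^sub>h F x"
  shows "hlinear F"
proof (rule hlinearI[OF add])
  fix c :: "complex fps" and x
  show "F (c *\<^sub>h x) = c *\<^sub>h F x"
  proof (rule hsmall_eq)
    fix N show "hsmall N (F (c *\<^sub>h x) - c *\<^sub>h F x)"
    proof (induction N arbitrary: c)
      case (Suc N)
      have c: "c = fps_const (c $ 0) + fps_X * fps_shift 1 c"
        by (rule fps_ext) simp
      have s: "c *\<^sub>h y = fps_const (c $ 0) *\<^sub>h y + fps_X *\<^sub>h fps_shift 1 c *\<^sub>h y" for y :: "'c::hmodule"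
        by (subst c) (simp only: hscale_add_left hscale_hscale)
      show ?case using hsmall_Suc[OF Suc.IH[of "fps_shift 1 c"]]
        by (simp add: s[of x] s[of "F x"] add const X hscale_diff_right)
    qed simp
  qed
qed

text \<open>Closedness in terms of the filtration. It drives the density arguments: the elements
  satisfying a linear identity form such a set, so the identity only has to be checked on
  topological generators.\<close>

definition hclosed :: "'a::hmodule set \<Rightarrow> bool"
  where "hclosed S \<longleftrightarrow> hsubmodule S \<and> (\<forall>a. (\<forall>n. \<exists>s\<in>S. hsmall n (a - s)) \<longrightarrow> a \<in> S)"

lemma hclosedD:
  assumes "hclosed S"
  shows "0 \<in> S" "x \<in> S \<Longrightarrow> y \<in> S \<Longrightarrow> x + y \<in> S" "x \<in> S \<Longrightarrow> c *\<^sub>h x \<in> S"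
    "(\<And>n. \<exists>s\<in>S. hsmall n (a - s)) \<Longrightarrow> a \<in> S"
  using assms unfolding hclosed_def hsubmodule_def by blast+

lemma hclosed_sum: "hclosed S \<Longrightarrow> (\<And>i. i \<in> I \<Longrightarrow> f i \<in> S) \<Longrightarrow> (\<Sum>i\<in>I. f i) \<in> S"
  by (induction I rule: infinite_finite_induct) (auto intro: hclosedD)

lemma hclosed_diff: "hclosed S \<Longrightarrow> x \<in> S \<Longrightarrow> y \<in> S \<Longrightarrow> x - y \<in> S"
  using hclosedD(2)[of S x "(-1) *\<^sub>h y"] hclosedD(3)[of S y "-1"]
  by (simp add: hscale_minus_left hscale_one)

lemma hclosed_equalizer:
  fixes F G :: "'a::hmodule \<Rightarrow> 'b::hcomplete"
  assumes F: "hlinear F" and G: "hlinear G" shows "hclosed {x. F x = G x}"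
  unfolding hclosed_def hsubmodule_def
proof (intro conjI ballI allI impI)
  fix a assume *: "\<forall>n. \<exists>s\<in>{x. F x = G x}. hsmall n (a - s)"
  have "F a = G a"
  proof (rule hsmall_eq)
    fix n obtain s where s: "F s = G s" "hsmall n (a - s)" using * by blast
    have "F a - G a = F (a - s) - G (a - s)" using s(1) by (simp add: F G hlinear_simps)
    thus "hsmall n (F a - G a)" using s(2) F G by (metis hsmall_diff hsmall_hlinear)
  qed
  thus "a \<in> {x. F x = G x}" by simp
qed (use F G in \<open>simp_all add: hlinear_simps\<close>)

lemma hclosed_INT: assumes S: "\<And>i. hclosed (S i)" shows "hclosed {x. \<forall>i. x \<in> S i}"
  unfolding hclosed_def hsubmodule_def
proof (intro conjI ballI allI impI)
  fix a assume a: "\<forall>n. \<exists>s\<in>{x. \<forall>i. x \<in> S i}. hsmall n (a - s)"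
  have "a \<in> S i" for i by (rule hclosedD(4)[OF S]) (use a in blast)
  thus "a \<in> {x. \<forall>i. x \<in> S i}" by blast
qed (use hclosedD(1-3)[OF S] in simp_all)

text \<open>Quantified identities also define closed submodules, so an induction on one argument can
  keep the others general.\<close>

lemma hclosed_all_eq:
  fixes F G :: "'i \<Rightarrow> 'a::hmodule \<Rightarrow> 'b::hcomplete"
  assumes "\<And>i. hlinear (F i)" "\<And>i. hlinear (G i)" shows "hclosed {x. \<forall>i. F i x = G i x}"
  using hclosed_INT[of "\<lambda>i. {x. F i x = G i x}"] hclosed_equalizer[OF assms] by simp

lemma hclosed_vimage:
  assumes F: "hlinear F" and S: "hclosed S" shows "hclosed {x. F x \<in> S}"
  unfolding hclosed_def hsubmodule_def
proof (intro conjI ballI allI impI)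
  fix a assume a: "\<forall>n. \<exists>s\<in>{x. F x \<in> S}. hsmall n (a - s)"
  have "F a \<in> S"
  proof (rule hclosedD(4)[OF S])
    fix n obtain s where "F s \<in> S" "hsmall n (a - s)" using a by blast
    thus "\<exists>s\<in>S. hsmall n (F a - s)" using hsmall_hlinear[OF F] hlinear_diff[OF F] by metis
  qed
  thus "a \<in> {x. F x \<in> S}" by simp
qed (use hclosedD(1-3)[OF S] in \<open>simp_all add: hlinear_simps[OF F]\<close>)

text \<open>The relation of congruence modulo \<open>h\<close> is open, hence closed.\<close>

lemma hclosed_hsmall_1:
  assumes "hlinear F" shows "hclosed {x. hsmall 1 (F x)}"
  unfolding hclosed_def hsubmodule_def
proof (intro conjI ballI allI impI)
  fix a assume "\<forall>n. \<exists>s\<in>{x. hsmall 1 (F x)}. hsmall n (a - s)"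
  then obtain s where "hsmall 1 (F s)" "hsmall 1 (F (a - s))" using hsmall_hlinear[OF assms] by blast
  hence "hsmall 1 (F s + F (a - s))" by (rule hsmall_add)
  thus "a \<in> {x. hsmall 1 (F x)}" by (simp add: hlinear_simps[OF assms])
qed (use assms in \<open>simp_all add: hlinear_simps hsmall_add hsmall_scale\<close>)


subsection \<open>Power series with vector coefficients\<close>

lemma fps_X_power_hscale_nth:
  "(fps_X ^ n *\<^sub>h f) $ k = (if k < n then 0 else (f :: 'a::cvec fps) $ (k - n))"
proof -
  have "(fps_X ^ n *\<^sub>h f) $ k = (\<Sum>i=0..k. if i = n then f $ (k - n) else 0)"
    unfolding hscale_nth by (rule sum.cong) (auto simp: cscale_one)
  thus ?thesis by auto
qed

lemma fps_X_hscale_nth: "(fps_X *\<^sub>h f) $ k = (if k = 0 then 0 else (f :: 'a::cvec fps) $ (k - 1))"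
  using fps_X_power_hscale_nth[of 1 f k] by simp

lemma fps_const_hscale_nth: "(fps_const a *\<^sub>h f) $ k = a *\<^sub>c ((f :: 'a::cvec fps) $ k)"
proof -
  have "(fps_const a *\<^sub>h f) $ k = (\<Sum>i=0..k. if i = 0 then a *\<^sub>c (f $ k) else 0)"
    unfolding hscale_nth by (rule sum.cong) auto
  thus ?thesis by simp
qed

lemma hscale_fps_const: "fps_const a *\<^sub>h fps_const v = fps_const (a *\<^sub>c (v :: 'a::cvec))"
  by (rule fps_ext) (simp add: fps_const_hscale_nth)

lemma hscale_complex_fps: "c *\<^sub>h f = c * (f :: complex fps)"
  by (rule fps_ext) (simp add: hscale_nth fps_mult_nth cscale_complex_def)

lemma hlinear_hscale_left: "hlinear f \<Longrightarrow> hlinear (\<lambda>x. f x *\<^sub>h (a::'b::hmodule))"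
  by (rule hlinearI) (simp_all add: hlinear_simps hscale_add_left hscale_complex_fps hscale_hscale)

lemma hsmall_fps_iff: "hsmall n f \<longleftrightarrow> (\<forall>k<n. (f :: 'a::cvec fps) $ k = 0)"
proof
  assume "\<forall>k<n. f $ k = 0"
  hence "f = fps_X ^ n *\<^sub>h fps_shift n f"
    by (intro fps_ext) (auto simp: fps_X_power_hscale_nth)
  thus "hsmall n f" unfolding hsmall_def by blast
qed (auto simp: hsmall_def fps_X_power_hscale_nth)

lemma hsum_fps_nth: "(\<Sum>n<N. fps_X ^ n *\<^sub>h (u n :: 'a::cvec fps)) $ k = (\<Sum>n<N. if k < n then 0 else u n $ (k - n))"
  by (simp add: fps_sum_nth fps_X_power_hscale_nth)

instance fps :: (cvec) hcomplete
proof
  fix x :: "'a fps" assume "\<And>n. \<exists>z. x = fps_X ^ n *\<^sub>h z"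
  thus "x = 0" by (fold hsmall_def, intro fps_ext) (auto simp: hsmall_fps_iff)
next
  fix u :: "nat \<Rightarrow> 'a fps"
  show "\<exists>s. \<forall>N. \<exists>z. s - (\<Sum>n<N. fps_X ^ n *\<^sub>h u n) = fps_X ^ N *\<^sub>h z"
    unfolding hsmall_def[symmetric]
  proof (intro exI allI)
    fix N
    \<comment> \<open>Coefficient \<open>k\<close> of the limit sees only the terms of index at most
      \<open>k\<close>, because \<open>h^n u_n\<close> starts in degree \<open>n\<close>.\<close>
    show "hsmall N (Abs_fps (\<lambda>k. \<Sum>n<Suc k. u n $ (k - n)) - (\<Sum>n<N. fps_X ^ n *\<^sub>h u n))"
      unfolding hsmall_fps_iff
    proof (intro allI impI)
      fix k assume "k < N"
      have "(\<Sum>n<Suc k. u n $ (k - n)) = (\<Sum>n<N. if k < n then 0 else u n $ (k - n))"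
        using \<open>k < N\<close> by (intro sum.mono_neutral_cong_left) auto
      thus "(Abs_fps (\<lambda>k. \<Sum>n<Suc k. u n $ (k - n)) - (\<Sum>n<N. fps_X ^ n *\<^sub>h u n)) $ k = 0"
        by (simp add: hsum_fps_nth)
    qed
  qed
qed

lemma hsmall_fps_const_expansion:
  "hsmall N (f - (\<Sum>n<N. fps_X ^ n *\<^sub>h fps_const ((f :: 'a::cvec fps) $ n)))"
  unfolding hsmall_fps_iff
proof (intro allI impI)
  fix k assume "k < N"
  have "(\<Sum>n<N. if k < n then 0 else fps_const (f $ n) $ (k - n)) = (\<Sum>n<N. if n = k then f $ k else 0)"
    by (rule sum.cong) auto
  thus "(f - (\<Sum>n<N. fps_X ^ n *\<^sub>h fps_const (f $ n))) $ k = 0"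
    using \<open>k < N\<close> by (simp only: fps_sub_nth hsum_fps_nth) simp
qed

lemma fps_hclosed_induct:
  assumes "hclosed S" "\<And>v. fps_const v \<in> S" shows "(f :: 'a::cvec fps) \<in> S"
  by (rule hclosedD(4)[OF assms(1)])
    (blast intro: hsmall_fps_const_expansion hclosed_sum[OF assms(1)] hclosedD(3)[OF assms(1)] assms(2))

lemma fps_X_torsion_free: "fps_X *\<^sub>h f = 0 \<Longrightarrow> (f :: 'a::cvec fps) = 0"
proof (rule fps_ext)
  fix n assume "fps_X *\<^sub>h f = 0"
  hence "(fps_X *\<^sub>h f) $ Suc n = 0" by simp
  thus "f $ n = 0 $ n" by (simp add: fps_X_hscale_nth)
qed

definition clinear :: "('v::cvec \<Rightarrow> 'b::hmodule) \<Rightarrow> bool"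
  where "clinear T \<longleftrightarrow> (\<forall>x y. T (x + y) = T x + T y) \<and> (\<forall>a x. T (a *\<^sub>c x) = fps_const a *\<^sub>h T x)"

definition hext :: "('v::cvec \<Rightarrow> 'b::hcomplete) \<Rightarrow> 'v fps \<Rightarrow> 'b"
  where "hext T f = hsum (\<lambda>n. T (f $ n))"

lemma clinear_0: "clinear T \<Longrightarrow> T 0 = 0"
  unfolding clinear_def by (metis add_cancel_right_right add_0)

lemma hsum_zero: "hsum (\<lambda>n. 0) = 0"
  by (rule hsum_unique) simp

lemma hlinear_hext: assumes "clinear T" shows "hlinear (hext T)"
proof (rule hlinear_if_X)
  fix f
  show "hext T (fps_X *\<^sub>h f) = fps_X *\<^sub>h hext T f"
    unfolding hext_def by (subst hsum_split) (simp add: fps_X_hscale_nth clinear_0[OF assms])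
qed (use assms in \<open>simp_all add: hext_def clinear_def hsum_add hsum_scale fps_const_hscale_nth\<close>)

lemma hext_const: assumes "clinear T" shows "hext T (fps_const v) = T v"
  unfolding hext_def by (subst hsum_split) (simp add: clinear_0[OF assms] hsum_zero)


subsection \<open>Free modules\<close>

definition lext :: "('k \<Rightarrow> 'b::hmodule) \<Rightarrow> ('k \<Rightarrow>\<^sub>0 complex) \<Rightarrow> 'b"
  where "lext b v = (\<Sum>k\<in>Poly_Mapping.keys v. fps_const (Poly_Mapping.lookup v k) *\<^sub>h b k)"

lemma lext_single [simp]: "lext b (Poly_Mapping.single k a) = fps_const a *\<^sub>h b k"
  by (simp add: lext_def)

lemma lext_add: "lext b (v + w) = lext b v + lext b w"
  unfolding lext_def by (rule setsum_keys_plus_distrib) (simp_all add: hscale_add_left flip: fps_const_add)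

lemma poly_mapping_single_induct [case_names zero add]:
  assumes "P 0" "\<And>v k a. P v \<Longrightarrow> P (v + Poly_Mapping.single k a)" shows "P v"
proof (induction v rule: update_induct)
  case (update f k a)
  have "Poly_Mapping.update k a f = f + Poly_Mapping.single k a"
    using update by (intro poly_mapping_eqI) (auto simp: lookup_update lookup_add lookup_single in_keys_iff)
  thus ?case using assms(2) update by simp
qed (rule assms)

lemma clinear_lext: "clinear (lext b)"
proof -
  have "lext b (a *\<^sub>c v) = fps_const a *\<^sub>h lext b v" for a v
    by (induction v rule: poly_mapping_single_induct)
      (simp_all add: lext_add cscale_add_right hscale_add_right cscale_single hscale_hscale
        cscale_complex_def, simp add: lext_def)
  thus ?thesis by (simp add: clinear_def lext_add)
qed

text \<open>The completed free module on a set: arbitrary values on the basis extend, and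
  \<open>free_hclosed_induct\<close> gives uniqueness. Free algebras, polynomials and the
  presentation of the tensor product are all of this kind.\<close>

definition hfree :: "('k \<Rightarrow> 'b::hcomplete) \<Rightarrow> ('k \<Rightarrow>\<^sub>0 complex) fps \<Rightarrow> 'b"
  where "hfree b = hext (lext b)"

lemma hlinear_hfree: "hlinear (hfree b)"
  unfolding hfree_def by (rule hlinear_hext[OF clinear_lext])

lemma hfree_single [simp]: "hfree b (fps_const (Poly_Mapping.single k a)) = fps_const a *\<^sub>h b k"
  unfolding hfree_def by (simp add: hext_const clinear_lext)

lemma free_hclosed_induct:
  assumes S: "hclosed S" and s: "\<And>k. fps_const (Poly_Mapping.single k 1) \<in> S"
  shows "(f :: ('k \<Rightarrow>\<^sub>0 complex) fps) \<in> S"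
proof (rule fps_hclosed_induct[OF S])
  fix v :: "'k \<Rightarrow>\<^sub>0 complex"
  show "fps_const v \<in> S"
  proof (induction v rule: poly_mapping_single_induct)
    case (add v k a)
    have "fps_const a *\<^sub>h fps_const (Poly_Mapping.single k 1) \<in> S" using hclosedD(3)[OF S] s by blast
    thus ?case using hclosedD(2)[OF S add] by (simp add: hscale_fps_const cscale_single cscale_complex_def flip: fps_const_add)
  qed (use hclosedD(1)[OF S] in simp)
qed

lemma free_hlinear_eqI:
  fixes F G :: "('k \<Rightarrow>\<^sub>0 complex) fps \<Rightarrow> 'b::hcomplete"
  assumes "hlinear F" "hlinear G" "\<And>k. F (fps_const (Poly_Mapping.single k 1)) = G (fps_const (Poly_Mapping.single k 1))"
  shows "F f = G f"
  using free_hclosed_induct[OF hclosed_equalizer[OF assms(1,2)], of f] assms(3) by simp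

lemma hfree_mult:
  fixes b :: "'k::monoid_add \<Rightarrow> 'b::{halgebra,hcomplete}"
  assumes "\<And>k l. b (k + l) = b k * b l"
  shows "hfree b (f * g) = hfree b f * hfree b g"
proof -
  let ?e = "\<lambda>k. fps_const (Poly_Mapping.single k 1) :: ('k \<Rightarrow>\<^sub>0 complex) fps"
  have l: "hlinear (\<lambda>g. hfree b (f * g))" "hlinear (\<lambda>f. hfree b (f * g))" for f g
    by (rule hlinear_comp[OF hlinear_hfree] hlinear_mult_left hlinear_mult_right hlinear_id)+
  have 1: "hfree b (?e k * ?e l) = hfree b (?e k) * hfree b (?e l)" for k l
    by (simp add: mult_single assms hscale_one)
  have 2: "hfree b (?e k * g) = hfree b (?e k) * hfree b g" for k g
    by (rule free_hlinear_eqI[where F="\<lambda>g. hfree b (?e k * g)"]) (simp_all only: 1 l hlinear_mult_left hlinear_hfree)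
  show ?thesis
    by (rule free_hlinear_eqI[where F="\<lambda>f. hfree b (f * g)"]) (simp_all only: 2 l hlinear_mult_right hlinear_hfree)
qed


section \<open>Quotients of free modules\<close>

text \<open>Distinct series that agree below degree \<open>n\<close> have distance at most
  \<open>2^-n\<close>, and distance below \<open>2^-n\<close> forces such agreement. This carries
  the metric closures in the definitions of \<open>tensor_kernel\<close> and
  \<open>an3_ideal\<close> over to the filtration.\<close>

lemma closed_iff_hclosed:
  fixes S :: "'a::cvec fps set" assumes S: "hsubmodule S"
  shows "closed S \<longleftrightarrow> hclosed S"
proof
  assume c: "closed S"
  have "f \<in> S" if f: "\<forall>n. \<exists>s\<in>S. hsmall n (f - s)" for f
  proof (rule ccontr)
    assume "f \<notin> S"
    then obtain e where e: "e > 0" "\<And>g. dist g f < e \<Longrightarrow> g \<notin> S"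
      using c unfolding closed_def open_fps_def by blast
    obtain n where n: "inverse (2 ^ n) < e"
      using e(1) real_arch_pow_inv[of e "1/2"] by (auto simp: power_divide inverse_eq_divide)
    obtain s where s: "s \<in> S" "hsmall n (f - s)" using f by blast
    have "dist s f < e"
    proof (cases "s = f")
      case False
      have "n \<le> subdegree (s - f)"
        using s(2) False by (intro subdegree_geI) (auto simp: hsmall_fps_iff)
      hence "inverse (2 ^ subdegree (s - f)) \<le> inverse (2 ^ n :: real)"
        by (intro le_imp_inverse_le) auto
      moreover have "dist s f = inverse (2 ^ subdegree (s - f))" using False by (simp add: dist_fps_def)
      ultimately show ?thesis using n by linarith
    qed (use e in simp)
    thus False using e(2) s(1) by blast
  qed
  thus "hclosed S" using S unfolding hclosed_def by blast
next
  assume h: "hclosed S"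
  show "closed S" unfolding closed_def open_fps_def
  proof (intro ballI)
    fix f assume "f \<in> - S"
    then obtain n where n: "\<And>s. s \<in> S \<Longrightarrow> \<not> hsmall n (f - s)"
      using hclosedD(4)[OF h] by blast
    have "g \<notin> S" if g: "dist g f < inverse (2 ^ n)" for g
    proof -
      have "hsmall n (f - g)"
      proof (cases "g = f")
        case False
        hence "2 ^ n < (2 ^ subdegree (g - f) :: real)" using g by (simp add: dist_fps_def)
        hence "n < subdegree (g - f)" by simp
        hence "hsmall n (g - f)" unfolding hsmall_fps_iff
          by (intro allI impI nth_less_subdegree_zero) linarith
        thus ?thesis by (simp add: hsmall_diff_commute)
      qed simp
      thus ?thesis using n by blast
    qed
    moreover have "(0::real) < inverse (2 ^ n)" by simp
    ultimately show "\<exists>r>0. {g. dist g f < r} \<subseteq> - S" by blast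
  qed
qed

text \<open>Closedness of the kernel makes the quotient separated; completeness follows by lifting
  the terms of a series and summing upstairs.\<close>

lemma hcomplete_quotient:
  fixes \<pi> :: "'v::hcomplete \<Rightarrow> 'q::hmodule"
  assumes lin: "hlinear \<pi>" and sur: "\<And>q. \<exists>f. q = \<pi> f" and cl: "hclosed {f. \<pi> f = 0}"
  shows "(\<And>n. \<exists>z. x = fps_X ^ n *\<^sub>h z) \<Longrightarrow> x = (0::'q)"
    and "\<exists>s. \<forall>N. \<exists>z. s - (\<Sum>n<N. fps_X ^ n *\<^sub>h (u n :: 'q)) = fps_X ^ N *\<^sub>h z"
proof -
  assume *: "\<And>n. \<exists>z. x = fps_X ^ n *\<^sub>h z"
  obtain f where f: "x = \<pi> f" using sur by blast
  have "f \<in> {f. \<pi> f = 0}"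
  proof (rule hclosedD(4)[OF cl])
    fix n obtain z where "x = fps_X ^ n *\<^sub>h z" using * by blast
    then obtain g where "x = fps_X ^ n *\<^sub>h \<pi> g" using sur by metis
    hence "\<pi> (f - fps_X ^ n *\<^sub>h g) = 0" by (simp add: hlinear_simps[OF lin] f)
    thus "\<exists>s\<in>{f. \<pi> f = 0}. hsmall n (f - s)"
      by (intro bexI[of _ "f - fps_X ^ n *\<^sub>h g"]) (simp_all add: hsmall_X)
  qed
  thus "x = 0" by (simp add: f)
next
  have "\<forall>n. \<exists>f. u n = \<pi> f" using sur by blast
  then obtain r where r: "\<And>n. u n = \<pi> (r n)" unfolding choice_iff by blast
  have "hsmall N (\<pi> (hsum r) - (\<Sum>n<N. fps_X ^ n *\<^sub>h u n))" for N
    using hsmall_hlinear[OF lin hsum[of N r]] by (simp add: hlinear_simps[OF lin] r)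
  thus "\<exists>s. \<forall>N. \<exists>z. s - (\<Sum>n<N. fps_X ^ n *\<^sub>h u n) = fps_X ^ N *\<^sub>h z"
    unfolding hsmall_def by blast
qed


section \<open>Maps out of the completed tensor product\<close>

lemma tensor_kernel_hclosed: "tensor_kernel = hclosed hull tensor_relators"
proof -
  have "(\<lambda>S. hsubmodule S \<and> closed S) = (hclosed :: ('a::hmodule \<times> 'b::hmodule \<Rightarrow>\<^sub>0 complex) fps set \<Rightarrow> bool)"
  proof (rule ext)
    fix S :: "('a \<times> 'b \<Rightarrow>\<^sub>0 complex) fps set"
    show "(hsubmodule S \<and> closed S) = hclosed S"
      using closed_iff_hclosed[of S] hclosed_def[of S] by argo
  qed
  thus ?thesis by (simp add: tensor_kernel_def)
qed

lemma hclosed_Inter: "(\<And>S. S \<in> A \<Longrightarrow> hclosed S) \<Longrightarrow> hclosed (\<Inter>A)"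
  using hclosed_INT[of "\<lambda>S. if S \<in> A then S else UNIV"]
proof -
  assume A: "\<And>S. S \<in> A \<Longrightarrow> hclosed S"
  have U: "hclosed UNIV" by (simp add: hclosed_def hsubmodule_def)
  \<comment> \<open>\<open>hclosed_INT\<close> runs over a whole type, so the sets outside
    \<open>A\<close> are replaced by \<open>UNIV\<close>.\<close>
  have "hclosed {x. \<forall>S. x \<in> (if S \<in> A then S else UNIV)}"
    by (rule hclosed_INT) (simp add: A U)
  moreover have "{x. \<forall>S. x \<in> (if S \<in> A then S else UNIV)} = \<Inter>A" by auto
  ultimately show ?thesis by simp
qed

lemma hclosed_hull: "hclosed (hclosed hull R)"
  unfolding hull_def by (rule hclosed_Inter) blast

lemma hlinear_abs_htensor: "hlinear abs_htensor"
  by (rule hlinearI) (simp_all add: plus_htensor.abs_eq hscale_htensor.abs_eq)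

lemma abs_htensor_surj: "\<exists>f. t = abs_htensor f"
  by (metis Quotient3_abs_rep Quotient3_htensor)

lemma abs_htensor_eq_0: "abs_htensor f = 0 \<longleftrightarrow> f \<in> tensor_kernel"
  by (simp add: zero_htensor_def htensor.abs_eq_iff tensor_eq_def)

lemma abs_htensor_hpair: "abs_htensor (hpair a b) = a \<otimes>\<^sub>h b"
  by (simp add: htens.abs_eq)

instance htensor :: (hmodule, hmodule) hcomplete
proof
  note * = hcomplete_quotient[OF hlinear_abs_htensor abs_htensor_surj]
  have cl: "hclosed {f. abs_htensor f = (0 :: ('a, 'b) htensor)}"
    by (simp add: abs_htensor_eq_0 tensor_kernel_hclosed hclosed_hull)
  show "(\<And>n. \<exists>z. x = fps_X ^ n *\<^sub>h z) \<Longrightarrow> x = 0" for x :: "('a, 'b) htensor"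
    by (rule *(1)[OF cl])
  show "\<exists>s. \<forall>N. \<exists>z. s - (\<Sum>n<N. fps_X ^ n *\<^sub>h u n) = fps_X ^ N *\<^sub>h z" for u :: "nat \<Rightarrow> ('a, 'b) htensor"
    by (rule *(2)[OF cl])
qed

lemma htensor_hclosed_induct:
  assumes S: "hclosed S" and p: "\<And>x y. x \<otimes>\<^sub>h y \<in> S" shows "t \<in> S"
proof -
  have "f \<in> {f. abs_htensor f \<in> S}" for f
  proof (rule free_hclosed_induct)
    show "hclosed {f. abs_htensor f \<in> S}" by (rule hclosed_vimage[OF hlinear_abs_htensor S])
    fix k show "fps_const (Poly_Mapping.single k 1) \<in> {f. abs_htensor f \<in> S}"
      using p[of "fst k" "snd k"] by (simp add: abs_htensor_hpair[symmetric] hpair_def)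
  qed
  thus ?thesis using abs_htensor_surj[of t] by blast
qed

lemma htensor_eqI:
  fixes F G :: "('a::hmodule, 'b::hmodule) htensor \<Rightarrow> 'c::hcomplete"
  assumes "hlinear F" "hlinear G" "\<And>x y. F (x \<otimes>\<^sub>h y) = G (x \<otimes>\<^sub>h y)" shows "F t = G t"
  using htensor_hclosed_induct[OF hclosed_equalizer[OF assms(1,2)], of t] assms(3) by simp

text \<open>The extension to the free module kills the bilinearity relations, and its kernel is
  closed because the target is separated; so it also kills the closure of these relations.\<close>

lemma htensor_lift_ex:
  fixes b :: "'a::hmodule \<Rightarrow> 'b::hmodule \<Rightarrow> 'c::hcomplete"
  assumes b: "hbilinear b"
  shows "\<exists>F. hlinear F \<and> (\<forall>x y. F (x \<otimes>\<^sub>h y) = b x y)"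
proof -
  let ?f = "hfree (\<lambda>(x, y). b x y)"
  note lin = hlinear_hfree[of "\<lambda>(x, y). b x y"]
  have p: "?f (hpair x y) = b x y" for x y by (simp add: hpair_def hscale_one)
  have "hclosed {f. ?f f = 0}" by (rule hclosed_equalizer[OF lin hlinear_zero])
  moreover have "tensor_relators \<subseteq> {f. ?f f = 0}"
    unfolding tensor_relators_def
    by (intro Un_least subsetI CollectI; elim CollectE exE conjE)
      (simp_all add: hlinear_simps[OF lin] p hbilinearD[OF b] hlinear_simps[OF hbilinearD(1)[OF b]] hlinear_simps[OF hbilinearD(2)[OF b]])
  ultimately have K: "tensor_kernel \<subseteq> {f. ?f f = 0}"
    unfolding tensor_kernel_hclosed by (simp add: hull_minimal)
  define F where "F t = ?f (rep_htensor t)" for t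
  have F: "F (abs_htensor f) = ?f f" for f
  proof -
    have "tensor_eq (rep_htensor (abs_htensor f)) f"
      by (meson Quotient3_htensor equivp_tensor_eq rep_abs_rsp_left equivp_reflp)
    thus ?thesis using K by (auto simp: tensor_eq_def F_def hlinear_simps[OF lin])
  qed
  have "hlinear F"
  proof (rule hlinearI)
    fix x y :: "('a, 'b) htensor" and c
    obtain f g where "x = abs_htensor f" "y = abs_htensor g"
      using abs_htensor_surj[of x] abs_htensor_surj[of y] by blast
    thus "F (x + y) = F x + F y" "F (c *\<^sub>h x) = c *\<^sub>h F x"
      using F by (simp_all add: hlinear_simps[OF hlinear_abs_htensor, symmetric] hlinear_simps[OF lin])
  qed
  moreover have "F (x \<otimes>\<^sub>h y) = b x y" for x y by (simp add: abs_htensor_hpair[symmetric] F p)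
  ultimately show ?thesis by blast
qed

lemma sweedler_unique:
  fixes b :: "'a::hmodule \<Rightarrow> 'b::hmodule \<Rightarrow> 'c::hcomplete"
  assumes "hlinear F" "\<And>x y. F (x \<otimes>\<^sub>h y) = b x y" shows "sweedler b = F"
  unfolding sweedler_def
proof (rule the_equality)
  fix G :: "('a, 'b) htensor \<Rightarrow> 'c"
  assume "hlinear G \<and> (\<forall>x y. G (x \<otimes>\<^sub>h y) = b x y)"
  hence "G t = F t" for t using htensor_eqI[of G F] by (simp add: assms)
  thus "G = F" by blast
qed (simp add: assms)

lemma
  fixes b :: "'a::hmodule \<Rightarrow> 'b::hmodule \<Rightarrow> 'c::hcomplete"
  assumes "hbilinear b"
  shows hlinear_sweedler: "hlinear (sweedler b)"
    and sweedler_htens: "sweedler b (x \<otimes>\<^sub>h y) = b x y"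
  using htensor_lift_ex[OF assms] sweedler_unique by metis+

lemma hlinear_sweedler_param:
  fixes B :: "'d::hmodule \<Rightarrow> 'a::hmodule \<Rightarrow> 'b::hmodule \<Rightarrow> 'c::hcomplete"
  assumes B: "\<And>p. hbilinear (B p)" and p: "\<And>x y. hlinear (\<lambda>p. B p x y)"
  shows "hlinear (\<lambda>p. sweedler (B p) t)"
proof (rule hlinearI)
  fix q r c
  show "sweedler (B (q + r)) t = sweedler (B q) t + sweedler (B r) t"
    by (rule htensor_eqI[where F="sweedler (B (q + r))"])
      (simp_all add: hlinear_sweedler hlinear_plus B sweedler_htens hlinear_simps[OF p])
  show "sweedler (B (c *\<^sub>h q)) t = c *\<^sub>h sweedler (B q) t"
    by (rule htensor_eqI[where F="sweedler (B (c *\<^sub>h q))"])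
      (simp_all add: hlinear_sweedler hlinear_hscale B sweedler_htens hlinear_simps[OF p])
qed

lemma hlinear_of_sweedler:
  fixes b :: "'a::hmodule \<Rightarrow> 'b::hmodule \<Rightarrow> 'c::hcomplete"
  assumes f: "hlinear (f :: 'c \<Rightarrow> 'd::hcomplete)" and b: "hbilinear b"
  shows "f (sweedler b t) = sweedler (\<lambda>x y. f (b x y)) t"
proof -
  have c: "hbilinear (\<lambda>x y. f (b x y))"
    by (intro hbilinearI hlinear_comp[OF f] hbilinearD[OF b])
  show ?thesis
    by (rule htensor_eqI[where F="\<lambda>t. f (sweedler b t)"])
      (simp_all add: c hlinear_sweedler hlinear_comp[OF f] b sweedler_htens)
qed

lemmas hlinear_htens_left = hbilinearD(2)[OF hbilinear_htens]
lemmas hlinear_htens_right = hbilinearD(1)[OF hbilinear_htens]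
lemmas htens_simps = hlinear_simps[OF hlinear_htens_left] hlinear_simps[OF hlinear_htens_right]


section \<open>The tensor product algebra\<close>

text \<open>The functional serves only to show that tensor products are nontrivial.\<close>

class hunital = halgebra + hcomplete +
  assumes unit_functional_ex: "\<exists>e :: 'a \<Rightarrow> complex fps.
    (\<forall>x y. e (x + y) = e x + e y) \<and> (\<forall>c x. e (c *\<^sub>h x) = c * e x) \<and> e 1 = 1"

lemma unit_functional: obtains e :: "'a::hunital \<Rightarrow> complex fps" where "hlinear e" "e 1 = 1"
  using unit_functional_ex unfolding hlinear_def hscale_complex_fps by blast

lemma mult_bilinear:
  fixes f :: "'a::hmodule \<Rightarrow> 'c::halgebra" and g :: "'b::hmodule \<Rightarrow> 'c"
  assumes "hlinear f" "hlinear g" shows "hbilinear (\<lambda>x y. f x * g y)"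
  by (intro hbilinearI hlinear_mult_left hlinear_mult_right assms)

lemma htens_bilinear:
  assumes "hlinear f" "hlinear g" shows "hbilinear (\<lambda>x y. f x \<otimes>\<^sub>h g y)"
  by (intro hbilinearI hlinear_comp[OF hlinear_htens_left] hlinear_comp[OF hlinear_htens_right] assms)

text \<open>The map is extended in two stages: for fixed \<open>a\<close> and \<open>b\<close> in
  the right factor, and then the result, which is bilinear in \<open>a\<close> and \<open>b\<close>,
  in the left one.\<close>

lemma tensor_mult_ex:
  "\<exists>m. hbilinear m \<and> (\<forall>a b c d. m (a \<otimes>\<^sub>h b) (c \<otimes>\<^sub>h d) = ((a::'a::halgebra) * c) \<otimes>\<^sub>h ((b::'b::halgebra) * d))"
proof -
  define r where "r a b = sweedler (\<lambda>c d. (a * c) \<otimes>\<^sub>h (b * d))" for a :: 'a and b :: 'b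
  have bl: "hbilinear (\<lambda>c d. (a * c) \<otimes>\<^sub>h (b * d))" for a :: 'a and b :: 'b
    by (intro htens_bilinear hlinear_mult_left hlinear_id)
  have r: "hlinear (r a b)" "r a b (c \<otimes>\<^sub>h d) = (a * c) \<otimes>\<^sub>h (b * d)" for a b c d
    by (simp_all add: r_def hlinear_sweedler sweedler_htens bl)
  have rb: "hbilinear (\<lambda>a b. r a b t)" for t
    unfolding r_def
    by (intro hbilinearI hlinear_sweedler_param bl hlinear_comp[OF hlinear_htens_left]
        hlinear_comp[OF hlinear_htens_right] hlinear_mult_right hlinear_id)
  let ?m = "\<lambda>s t. sweedler (\<lambda>a b. r a b t) s"
  have "hbilinear ?m"
    by (intro hbilinearI hlinear_sweedler_param rb hlinear_sweedler r)
  moreover have "?m (a \<otimes>\<^sub>h b) (c \<otimes>\<^sub>h d) = (a * c) \<otimes>\<^sub>h (b * d)" for a b c d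
    by (subst sweedler_htens[OF rb]) (rule r)
  ultimately show ?thesis by blast
qed

lemma hbilinear_htensor_eqI:
  fixes m m' :: "('a::hmodule, 'b::hmodule) htensor \<Rightarrow> ('c::hmodule, 'd::hmodule) htensor \<Rightarrow> 'e::hcomplete"
  assumes "hbilinear m" "hbilinear m'"
    "\<And>a b c d. m (a \<otimes>\<^sub>h b) (c \<otimes>\<^sub>h d) = m' (a \<otimes>\<^sub>h b) (c \<otimes>\<^sub>h d)"
  shows "m = m'"
proof (intro ext)
  fix s t
  have *: "m (a \<otimes>\<^sub>h b) t = m' (a \<otimes>\<^sub>h b) t" for a b
    by (rule htensor_eqI[where F="m (a \<otimes>\<^sub>h b)"]) (use assms hbilinearD in blast)+
  show "m s t = m' s t"
    by (rule htensor_eqI[where F="\<lambda>s. m s t"]) (use * assms hbilinearD in blast)+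
qed

lemma tensor_mult:
  shows hbilinear_tensor_mult: "hbilinear (tensor_mult :: ('a::halgebra, 'b::halgebra) htensor \<Rightarrow> _)"
    and tensor_mult_htens: "tensor_mult ((a::'a) \<otimes>\<^sub>h b) (c \<otimes>\<^sub>h d) = (a * c) \<otimes>\<^sub>h ((b::'b) * d)"
proof -
  have "\<exists>!m. hbilinear m \<and> (\<forall>a b c d. m (a \<otimes>\<^sub>h b) (c \<otimes>\<^sub>h d) = ((a::'a) * c) \<otimes>\<^sub>h ((b::'b) * d))"
    by (rule ex_ex1I[OF tensor_mult_ex]) (auto intro!: hbilinear_htensor_eqI)
  from theI'[OF this] show "hbilinear (tensor_mult :: ('a::halgebra, 'b::halgebra) htensor \<Rightarrow> _)"
    "tensor_mult ((a::'a) \<otimes>\<^sub>h b) (c \<otimes>\<^sub>h d) = (a * c) \<otimes>\<^sub>h ((b::'b) * d)"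
    unfolding tensor_mult_def by blast+
qed

lemmas tensor_mult_hlinear = hbilinearD[OF hbilinear_tensor_mult]

lemma tensor_mult_assoc: "tensor_mult (tensor_mult r s) t = tensor_mult r (tensor_mult s t)"
proof -
  note l = hlinear_comp[OF tensor_mult_hlinear(1)] hlinear_comp[OF tensor_mult_hlinear(2)]
    tensor_mult_hlinear hlinear_id
  have 1: "tensor_mult (tensor_mult (a \<otimes>\<^sub>h b) (c \<otimes>\<^sub>h d)) t = tensor_mult (a \<otimes>\<^sub>h b) (tensor_mult (c \<otimes>\<^sub>h d) t)"
    for a b c d
    by (rule htensor_eqI[where F="tensor_mult (tensor_mult (a \<otimes>\<^sub>h b) (c \<otimes>\<^sub>h d))"])
      (simp_all add: tensor_mult_htens mult.assoc l)
  have 2: "tensor_mult (tensor_mult (a \<otimes>\<^sub>h b) s) t = tensor_mult (a \<otimes>\<^sub>h b) (tensor_mult s t)" for a b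
    by (rule htensor_eqI[where F="\<lambda>s. tensor_mult (tensor_mult (a \<otimes>\<^sub>h b) s) t"])
      (simp_all add: 1 l)
  show ?thesis
    by (rule htensor_eqI[where F="\<lambda>r. tensor_mult (tensor_mult r s) t"]) (simp_all add: 2 l)
qed

lemma tensor_mult_one: "tensor_mult (1 \<otimes>\<^sub>h 1) t = t" "tensor_mult t (1 \<otimes>\<^sub>h 1) = t"
  by (rule htensor_eqI[where G="\<lambda>t. t"]; simp add: tensor_mult_hlinear tensor_mult_htens)+

lemma htens_functional:
  obtains e :: "('a::hunital, 'b::hunital) htensor \<Rightarrow> complex fps" where "hlinear e" "e (1 \<otimes>\<^sub>h 1) = 1"
proof -
  obtain f :: "'a \<Rightarrow> complex fps" where f: "hlinear f" "f 1 = 1" using unit_functional .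
  obtain g :: "'b \<Rightarrow> complex fps" where g: "hlinear g" "g 1 = 1" using unit_functional .
  note bl = mult_bilinear[OF f(1) g(1)]
  show ?thesis by (rule that[OF hlinear_sweedler[OF bl]]) (simp add: sweedler_htens bl f g)
qed

text \<open>The product \<open>*\<close> is the componentwise one, as needed for the target of a
  coproduct. The smash product of the undeformed algebra stays the separate function
  \<open>undeformed_mult\<close> on the same type.\<close>

instantiation htensor :: (hunital, hunital) halgebra
begin
definition times_htensor :: "('a, 'b) htensor \<Rightarrow> ('a, 'b) htensor \<Rightarrow> ('a, 'b) htensor"
  where "times_htensor = tensor_mult"
definition one_htensor :: "('a, 'b) htensor" where "one_htensor = 1 \<otimes>\<^sub>h 1"
instance
proof
  obtain e :: "('a, 'b) htensor \<Rightarrow> complex fps" where "hlinear e" "e (1 \<otimes>\<^sub>h 1) = 1"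
    by (rule htens_functional)
  thus "(0 :: ('a, 'b) htensor) \<noteq> 1" unfolding one_htensor_def by (metis hlinear_0 zero_neq_one)
qed (simp_all add: times_htensor_def one_htensor_def tensor_mult_assoc tensor_mult_one
      hlinear_simps[OF tensor_mult_hlinear(1)] hlinear_simps[OF tensor_mult_hlinear(2)])
end

instance htensor :: (hunital, hunital) hunital
proof
  show "\<exists>e :: ('a, 'b) htensor \<Rightarrow> complex fps.
    (\<forall>x y. e (x + y) = e x + e y) \<and> (\<forall>c x. e (c *\<^sub>h x) = c * e x) \<and> e 1 = 1"
    using htens_functional[where ?'a='a and ?'b='b] unfolding hlinear_def hscale_complex_fps one_htensor_def by metis
qed

lemma htens_mult: "(a \<otimes>\<^sub>h b) * (c \<otimes>\<^sub>h d) = (a * c) \<otimes>\<^sub>h ((b::'b::hunital) * d)" for a c :: "'a::hunital"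
  by (simp add: times_htensor_def tensor_mult_htens)

class cunital = calgebra +
  assumes cunit_functional_ex: "\<exists>e :: 'a \<Rightarrow> complex.
    (\<forall>x y. e (x + y) = e x + e y) \<and> (\<forall>a x. e (a *\<^sub>c x) = a * e x) \<and> e 1 = 1"

instance complex :: cunital
  by standard (rule exI[of _ "\<lambda>x. x"], simp add: cscale_complex_def)

instance poly_mapping :: (monoid_add, cunital) cunital
proof
  obtain e :: "'b \<Rightarrow> complex" where e: "\<And>x y. e (x + y) = e x + e y" "\<And>a x. e (a *\<^sub>c x) = a * e x" "e 1 = 1"
    using cunit_functional_ex by blast
  show "\<exists>e :: ('a \<Rightarrow>\<^sub>0 'b) \<Rightarrow> complex.
    (\<forall>x y. e (x + y) = e x + e y) \<and> (\<forall>a x. e (a *\<^sub>c x) = a * e x) \<and> e 1 = 1"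
    by (intro exI[of _ "\<lambda>p. e (Poly_Mapping.lookup p 0)"]) (simp add: lookup_add lookup_cscale e)
qed

instance fps :: (cunital) hunital
proof
  obtain e :: "'a \<Rightarrow> complex" where e: "\<And>x y. e (x + y) = e x + e y" "\<And>a x. e (a *\<^sub>c x) = a * e x" "e 1 = 1"
    using cunit_functional_ex by blast
  have e0: "e 0 = 0" using e(1)[of 0 0] by simp
  have "clinear (\<lambda>x. fps_const (e x))"
    by (simp add: clinear_def e hscale_fps_const cscale_complex_def)
  from hlinear_hext[OF this] hext_const[OF this, of 1]
  show "\<exists>e :: 'a fps \<Rightarrow> complex fps.
    (\<forall>x y. e (x + y) = e x + e y) \<and> (\<forall>c x. e (c *\<^sub>h x) = c * e x) \<and> e 1 = 1"
    unfolding hlinear_def hscale_complex_fps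
    by (intro exI[of _ "hext (\<lambda>x. fps_const (e x))"]) (simp add: e)
qed


section \<open>The algebra of endomorphisms\<close>

text \<open>Endomorphisms form a \<open>ring_1\<close> only if the identity differs from
  zero.\<close>

class hnontrivial = hcomplete +
  assumes nontrivial_ex: "\<exists>x. x \<noteq> 0"

instance htensor :: (hunital, hunital) hnontrivial
  by standard (rule exI[of _ 1], simp)

instance fps :: (cunital) hnontrivial
  by standard (rule exI[of _ 1], simp)

typedef (overloaded) 'a hend = "{f :: 'a::hmodule \<Rightarrow> 'a. hlinear f}"
  morphisms app Hend by (rule exI[of _ "\<lambda>x. x"]) simp

setup_lifting type_definition_hend

lemma hlinear_app: "hlinear (app f)" using app by blast

lemmas app_simps = hlinear_simps[OF hlinear_app]

lemma app_Hend: "hlinear f \<Longrightarrow> app (Hend f) = f" by (simp add: Hend_inverse)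

lemma hend_eqI: "(\<And>x. app f x = app g x) \<Longrightarrow> f = g"
  by (simp add: app_inject[symmetric] ext)

instantiation hend :: (hnontrivial) halgebra
begin
lift_definition zero_hend :: "'a hend" is "\<lambda>x. 0" by (rule hlinear_zero)
lift_definition one_hend :: "'a hend" is "\<lambda>x. x" by (rule hlinear_id)
lift_definition plus_hend :: "'a hend \<Rightarrow> 'a hend \<Rightarrow> 'a hend" is "\<lambda>f g x. f x + g x" by (rule hlinear_plus)
lift_definition minus_hend :: "'a hend \<Rightarrow> 'a hend \<Rightarrow> 'a hend" is "\<lambda>f g x. f x - g x" by (rule hlinear_sub)
lift_definition uminus_hend :: "'a hend \<Rightarrow> 'a hend" is "\<lambda>f x. - f x" by (rule hlinear_uminus)
lift_definition times_hend :: "'a hend \<Rightarrow> 'a hend \<Rightarrow> 'a hend" is "\<lambda>f g x. f (g x)" by (rule hlinear_comp)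
lift_definition hscale_hend :: "complex fps \<Rightarrow> 'a hend \<Rightarrow> 'a hend" is "\<lambda>c f x. c *\<^sub>h f x" by (rule hlinear_hscale)

lemma app_ops [simp]: "app (f + g) x = app f x + app g x" "app (f - g) x = app f x - app g x"
  "app (- f) x = - app f x" "app (f * g) x = app f (app g x)" "app (c *\<^sub>h f) x = c *\<^sub>h app f x"
  "app 0 x = 0" "app 1 x = x" for f g :: "'a hend"
  by (simp_all add: plus_hend.rep_eq minus_hend.rep_eq uminus_hend.rep_eq times_hend.rep_eq
      hscale_hend.rep_eq zero_hend.rep_eq one_hend.rep_eq)

instance
proof
  obtain x :: 'a where x: "x \<noteq> 0" using nontrivial_ex by blast
  have "app (0 :: 'a hend) x \<noteq> app 1 x" using x by simp
  thus "(0 :: 'a hend) \<noteq> 1" by metis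
qed (rule hend_eqI; simp add: app_simps algebra_simps hscale_add_right hscale_add_left
      hscale_hscale hscale_one)+
end

lemma hlinear_app_left: "hlinear (\<lambda>f. app f x)"
  by (rule hlinearI) simp_all

lemma app_sum: "app (\<Sum>i\<in>I. f i) x = (\<Sum>i\<in>I. app (f i) x)"
  by (rule hlinear_sum[OF hlinear_app_left])

instance hend :: (hnontrivial) hcomplete
proof
  fix f :: "'a hend" assume *: "\<And>n. \<exists>z. f = fps_X ^ n *\<^sub>h z"
  have "app f x = 0" for x
  proof (rule hsmall_all)
    show "hsmall n (app f x)" for n using *[of n] by (auto simp: hsmall_X)
  qed
  thus "f = 0" by (intro hend_eqI) simp
next
  fix u :: "nat \<Rightarrow> 'a hend"
  \<comment> \<open>The tail of the series divided by \<open>h^N\<close>, formed pointwise. It is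
    again an endomorphism, so \<open>r 0\<close> is the sum and \<open>r N\<close> the exact
    remainder.\<close>
  define r where "r N = Hend (\<lambda>x. hsum (\<lambda>n. app (u (N + n)) x))" for N
  have r: "app (r N) x = hsum (\<lambda>n. app (u (N + n)) x)" for N x
    unfolding r_def
    by (subst app_Hend) (auto intro!: hlinearI simp: app_simps hsum_add hsum_scale)
  have "r 0 - (\<Sum>n<N. fps_X ^ n *\<^sub>h u n) = fps_X ^ N *\<^sub>h r N" for N
  proof (induction N)
    case (Suc N)
    have "r N = u N + fps_X *\<^sub>h r (Suc N)"
      by (rule hend_eqI, simp add: r, subst hsum_split, simp)
    hence "fps_X ^ N *\<^sub>h r N = fps_X ^ N *\<^sub>h u N + fps_X ^ Suc N *\<^sub>h r (Suc N)"
      by (simp add: hscale_add_right hscale_hscale mult.commute)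
    thus ?case using Suc by (simp add: algebra_simps)
  qed (simp add: hscale_one)
  thus "\<exists>s. \<forall>N. \<exists>z. s - (\<Sum>n<N. fps_X ^ n *\<^sub>h u n) = fps_X ^ N *\<^sub>h z" by blast
qed


section \<open>Universal properties of the algebras\<close>

abbreviation alg_hom :: "('a::halgebra \<Rightarrow> 'b::halgebra) \<Rightarrow> bool"
  where "alg_hom \<equiv> halgebra_hom (*) 1 (*) 1"

lemma halgebra_homD:
  assumes "halgebra_hom mA oneA mB oneB F"
  shows "hlinear F" "F oneA = oneB" "F (mA x y) = mB (F x) (F y)"
  using assms by (simp_all add: halgebra_hom_def)

lemma hext_mult:
  fixes T :: "'v::calgebra \<Rightarrow> 'b::{halgebra,hcomplete}"
  assumes lin: "clinear T" and mult: "\<And>x y. T (x * y) = T x * T y"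
  shows "hext T (f * g) = hext T f * hext T g"
proof -
  have l: "hlinear (\<lambda>g. hext T (f * g))" "hlinear (\<lambda>f. hext T (f * g))" for f g
    by (rule hlinear_comp[OF hlinear_hext[OF lin]] hlinear_mult_left hlinear_mult_right hlinear_id)+
  have "f \<in> {f. \<forall>g. hext T (f * g) = hext T f * hext T g}"
  proof (rule fps_hclosed_induct)
    show "hclosed {f. \<forall>g. hext T (f * g) = hext T f * hext T g}"
      by (intro hclosed_all_eq l hlinear_mult_right hlinear_hext[OF lin])
    fix v
    have "g \<in> {g. hext T (fps_const v * g) = hext T (fps_const v) * hext T g}" for g
      by (rule fps_hclosed_induct)
        (auto intro!: hclosed_equalizer l hlinear_mult_left hlinear_hext[OF lin] simp: hext_const[OF lin] mult)
    thus "fps_const v \<in> {f. \<forall>g. hext T (f * g) = hext T f * hext T g}" by blast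
  qed
  thus ?thesis by blast
qed

definition word_prod :: "('g \<Rightarrow> 'b::monoid_mult) \<Rightarrow> 'g word \<Rightarrow> 'b"
  where "word_prod t w = prod_list (map t (letters w))"

lemma word_prod_simps [simp]: "word_prod t 0 = 1" "word_prod t (v + w) = word_prod t v * word_prod t w"
  "word_prod t (Word [g]) = t g"
  by (simp_all add: word_prod_def zero_word_def plus_word_def)

lemma comm_simps: "comm (x + y) z = comm x z + comm y z" "comm z (x + y) = comm z x + comm z y"
  "comm (- x) z = - comm x z" "comm z (- x) = - comm z x"
  "comm (x - y) z = comm x z - comm y z" "comm z (x - y) = comm z x - comm z y"
  "comm 0 z = 0" "comm z 0 = 0" "comm x x = 0" for x :: "'a::ring"
  by (simp_all add: comm_def algebra_simps)

lemma comm_one [simp]: "comm 1 z = 0" "comm z 1 = 0" for z :: "'a::ring_1"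
  by (simp_all add: comm_def)

lemma comm_hscale: "comm (c *\<^sub>h x) y = c *\<^sub>h comm x y" "comm x (c *\<^sub>h y) = c *\<^sub>h comm x y" for x :: "'a::halgebra"
  by (simp_all add: comm_def hscale_mult_left hscale_mult_right hscale_diff_right)

lemma comm_sum: "comm (\<Sum>i\<in>I. f i) y = (\<Sum>i\<in>I. comm (f i) y)" "comm y (\<Sum>i\<in>I. f i) = (\<Sum>i\<in>I. comm y (f i))"
  for y :: "'a::ring"
  by (induction I rule: infinite_finite_induct) (simp_all add: comm_simps)

lemma comm_mult_right: "comm x (y * z) = comm x y * z + y * comm x z" for x :: "'a::ring"
  by (simp add: comm_def algebra_simps)

lemma comm_mult_left: "comm (x * y) z = x * comm y z + comm x z * y" for x :: "'a::ring"
  by (simp add: comm_def algebra_simps)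

lemma comm_swap: "comm y x = - comm x y" for x :: "'a::ring"
  by (simp add: comm_def)

lemma comm_eq_0_iff: "comm x y = 0 \<longleftrightarrow> x * y = y * x" for x :: "'a::ring"
  by (simp add: comm_def)

lemma hom_comm:
  fixes F :: "'a::halgebra \<Rightarrow> 'b::halgebra"
  assumes "alg_hom F" shows "F (comm x y) = comm (F x) (F y)"
  using halgebra_homD[OF assms] by (simp add: comm_def hlinear_simps)


subsection \<open>The enveloping algebra\<close>

definition io_rep :: "(io_gen \<Rightarrow> 'b::halgebra) \<Rightarrow> bool"
  where "io_rep t \<longleftrightarrow>
      (\<forall>i j. comm (t (GM i)) (t (GM j)) = (\<Sum>k\<in>UNIV. fps_const (\<i> * eps i j k) *\<^sub>h t (GM k)))
    \<and> (\<forall>i j. comm (t (GM i)) (t (GN j)) = (\<Sum>k\<in>UNIV. fps_const (\<i> * eps i j k) *\<^sub>h t (GN k)))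
    \<and> (\<forall>i j. comm (t (GN i)) (t (GN j)) = (\<Sum>k\<in>UNIV. fps_const (- \<i> * eps i j k) *\<^sub>h t (GM k)))
    \<and> (\<forall>\<mu> \<nu>. comm (t (GP \<mu>)) (t (GP \<nu>)) = 0)
    \<and> (\<forall>j. comm (t (GM j)) (t (GP Tm)) = 0)
    \<and> (\<forall>j k. comm (t (GM j)) (t (GP (Sp k))) = (\<Sum>l\<in>UNIV. fps_const (\<i> * eps j k l) *\<^sub>h t (GP (Sp l))))
    \<and> (\<forall>j k. comm (t (GN j)) (t (GP (Sp k))) = fps_const (- \<i> * delta j k) *\<^sub>h t (GP Tm))
    \<and> (\<forall>j. comm (t (GN j)) (t (GP Tm)) = fps_const (- \<i>) *\<^sub>h t (GP (Sp j)))"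

lemma io_repD:
  assumes "io_rep t"
  shows "comm (t (GM i)) (t (GM j)) = (\<Sum>k\<in>UNIV. fps_const (\<i> * eps i j k) *\<^sub>h t (GM k))"
    "comm (t (GM i)) (t (GN j)) = (\<Sum>k\<in>UNIV. fps_const (\<i> * eps i j k) *\<^sub>h t (GN k))"
    "comm (t (GN i)) (t (GN j)) = (\<Sum>k\<in>UNIV. fps_const (- \<i> * eps i j k) *\<^sub>h t (GM k))"
    "comm (t (GP \<mu>)) (t (GP \<nu>)) = 0"
    "comm (t (GM j)) (t (GP Tm)) = 0"
    "comm (t (GM j)) (t (GP (Sp k))) = (\<Sum>l\<in>UNIV. fps_const (\<i> * eps j k l) *\<^sub>h t (GP (Sp l)))"
    "comm (t (GN j)) (t (GP (Sp k))) = fps_const (- \<i> * delta j k) *\<^sub>h t (GP Tm)"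
    "comm (t (GN j)) (t (GP Tm)) = fps_const (- \<i>) *\<^sub>h t (GP (Sp j))"
  using assms unfolding io_rep_def by blast+

lemma free_hom:
  fixes t :: "'g \<Rightarrow> 'b::{halgebra,hcomplete}"
  shows "alg_hom (hfree (word_prod t))"
    and "hfree (word_prod t) (fps_const (free_gen g)) = t g"
proof -
  show "hfree (word_prod t) (fps_const (free_gen g)) = t g"
    by (simp add: free_gen_def hscale_one)
  have "hfree (word_prod t) (fps_const (Poly_Mapping.single 0 1)) = 1"
    by (simp only: hfree_single) (simp add: hscale_one)
  hence "hfree (word_prod t) 1 = 1" by simp
  thus "alg_hom (hfree (word_prod t))"
    by (simp add: halgebra_hom_def hlinear_hfree hfree_mult)
qed

lemma abs_uio_ops: "abs_uio (x + y) = abs_uio x + abs_uio y" "abs_uio (x - y) = abs_uio x - abs_uio y"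
  "abs_uio (x * y) = abs_uio x * abs_uio y" "abs_uio (a *\<^sub>c x) = a *\<^sub>c abs_uio x" "abs_uio 0 = 0" "abs_uio 1 = 1"
  "abs_uio (free_gen g) = io g"
  by (simp_all add: plus_uio.abs_eq minus_uio.abs_eq times_uio.abs_eq cscale_uio.abs_eq zero_uio_def one_uio_def io_def)

lemma abs_uio_sum: "abs_uio (\<Sum>i\<in>I. f i) = (\<Sum>i\<in>I. abs_uio (f i))"
  by (induction I rule: infinite_finite_induct) (simp_all add: abs_uio_ops)

lemma abs_uio_surj: "\<exists>v. u = abs_uio v"
  by (metis Quotient3_abs_rep Quotient3_uio)

lemma abs_uio_eq_0: "abs_uio v = 0 \<longleftrightarrow> v \<in> io_ideal"
  by (simp add: zero_uio_def uio.abs_eq_iff io_eq_def)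

lemma abs_uio_relator: "r \<in> io_relators \<Longrightarrow> abs_uio r = 0"
  unfolding abs_uio_eq_0 io_ideal_def by (rule hull_inc)

lemma fps_const_sum: "fps_const (\<Sum>i\<in>I. f i) = (\<Sum>i\<in>I. fps_const (f i))"
  by (induction I rule: infinite_finite_induct) (simp_all flip: fps_const_add)

lemma io_rep_io: "io_rep (\<lambda>g. fps_const (io g))"
proof -
  define f where "f v = fps_const (abs_uio v)" for v
  have f: "f (x - y) = f x - f y" "f (x * y) = f x * f y" "f (a *\<^sub>c x) = fps_const a *\<^sub>h f x"
    "f (free_gen g) = fps_const (io g)" "f (\<Sum>i\<in>I. F i) = (\<Sum>i\<in>I. f (F i))"
    for x y a g F and I :: "space set"
    by (simp_all add: f_def abs_uio_ops abs_uio_sum fps_const_sum hscale_fps_const)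
  have fc: "f (comm x y) = comm (f x) (f y)" for x y by (simp add: comm_def f)
  have b: "(\<forall>r\<in>{F i j |i j. True}. P r) \<longleftrightarrow> (\<forall>i j. P (F i j))" "(\<forall>r\<in>{G i |i. True}. P r) \<longleftrightarrow> (\<forall>i. P (G i))"
    for P and F :: "'i \<Rightarrow> 'j \<Rightarrow> io_gen free_algebra" and G :: "'i \<Rightarrow> io_gen free_algebra"
    by blast+
  have "\<forall>r\<in>io_relators. f r = 0" by (simp add: f_def abs_uio_relator)
  thus ?thesis
    unfolding io_relators_def Let_def ball_Un b f fc io_rep_def right_minus_eq by blast
qed

text \<open>Universal property of the enveloping algebra over power series. The map is built on the
  free algebra, passes to \<open>uio\<close> because its kernel is an ideal containing the relators,
  and is then extended coefficientwise.\<close>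

lemma uio_hom_ex:
  fixes t :: "io_gen \<Rightarrow> 'b::{halgebra,hcomplete}"
  assumes t: "io_rep t"
  shows "\<exists>F. alg_hom F \<and> (\<forall>g. F (fps_const (io g)) = t g)"
proof -
  let ?H = "hfree (word_prod t)"
  note hom = halgebra_homD[OF free_hom(1)[of t]]
  define f where "f v = ?H (fps_const v)" for v
  have f: "f (x + y) = f x + f y" "f (x - y) = f x - f y" "f (x * y) = f x * f y" "f (a *\<^sub>c x) = fps_const a *\<^sub>h f x"
    "f 0 = 0" "f 1 = 1" "f (free_gen g) = t g" for x y a g
    using hom free_hom(2)[of t g]
    by (simp_all add: f_def hlinear_simps hscale_fps_const[symmetric] flip: fps_const_add fps_const_sub fps_const_mult)
  have fs: "f (\<Sum>i\<in>I. g i) = (\<Sum>i\<in>I. f (g i))" for I :: "space set" and g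
    by (induction I rule: infinite_finite_induct) (simp_all add: f)
  have fc: "f (comm x y) = comm (f x) (f y)" for x y by (simp add: comm_def f)
  have "two_sided_ideal {v. f v = 0}" by (simp add: two_sided_ideal_def f)
  moreover have "io_relators \<subseteq> {v. f v = 0}"
    unfolding io_relators_def Let_def
    by (intro Un_least subsetI CollectI; elim CollectE exE conjE) (simp_all add: f fs fc io_repD[OF t])
  ultimately have K: "io_ideal \<subseteq> {v. f v = 0}" unfolding io_ideal_def by (simp add: hull_minimal)
  define T where "T u = f (rep_uio u)" for u
  have T: "T (abs_uio v) = f v" for v
  proof -
    have "io_eq (rep_uio (abs_uio v)) v"
      by (meson Quotient3_uio uio_equivp rep_abs_rsp_left equivp_reflp)
    thus ?thesis using K by (auto simp: io_eq_def T_def f)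
  qed
  have Tops: "T (x + y) = T x + T y" "T (x * y) = T x * T y" "T (a *\<^sub>c x) = fps_const a *\<^sub>h T x" for x y a
  proof -
    obtain v w where "x = abs_uio v" "y = abs_uio w" using abs_uio_surj[of x] abs_uio_surj[of y] by blast
    thus "T (x + y) = T x + T y" "T (x * y) = T x * T y" "T (a *\<^sub>c x) = fps_const a *\<^sub>h T x"
      by (simp_all add: abs_uio_ops[symmetric] T f)
  qed
  have lin: "clinear T" by (simp add: clinear_def Tops)
  have "hext T 1 = 1" using hext_const[OF lin, of 1] T[of 1] by (simp add: abs_uio_ops f)
  hence "alg_hom (hext T)"
    by (simp add: halgebra_hom_def hlinear_hext[OF lin] hext_mult[OF lin] Tops)
  moreover have "hext T (fps_const (io g)) = t g" for g
    by (simp add: hext_const[OF lin] abs_uio_ops(7)[symmetric] T f)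
  ultimately show ?thesis by blast
qed

lemma uio_h_word_induct:
  assumes S: "hclosed S" and w: "\<And>gs. fps_const (prod_list (map io gs)) \<in> S"
  shows "(L :: uio_h) \<in> S"
proof (rule fps_hclosed_induct[OF S])
  have a: "fps_const (abs_uio v) \<in> S" for v
  proof (induction v rule: poly_mapping_single_induct)
    case zero thus ?case using hclosedD(1)[OF S] by (simp add: abs_uio_ops)
  next
    case (add v k a)
    have "abs_uio (Poly_Mapping.single (Word gs) 1) = prod_list (map io gs)" for gs
    proof (induction gs)
      case Nil thus ?case using abs_uio_ops(6) by (simp add: zero_word_def[symmetric])
    next
      case (Cons g gs)
      have "Poly_Mapping.single (Word (g # gs)) 1 = free_gen g * Poly_Mapping.single (Word gs) 1"
        by (simp add: free_gen_def mult_single plus_word_def)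
      thus ?case using Cons by (simp add: abs_uio_ops)
    qed
    hence "abs_uio (Poly_Mapping.single k a) = a *\<^sub>c prod_list (map io (letters k))"
      by (cases k) (metis abs_uio_ops(4) cscale_single cscale_complex_def mult.right_neutral word.sel)
    hence "fps_const (abs_uio (Poly_Mapping.single k a)) \<in> S"
      using hclosedD(3)[OF S w, of "fps_const a" "letters k"] by (simp add: hscale_fps_const)
    thus ?case using hclosedD(2)[OF S add] by (simp add: abs_uio_ops flip: fps_const_add)
  qed
  show "fps_const u \<in> S" for u using a abs_uio_surj[of u] by auto
qed

lemma uio_h_induct:
  assumes S: "hclosed S" and one: "1 \<in> S" and step: "\<And>g L. L \<in> S \<Longrightarrow> fps_const (io g) * L \<in> S"
  shows "(L :: uio_h) \<in> S"
proof (rule uio_h_word_induct[OF S])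
  fix gs show "fps_const (prod_list (map io gs)) \<in> S"
    by (induction gs) (use one step in \<open>simp_all flip: fps_const_mult\<close>)
qed

text \<open>Peeling generators off on the right suits actions: in \<open>act (L * g) x\<close> the
  generator first turns a coordinate into a combination of coordinates and 1, to which the
  hypothesis on \<open>L\<close> applies.\<close>

lemma uio_h_induct_right:
  assumes S: "hclosed S" and one: "1 \<in> S" and step: "\<And>g L. L \<in> S \<Longrightarrow> L * fps_const (io g) \<in> S"
  shows "(L :: uio_h) \<in> S"
proof (rule uio_h_word_induct[OF S])
  fix gs show "fps_const (prod_list (map io gs)) \<in> S"
    by (induction gs rule: rev_induct) (use one step in \<open>simp_all flip: fps_const_mult\<close>)
qed

lemma uio_hom_eqI:
  fixes F G :: "uio_h \<Rightarrow> 'b::{halgebra,hcomplete}"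
  assumes "alg_hom F" "alg_hom G"
    "\<And>g. F (fps_const (io g)) = G (fps_const (io g))"
  shows "F = G"
proof
  fix L
  have "L \<in> {L. F L = G L}"
    by (rule uio_h_induct)
      (use halgebra_homD[OF assms(1)] halgebra_homD[OF assms(2)] assms(3) in \<open>auto intro: hclosed_equalizer\<close>)
  thus "F L = G L" by simp
qed

lemma uio_hom_ex1:
  fixes t :: "io_gen \<Rightarrow> 'b::{halgebra,hcomplete}"
  assumes "io_rep t"
  shows "\<exists>!F. alg_hom F \<and> (\<forall>g. F (fps_const (io g)) = t g)"
  by (rule ex_ex1I[OF uio_hom_ex[OF assms]]) (auto intro!: uio_hom_eqI)

lemma all_io_gen: "(\<forall>g. P g) \<longleftrightarrow> (\<forall>i. P (GM i)) \<and> (\<forall>i. P (GN i)) \<and> (\<forall>\<mu>. P (GP \<mu>))"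
  by (metis io_gen.exhaust)

lemma counit: "alg_hom counit" "counit (fps_const (io g)) = 0"
proof -
  have "io_rep (\<lambda>g. 0 :: complex fps)" by (simp add: io_rep_def comm_simps)
  from theI'[OF uio_hom_ex1[OF this]]
  show "alg_hom counit" "counit (fps_const (io g)) = 0"
    unfolding all_io_gen Mg_def[symmetric] Ng_def[symmetric] Pg_def[symmetric] counit_def[symmetric]
    by (cases g; simp add: Mg_def Ng_def Pg_def)+
qed

lemmas counit_hom = halgebra_homD[OF counit(1)]
lemmas counit_simps = counit(2) counit_hom(2,3) hlinear_simps[OF counit_hom(1)]

instance uio :: cunital
proof
  show "\<exists>e :: uio \<Rightarrow> complex. (\<forall>x y. e (x + y) = e x + e y) \<and> (\<forall>a x. e (a *\<^sub>c x) = a * e x) \<and> e 1 = 1"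
    by (intro exI[of _ "\<lambda>u. counit (fps_const u) $ 0"])
      (simp add: counit_simps hscale_complex_fps flip: fps_const_add hscale_fps_const)
qed

lemma halgebra_hom_tensor: "halgebra_hom (*) 1 tensor_mult (1 \<otimes>\<^sub>h 1) F \<longleftrightarrow> alg_hom F"
  for F :: "uio_h \<Rightarrow> ('a::hunital, 'b::hunital) htensor"
  by (simp add: times_htensor_def one_htensor_def)

lemma comm_htens: "comm (a \<otimes>\<^sub>h b) (c \<otimes>\<^sub>h d) = comm a c \<otimes>\<^sub>h (b * d) + (c * a) \<otimes>\<^sub>h comm b d"
  for a c :: "'a::hunital" and b d :: "'b::hunital"
  by (simp add: comm_def htens_mult htens_simps)

text \<open>\<open>a \<otimes> 1\<close> commutes with \<open>1 \<otimes> b\<close>, so the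
  commutator of two primitive elements is the primitive element of the commutator, and the relations
  are inherited from \<open>uio\<close>.\<close>

lemma primitive_coproduct: "alg_hom primitive_coproduct"
  "primitive_coproduct (fps_const (io g)) = fps_const (io g) \<otimes>\<^sub>h 1 + 1 \<otimes>\<^sub>h fps_const (io g)"
proof -
  let ?t = "\<lambda>g. fps_const (io g) \<otimes>\<^sub>h 1 + 1 \<otimes>\<^sub>h fps_const (io g) :: (uio_h, uio_h) htensor"
  have "comm (?t g) (?t k) = comm (fps_const (io g)) (fps_const (io k)) \<otimes>\<^sub>h 1 + 1 \<otimes>\<^sub>h comm (fps_const (io g)) (fps_const (io k))" for g k
    by (simp add: comm_simps comm_htens htens_simps)
  hence "io_rep ?t"
    using io_rep_io unfolding io_rep_def
    by (simp add: htens_simps sum.distrib hscale_add_right)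
  from theI'[OF uio_hom_ex1[OF this]]
  show "alg_hom primitive_coproduct"
    "primitive_coproduct (fps_const (io g)) = fps_const (io g) \<otimes>\<^sub>h 1 + 1 \<otimes>\<^sub>h fps_const (io g)"
    unfolding primitive_coproduct_def halgebra_hom_tensor by blast+
qed


subsection \<open>Kappa-Minkowski spacetime\<close>

lemma hlinear_abs_uan3: "hlinear abs_uan3"
  by (rule hlinearI) (simp_all add: plus_uan3.abs_eq hscale_uan3.abs_eq)

lemma abs_uan3_ops: "abs_uan3 (x * y) = abs_uan3 x * abs_uan3 y" "abs_uan3 1 = 1"
  "abs_uan3 (fps_const (free_gen \<mu>)) = Xg \<mu>"
  by (simp_all add: times_uan3.abs_eq one_uan3_def Xg_def)

lemma abs_uan3_surj: "\<exists>v. u = abs_uan3 v"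
  by (metis Quotient3_abs_rep Quotient3_uan3)

lemma abs_uan3_eq_0: "abs_uan3 v = 0 \<longleftrightarrow> v \<in> an3_ideal"
  by (simp add: zero_uan3_def uan3.abs_eq_iff an3_eq_def)

lemma hsubmodule_ideal: "two_sided_ideal I \<Longrightarrow> hsubmodule (I :: 'a::halgebra set)"
  unfolding hsubmodule_def using two_sided_idealD(1,2) ideal_hscale by blast

instance uan3 :: hcomplete
proof
  note * = hcomplete_quotient[OF hlinear_abs_uan3 abs_uan3_surj]
  have "closed an3_ideal" unfolding an3_ideal_def hull_def by (rule closed_Inter) blast
  hence cl: "hclosed {f. abs_uan3 f = 0}"
    by (simp add: abs_uan3_eq_0 closed_iff_hclosed hsubmodule_ideal two_sided_ideal_an3)
  show "(\<And>n. \<exists>z. x = fps_X ^ n *\<^sub>h z) \<Longrightarrow> x = 0" for x :: uan3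
    by (rule *(1)[OF cl])
  show "\<exists>s. \<forall>N. \<exists>z. s - (\<Sum>n<N. fps_X ^ n *\<^sub>h u n) = fps_X ^ N *\<^sub>h z" for u :: "nat \<Rightarrow> uan3"
    by (rule *(2)[OF cl])
qed

definition an3_rep :: "(spacetime \<Rightarrow> 'b::halgebra) \<Rightarrow> bool"
  where "an3_rep X \<longleftrightarrow> (\<forall>i. comm (X Tm) (X (Sp i)) = (- fps_const \<i> * fps_X) *\<^sub>h X (Sp i))
    \<and> (\<forall>j k. comm (X (Sp j)) (X (Sp k)) = 0)"

text \<open>These relators contain \<open>h\<close>, so the quotient is taken after passing to power
  series, and the kernel has to be a closed ideal. It is closed because the target is
  separated.\<close>

lemma uan3_hom_ex:
  fixes X :: "spacetime \<Rightarrow> 'b::{halgebra,hcomplete}"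
  assumes X: "an3_rep X"
  shows "\<exists>F. alg_hom F \<and> (\<forall>\<mu>. F (Xg \<mu>) = X \<mu>)"
proof -
  let ?H = "hfree (word_prod X)"
  note hom = halgebra_homD[OF free_hom(1)[of X]]
  note gen = free_hom(2)[of X]
  note l = hlinear_simps[OF hom(1)]
  have tw: "two_sided_ideal {f. ?H f = 0}" by (simp add: two_sided_ideal_def l hom)
  moreover have "closed {f. ?H f = 0}"
    using closed_iff_hclosed[OF hsubmodule_ideal[OF tw]] hclosed_equalizer[OF hom(1) hlinear_zero] by simp
  moreover have "an3_relators \<subseteq> {f. ?H f = 0}"
    unfolding an3_relators_def Let_def
    by (intro Un_least subsetI CollectI; elim CollectE exE conjE)
      (use X in \<open>simp_all add: l hom_comm[OF free_hom(1)] gen an3_rep_def\<close>)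
  ultimately have K: "an3_ideal \<subseteq> {f. ?H f = 0}" unfolding an3_ideal_def by (simp add: hull_minimal)
  define F where "F u = ?H (rep_uan3 u)" for u
  have F: "F (abs_uan3 v) = ?H v" for v
  proof -
    have "an3_eq (rep_uan3 (abs_uan3 v)) v"
      by (meson Quotient3_uan3 uan3_equivp rep_abs_rsp_left equivp_reflp)
    thus ?thesis using K by (auto simp: an3_eq_def F_def l)
  qed
  have "F (x + y) = F x + F y \<and> F (x * y) = F x * F y \<and> F (a *\<^sub>h x) = a *\<^sub>h F x" for x y a
  proof -
    obtain v w where "x = abs_uan3 v" "y = abs_uan3 w" using abs_uan3_surj[of x] abs_uan3_surj[of y] by blast
    thus ?thesis
      by (simp add: abs_uan3_ops[symmetric] hlinear_simps[OF hlinear_abs_uan3, symmetric] F l hom)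
  qed
  moreover have "F 1 = 1" using F[of 1] hom(2) by (simp add: abs_uan3_ops)
  ultimately have "alg_hom F" by (simp add: halgebra_hom_def hlinear_def)
  moreover have "F (Xg \<mu>) = X \<mu>" for \<mu> using F[of "fps_const (free_gen \<mu>)"] gen by (simp add: abs_uan3_ops)
  ultimately show ?thesis by blast
qed

lemma uan3_induct:
  assumes S: "hclosed S" and one: "1 \<in> S" and step: "\<And>\<mu> u. u \<in> S \<Longrightarrow> Xg \<mu> * u \<in> S"
  shows "u \<in> S"
proof -
  have "f \<in> {f. abs_uan3 f \<in> S}" for f
  proof (rule free_hclosed_induct)
    show "hclosed {f. abs_uan3 f \<in> S}" by (rule hclosed_vimage[OF hlinear_abs_uan3 S])
    fix k :: "spacetime word"
    have "abs_uan3 (fps_const (Poly_Mapping.single (Word \<mu>s) 1)) \<in> S" for \<mu>s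
    proof (induction \<mu>s)
      case Nil thus ?case using one by (simp add: zero_word_def[symmetric] abs_uan3_ops)
    next
      case (Cons \<mu> \<mu>s)
      have "Poly_Mapping.single (Word (\<mu> # \<mu>s)) 1 = free_gen \<mu> * Poly_Mapping.single (Word \<mu>s) 1"
        by (simp add: free_gen_def mult_single plus_word_def)
      thus ?case using step[OF Cons] by (simp add: abs_uan3_ops(1,3)[symmetric])
    qed
    thus "fps_const (Poly_Mapping.single k 1) \<in> {f. abs_uan3 f \<in> S}" by (cases k) simp
  qed
  thus ?thesis using abs_uan3_surj[of u] by blast
qed

lemma an3_rep_Xg: "an3_rep Xg"
proof -
  have "r \<in> an3_relators \<Longrightarrow> abs_uan3 r = 0" for r
    unfolding abs_uan3_eq_0 an3_ideal_def by (rule hull_inc)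
  moreover have "abs_uan3 (comm x y) = comm (abs_uan3 x) (abs_uan3 y)" for x y
    by (simp add: comm_def abs_uan3_ops hlinear_simps[OF hlinear_abs_uan3])
  ultimately have r: "comm (Xg \<mu>) (Xg \<nu>) = abs_uan3 c"
    if "comm (fps_const (free_gen \<mu>)) (fps_const (free_gen \<nu>)) - c \<in> an3_relators" for \<mu> \<nu> c
    using that abs_uan3_ops(3) hlinear_diff[OF hlinear_abs_uan3] by (metis eq_iff_diff_eq_0)
  have "comm (Xg Tm) (Xg (Sp i)) = (- fps_const \<i> * fps_X) *\<^sub>h Xg (Sp i)" for i
    by (subst r[where c="(- fps_const \<i> * fps_X) *\<^sub>h fps_const (free_gen (Sp i))"])
      (auto simp: an3_relators_def Let_def hlinear_simps[OF hlinear_abs_uan3] abs_uan3_ops)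
  moreover have "comm (Xg (Sp j)) (Xg (Sp k)) = 0" for j k
    by (subst r[where c=0])
      (auto simp: an3_relators_def Let_def hlinear_simps[OF hlinear_abs_uan3])
  ultimately show ?thesis by (simp add: an3_rep_def)
qed


subsection \<open>Polynomials\<close>

definition xvar :: "spacetime \<Rightarrow> x4 fps"
  where "xvar \<mu> = fps_const (Poly_Mapping.single (Poly_Mapping.single \<mu> 1) 1)"

lemma eta_square [simp]: "eta \<mu> * eta \<mu> = 1" "fps_const (eta \<mu>) * fps_const (eta \<mu>) = 1"
  by (cases \<mu>; simp)+

lemma xg_xvar: "xg \<mu> = fps_const (eta \<mu>) *\<^sub>h xvar \<mu>"
  by (simp add: xg_def xvar_def hscale_fps_const)

lemma xvar_xg: "xvar \<mu> = fps_const (eta \<mu>) *\<^sub>h xg \<mu>"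
  by (simp add: xg_xvar hscale_hscale hscale_one)

lemma x4_induct:
  assumes S: "hclosed S" and one: "1 \<in> S" and step: "\<And>\<mu> u. u \<in> S \<Longrightarrow> xg \<mu> * u \<in> S"
  shows "(f :: x4 fps) \<in> S"
proof (rule free_hclosed_induct[OF S])
  have v: "xvar \<mu> * u \<in> S" if "u \<in> S" for u \<mu>
    using hclosedD(3)[OF S step[OF that]] by (simp add: xvar_xg hscale_mult_left)
  fix m :: "spacetime \<Rightarrow>\<^sub>0 nat"
  show "fps_const (Poly_Mapping.single m 1) \<in> S"
  proof (induction m rule: poly_mapping_single_induct)
    case zero thus ?case using one by simp
  next
    case (add m \<mu> a)
    show ?case
    proof (induction a)
      case 0 thus ?case using add by simp
    next
      case (Suc a)
      have "Poly_Mapping.single (m + Poly_Mapping.single \<mu> (Suc a)) 1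
          = Poly_Mapping.single (Poly_Mapping.single \<mu> 1) (1::complex) * Poly_Mapping.single (m + Poly_Mapping.single \<mu> a) 1"
        by (simp add: mult_single single_add[symmetric] add.left_commute)
      thus ?case using v[OF Suc] by (simp add: xvar_def)
    qed
  qed
qed


section \<open>The square root and the shift operator\<close>

text \<open>If \<open>S = 1 + h T\<close>, then \<open>S D + D S = 0\<close> gives \<open>2 D = - h (T D + D T)\<close>, so \<open>D\<close> is divisible by
  every power of \<open>h\<close>.\<close>

lemma anticommute_zero:
  fixes S D :: "'a::{halgebra,hcomplete}"
  assumes S: "hsmall 1 (S - 1)" and D: "S * D + D * S = 0"
  shows "D = 0"
proof (rule hsmall_all)
  obtain T where T: "S - 1 = fps_X *\<^sub>h T" using S by (rule hsmall_1E)
  hence T: "S = 1 + fps_X *\<^sub>h T" by (simp add: algebra_simps)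
  have "D + D = - (fps_X *\<^sub>h (T * D + D * T))"
    using D unfolding T
    by (simp add: algebra_simps hscale_mult_left hscale_mult_right hscale_add_right eq_neg_iff_add_eq_0)
  hence "fps_const (1/2) *\<^sub>h (D + D) = fps_X *\<^sub>h fps_const (-1/2) *\<^sub>h (T * D + D * T)"
    by (simp add: hscale_left_commute[of fps_X] hscale_minus_right hscale_minus_left flip: fps_const_neg)
  moreover have "fps_const (1/2) *\<^sub>h (D + D) = D"
    unfolding hscale_add_right hscale_add_left[symmetric] by (simp add: hscale_one)
  ultimately have E: "D = fps_X *\<^sub>h fps_const (-1/2) *\<^sub>h (T * D + D * T)" by simp
  fix n show "hsmall n D"
  proof (induction n)
    case (Suc n)
    show ?case
      by (subst E) (intro hsmall_Suc hsmall_scale hsmall_add hsmall_mult_left hsmall_mult_right Suc)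
  qed simp
qed

text \<open>\<open>[S S, D]\<close> equals \<open>S [S, D] + [S, D] S\<close>, so
  \<open>anticommute_zero\<close> applies to \<open>[S, D]\<close>. A square root close to 1
  commutes with whatever its square commutes with; the binomial series does not enter.\<close>

lemma comm_sqrt:
  fixes S D :: "'a::{halgebra,hcomplete}"
  assumes S: "hsmall 1 (S - 1)" and D: "comm (S * S) D = 0"
  shows "comm S D = 0"
  by (rule anticommute_zero[OF S]) (use D in \<open>simp add: comm_mult_left\<close>)

text \<open>In degree \<open>2 k\<close>, Vandermonde's convolution turns the products of binomials
  of \<open>1/2\<close> into \<open>1 gchoose k\<close>, which vanishes from \<open>k = 2\<close>
  on.\<close>

lemma sqrtP_square: "sqrtP * sqrtP = 1 - fps_X ^ 2 *\<^sub>h fps_const P2"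
proof (rule fps_ext)
  fix n
  let ?g = "\<lambda>i. ((1/2::complex) gchoose i)"
  show "(sqrtP * sqrtP) $ n = (1 - fps_X ^ 2 *\<^sub>h fps_const P2) $ n"
  proof (cases "even n")
    case True
    then obtain k where n: "n = 2 * k" by blast
    have "(sqrtP * sqrtP) $ n = (\<Sum>i\<in>{0..2*k}. if even i then (?g (i div 2) *\<^sub>c (- P2) ^ (i div 2)) * (?g ((2*k-i) div 2) *\<^sub>c (- P2) ^ ((2*k-i) div 2)) else 0)"
      unfolding fps_mult_nth n sqrtP_def by (rule sum.cong) auto
    also have "\<dots> = (\<Sum>i\<in>(\<lambda>j. 2*j) ` {0..k}. (?g (i div 2) *\<^sub>c (- P2) ^ (i div 2)) * (?g ((2*k-i) div 2) *\<^sub>c (- P2) ^ ((2*k-i) div 2)))"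
      by (rule sum.mono_neutral_cong_right) (auto elim!: evenE)
    also have "\<dots> = (\<Sum>j\<in>{0..k}. (?g (k - j) * ?g j) *\<^sub>c (- P2) ^ k)"
      by (subst sum.reindex)
        (auto simp: inj_on_def cscale_mult_left cscale_mult_right cscale_cscale diff_mult_distrib2[symmetric]
          simp flip: power_add intro!: sum.cong)
    also have "\<dots> = (1 gchoose k :: complex) *\<^sub>c (- P2) ^ k"
      using gbinomial_Vandermonde[of "1/2::complex" "1/2" k] by (simp add: cscale_sum_left[symmetric] mult.commute)
    also have "(1 gchoose k :: complex) = (if k \<le> 1 then 1 else 0)"
    proof -
      have "(1 gchoose k :: complex) = of_nat (1 choose k)" by (simp add: binomial_gbinomial)
      thus ?thesis by (cases "k = 0 \<or> k = 1") auto
    qed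
    also have "(if k \<le> 1 then 1 else 0) *\<^sub>c (- P2) ^ k = (1 - fps_X ^ 2 *\<^sub>h fps_const P2) $ n"
      by (cases "k = 0"; cases "k = 1") (auto simp: n fps_X_power_hscale_nth cscale_one)
    finally show ?thesis .
  next
    case False
    have "(sqrtP * sqrtP) $ n = (\<Sum>i\<in>{0..n}. 0)"
      unfolding fps_mult_nth sqrtP_def using False by (intro sum.cong) auto
    thus ?thesis using False by (auto simp: fps_X_power_hscale_nth odd_pos)
  qed
qed

lemma sqrtP_small: "hsmall 1 (sqrtP - 1)"
  by (simp add: hsmall_fps_iff sqrtP_def cscale_one)

lemmas io_rels = io_repD[OF io_rep_io, folded Mg_def Ng_def Pg_def]

lemma fps_const_P2: "fps_const P2 = (\<Sum>i\<in>UNIV. Pg (Sp i) * Pg (Sp i)) - Pg Tm * Pg Tm"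
  by (simp add: P2_def Pg_def power2_eq_square fps_const_sum fps_const_sub[symmetric] del: fps_const_sub flip: fps_const_mult)

lemma sum_space: "(\<Sum>i\<in>UNIV. f i) = f I1 + f I2 + f I3"
  by (simp add: UNIV_space add.assoc)

lemma sum_spacetime: "(\<Sum>i\<in>UNIV. f i) = f Tm + f (Sp I1) + f (Sp I2) + f (Sp I3)"
  by (simp add: UNIV_spacetime add.assoc)

lemma all_space: "(\<forall>i. P i) \<longleftrightarrow> P I1 \<and> P I2 \<and> P I3"
  by (metis space.exhaust)

lemma all_spacetime: "(\<forall>\<mu>. P \<mu>) \<longleftrightarrow> P Tm \<and> (\<forall>i. P (Sp i))"
  by (metis spacetime.exhaust)

text \<open>The mass Casimir: under a rotation the spatial terms cancel by antisymmetry, and a boost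
  changes the spatial and the temporal part by the same amount.\<close>

lemma comm_P2: "comm (Pg \<mu>) (fps_const P2) = 0" "comm (Mg i) (fps_const P2) = 0" "comm (Ng i) (fps_const P2) = 0"
proof -
  have c: "Pg \<mu> * Pg \<nu> = Pg \<nu> * Pg \<mu>" for \<mu> \<nu> using io_rels(4)[of \<mu> \<nu>] by (simp add: comm_eq_0_iff)
  show "comm (Pg \<mu>) (fps_const P2) = 0"
    by (simp add: fps_const_P2 comm_simps comm_sum comm_mult_right io_rels)
  show "comm (Mg i) (fps_const P2) = 0"
    by (cases i) (simp_all add: fps_const_P2 comm_simps comm_sum comm_mult_right io_rels sum_space
        hscale_mult_left hscale_mult_right hscale_minus_left c[of "Sp I2" "Sp I1"] c[of "Sp I3" "Sp I1"] c[of "Sp I3" "Sp I2"] flip: fps_const_neg)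
  show "comm (Ng i) (fps_const P2) = 0"
    by (cases i) (simp_all add: fps_const_P2 comm_simps comm_sum comm_mult_right io_rels sum_space delta_def
        hscale_mult_left hscale_mult_right hscale_minus_left c[of "Sp I1" Tm] c[of "Sp I2" Tm] c[of "Sp I3" Tm] flip: fps_const_neg)
qed

lemma comm_sqrtP: "comm (Pg \<mu>) sqrtP = 0" "comm (Mg i) sqrtP = 0" "comm (Ng i) sqrtP = 0"
proof -
  have "comm L sqrtP = 0" if "comm L (fps_const P2) = 0" for L
  proof -
    have "comm (sqrtP * sqrtP) L = 0"
      using that comm_swap[of "fps_const P2" L] by (simp add: sqrtP_square comm_simps comm_hscale)
    thus ?thesis using comm_sqrt[OF sqrtP_small] comm_swap[of L] by simp
  qed
  thus "comm (Pg \<mu>) sqrtP = 0" "comm (Mg i) sqrtP = 0" "comm (Ng i) sqrtP = 0"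
    using comm_P2 by blast+
qed

lemma comm_inverse:
  fixes x y z :: "'a::ring_1"
  assumes "y * z = 1" "z * y = 1" shows "comm x z = - (z * comm x y * z)"
proof -
  have "0 = comm x (y * z)" using assms by simp
  also have "\<dots> = comm x y * z + y * comm x z" by (rule comm_mult_right)
  finally have "z * (comm x y * z + y * comm x z) = 0" by simp
  hence "z * comm x y * z + (z * y) * comm x z = 0" by (simp add: algebra_simps)
  thus ?thesis using assms by (simp add: eq_neg_iff_add_eq_0 add.commute)
qed

lemma comm_Xi: "comm (Pg \<mu>) Xi = 0" "comm (Mg i) Xi = 0"
  "comm (Ng i) Xi = (fps_const (- \<i>) * fps_X) *\<^sub>h Pg (Sp i)"
  by (simp_all add: Xi_def comm_simps comm_hscale io_rels comm_sqrtP hscale_hscale mult.commute)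

lemma comm_Xi_inv_P: "comm (Pg \<mu>) Xi_inv = 0"
  and comm_Xi_inv_M: "comm (Mg i) Xi_inv = 0"
  by (simp_all add: comm_inverse[OF Xi_inv(2,1)] comm_Xi)

lemma Pg_commute: "Pg \<mu> * Pg \<nu> = Pg \<nu> * Pg \<mu>" "Xi * Pg \<mu> = Pg \<mu> * Xi" "Xi_inv * Pg \<mu> = Pg \<mu> * Xi_inv"
  using io_rels(4) comm_Xi(1) comm_Xi_inv_P by (simp_all add: comm_eq_0_iff)

lemma Pg_left_commute: "Pg \<mu> * (Pg \<nu> * x) = Pg \<nu> * (Pg \<mu> * x)"
  "Xi * (Pg \<mu> * x) = Pg \<mu> * (Xi * x)" "Xi_inv * (Pg \<mu> * x) = Pg \<mu> * (Xi_inv * x)"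
  by (simp_all only: mult.assoc[symmetric] Pg_commute)

lemma comm_Xi_inv_N: "comm (Ng i) Xi_inv = (fps_const \<i> * fps_X) *\<^sub>h (Pg (Sp i) * (Xi_inv * Xi_inv))"
  by (simp add: comm_inverse[OF Xi_inv(2,1)] comm_Xi hscale_mult_left hscale_mult_right hscale_minus_left
      Pg_commute mult.assoc flip: fps_const_neg)

text \<open>The quadratic relation \<open>(\<Xi> - h P\<^sub>0)\<^sup>2 = 1 - h\<^sup>2 P\<^sup>2\<close>, multiplied by \<open>\<Xi>\<^sup>-\<^sup>1\<close>.\<close>

lemma Xi_inv_eq:
  "Xi_inv = Xi - (2 * fps_X) *\<^sub>h Pg Tm + fps_X ^ 2 *\<^sub>h (\<Sum>i\<in>UNIV. Pg (Sp i) * Pg (Sp i) * Xi_inv)"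
proof -
  have two: "(2 * fps_X) *\<^sub>h t = fps_X *\<^sub>h t + fps_X *\<^sub>h t" for t :: uio_h
    by (simp only: mult_2 hscale_add_left)
  have "sqrtP = Xi - fps_X *\<^sub>h Pg Tm" by (simp add: Xi_def)
  hence "(Xi - fps_X *\<^sub>h Pg Tm) * (Xi - fps_X *\<^sub>h Pg Tm) = 1 - fps_X ^ 2 *\<^sub>h fps_const P2"
    using sqrtP_square by simp
  hence "Xi * Xi - (2 * fps_X) *\<^sub>h (Pg Tm * Xi) + fps_X ^ 2 *\<^sub>h (\<Sum>i\<in>UNIV. Pg (Sp i) * Pg (Sp i)) = 1"
    unfolding two by (simp add: fps_const_P2 algebra_simps hscale_mult_left hscale_mult_right hscale_hscale power2_eq_square
        hscale_diff_right Pg_commute)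
  hence "(Xi * Xi - (2 * fps_X) *\<^sub>h (Pg Tm * Xi) + fps_X ^ 2 *\<^sub>h (\<Sum>i\<in>UNIV. Pg (Sp i) * Pg (Sp i))) * Xi_inv = Xi_inv"
    by simp
  thus ?thesis
    by (simp add: ring_distribs hscale_mult_left mult.assoc Xi_inv sum_distrib_right)
qed


section \<open>The kappa-Poincare coproduct\<close>

fun kappa_gen :: "io_gen \<Rightarrow> (uio_h, uio_h) htensor" where
  "kappa_gen (GM i) = Mg i \<otimes>\<^sub>h 1 + 1 \<otimes>\<^sub>h Mg i"
| "kappa_gen (GN i) = Ng i \<otimes>\<^sub>h 1 + Xi_inv \<otimes>\<^sub>h Ng i
          - fps_X *\<^sub>h (\<Sum>j\<in>UNIV. \<Sum>m\<in>UNIV.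
              fps_const (eps i j m) *\<^sub>h ((Pg (Sp j) * Xi_inv) \<otimes>\<^sub>h Mg m))"
| "kappa_gen (GP (Sp i)) = Pg (Sp i) \<otimes>\<^sub>h Xi + 1 \<otimes>\<^sub>h Pg (Sp i)"
| "kappa_gen (GP Tm) = Pg Tm \<otimes>\<^sub>h Xi + Xi_inv \<otimes>\<^sub>h Pg Tm
          + fps_X *\<^sub>h (\<Sum>m\<in>UNIV. (Pg (Sp m) * Xi_inv) \<otimes>\<^sub>h Pg (Sp m))"

lemma hscale_m1: "fps_const (-1) *\<^sub>h x = - x"
  by (metis hscale_minus_left hscale_one fps_const_neg fps_const_1_eq_1)

lemma comm_flip: "comm (Pg \<mu>) (Mg i) = - comm (Mg i) (Pg \<mu>)" "comm (Pg \<mu>) (Ng i) = - comm (Ng i) (Pg \<mu>)"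
  "comm (Ng i) (Mg j) = - comm (Mg j) (Ng i)"
  "comm Xi x = - comm x Xi" "comm Xi_inv x = - comm x Xi_inv"
  by (rule comm_swap)+

lemmas kappa_comm_simps = comm_simps comm_sum comm_hscale comm_htens comm_mult_right comm_mult_left
  io_rels comm_Xi comm_Xi_inv_P comm_Xi_inv_M comm_Xi_inv_N comm_flip

lemmas kappa_scalar_simps = hscale_hscale hscale_minus_left hscale_minus_right hscale_m1 hscale_one
  hscale_add_right hscale_diff_right hscale_mult_left hscale_mult_right htens_simps mult.assoc
  mult.commute[of fps_X "fps_const z" for z] mult.left_commute[of fps_X "fps_const z" for z]

text \<open>\<open>Xi_inv_eq\<close> times \<open>Xi_inv\<close>, solved for 1. The commutators of a
  boost with \<open>P_0\<close> and with another boost lead both to \<open>1 \<otimes> x\<close> and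
  to terms with \<open>Xi_inv * Xi_inv\<close>; eliminating the former makes the two sides
  comparable.\<close>

lemma one_htens:
  "1 \<otimes>\<^sub>h x = (Xi_inv * Xi_inv) \<otimes>\<^sub>h x + fps_X *\<^sub>h ((Pg Tm * Xi_inv) \<otimes>\<^sub>h x) + fps_X *\<^sub>h ((Pg Tm * Xi_inv) \<otimes>\<^sub>h x)
    - fps_X *\<^sub>h fps_X *\<^sub>h (\<Sum>i\<in>UNIV. (Pg (Sp i) * (Pg (Sp i) * (Xi_inv * Xi_inv))) \<otimes>\<^sub>h x)"
proof -
  have two: "(2 * fps_X) *\<^sub>h t = fps_X *\<^sub>h t + fps_X *\<^sub>h t" for t :: uio_h
    by (simp only: mult_2 hscale_add_left)
  have "Xi_inv * Xi_inv = (Xi - (2 * fps_X) *\<^sub>h Pg Tm + fps_X ^ 2 *\<^sub>h (\<Sum>i\<in>UNIV. Pg (Sp i) * Pg (Sp i) * Xi_inv)) * Xi_inv"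
    using Xi_inv_eq by simp
  hence "Xi_inv * Xi_inv = 1 - (fps_X *\<^sub>h (Pg Tm * Xi_inv) + fps_X *\<^sub>h (Pg Tm * Xi_inv))
      + fps_X *\<^sub>h fps_X *\<^sub>h (\<Sum>i\<in>UNIV. Pg (Sp i) * (Pg (Sp i) * (Xi_inv * Xi_inv)))"
    by (simp add: two ring_distribs hscale_mult_left mult.assoc Xi_inv sum_distrib_right power2_eq_square hscale_hscale)
  hence "1 = Xi_inv * Xi_inv + fps_X *\<^sub>h (Pg Tm * Xi_inv) + fps_X *\<^sub>h (Pg Tm * Xi_inv)
      - fps_X *\<^sub>h fps_X *\<^sub>h (\<Sum>i\<in>UNIV. Pg (Sp i) * (Pg (Sp i) * (Xi_inv * Xi_inv)))"
    by (simp add: algebra_simps)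
  from arg_cong[OF this, of "\<lambda>u. u \<otimes>\<^sub>h x"] show ?thesis by (simp only: htens_simps)
qed

lemma kappa_MM: "comm (kappa_gen (GM i)) (kappa_gen (GM j)) = (\<Sum>k\<in>UNIV. fps_const (\<i> * eps i j k) *\<^sub>h kappa_gen (GM k))"
  by (simp add: kappa_comm_simps htens_simps sum.distrib hscale_add_right)

lemma kappa_PP: "comm (kappa_gen (GP \<mu>)) (kappa_gen (GP \<nu>)) = 0"
  by (cases \<mu>; cases \<nu>) (simp_all add: kappa_comm_simps htens_simps)

lemma kappa_MP0: "comm (kappa_gen (GM j)) (kappa_gen (GP Tm)) = 0"
  by (cases j) (simp_all add: kappa_comm_simps sum_space kappa_scalar_simps flip: fps_const_neg)

lemma kappa_MP: "comm (kappa_gen (GM j)) (kappa_gen (GP (Sp k))) = (\<Sum>l\<in>UNIV. fps_const (\<i> * eps j k l) *\<^sub>h kappa_gen (GP (Sp l)))"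
  by (simp add: kappa_comm_simps htens_simps sum.distrib hscale_add_right)

lemma kappa_MN: "comm (kappa_gen (GM i)) (kappa_gen (GN j)) = (\<Sum>l\<in>UNIV. fps_const (\<i> * eps i j l) *\<^sub>h kappa_gen (GN l))"
  by (cases i; cases j) (simp_all add: kappa_comm_simps sum_space kappa_scalar_simps flip: fps_const_neg)

lemma kappa_NP: "comm (kappa_gen (GN j)) (kappa_gen (GP (Sp k))) = fps_const (- \<i> * delta j k) *\<^sub>h kappa_gen (GP Tm)"
  by (cases j; cases k) (simp_all add: kappa_comm_simps sum_space kappa_scalar_simps delta_def Pg_commute Pg_left_commute flip: fps_const_neg)

lemma kappa_NP0: "comm (kappa_gen (GN j)) (kappa_gen (GP Tm)) = fps_const (- \<i>) *\<^sub>h kappa_gen (GP (Sp j))"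
  by (cases j) ((simp_all add: kappa_comm_simps sum_space kappa_scalar_simps delta_def Pg_commute Pg_left_commute flip: fps_const_neg), (simp_all add: one_htens sum_space kappa_scalar_simps flip: fps_const_neg)?)

lemma kappa_NN: "comm (kappa_gen (GN i)) (kappa_gen (GN j)) = (\<Sum>l\<in>UNIV. fps_const (- \<i> * eps i j l) *\<^sub>h kappa_gen (GM l))"
  by (cases i; cases j) ((simp_all add: kappa_comm_simps sum_space kappa_scalar_simps delta_def Pg_commute Pg_left_commute flip: fps_const_neg), (simp_all add: one_htens sum_space kappa_scalar_simps flip: fps_const_neg)?)

lemma kappa_coproduct: "alg_hom kappa_coproduct"
  "kappa_coproduct (fps_const (io g)) = kappa_gen g"
proof -
  \<comment> \<open>Space before time, unlike \<open>all_spacetime\<close>, to match the order of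
    the conjuncts in \<open>kappa_coproduct_def\<close>.\<close>
  have all: "(\<forall>\<mu>. P \<mu>) \<longleftrightarrow> (\<forall>i. P (Sp i)) \<and> P Tm" for P by (metis spacetime.exhaust)
  have "kappa_coproduct = (THE \<Delta>. alg_hom \<Delta> \<and> (\<forall>g. \<Delta> (fps_const (io g)) = kappa_gen g))"
    unfolding kappa_coproduct_def halgebra_hom_tensor all_io_gen all kappa_gen.simps
      Mg_def[symmetric] Ng_def[symmetric] Pg_def[symmetric] by (rule refl)
  moreover have "io_rep kappa_gen"
    unfolding io_rep_def
    by (intro conjI allI kappa_MM kappa_MN kappa_NN kappa_PP kappa_MP0 kappa_MP kappa_NP kappa_NP0)
  ultimately show "alg_hom kappa_coproduct" "kappa_coproduct (fps_const (io g)) = kappa_gen g"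
    using theI'[OF uio_hom_ex1[of kappa_gen]] by simp_all
qed


section \<open>Covariance relations\<close>

text \<open>Both sides are linear in \<open>s\<close> and in \<open>t\<close>, so pure tensors
  decide. With a multiplicative coproduct this evaluates the Sweedler sum belonging to a product of
  symmetries.\<close>

lemma sweedler_mult:
  fixes b :: "'a::hunital \<Rightarrow> 'b::hunital \<Rightarrow> 'c::hcomplete"
  assumes b: "hbilinear b"
  shows "sweedler b (s * t) = sweedler (\<lambda>c d. sweedler (\<lambda>a e. b (a * c) (e * d)) s) t"
proof -
  note bl = hbilinearD[OF b]
  have b1: "hbilinear (\<lambda>a e. b (a * c) (e * d))" for c d
    by (intro hbilinearI hlinear_comp[OF bl(1)] hlinear_comp[OF bl(2)] hlinear_mult_right hlinear_id)
  have b2: "hbilinear (\<lambda>c d. sweedler (\<lambda>a e. b (a * c) (e * d)) s)" for s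
    by (intro hbilinearI hlinear_sweedler_param b1 hlinear_comp[OF bl(1)] hlinear_comp[OF bl(2)] hlinear_mult_left hlinear_id)
  have b3: "hlinear (\<lambda>s. sweedler (\<lambda>c d. sweedler (\<lambda>a e. b (a * c) (e * d)) s) t)" for t
    by (intro hlinear_sweedler_param b2 hlinear_sweedler b1)
  note l = hlinear_comp[OF hlinear_sweedler[OF b]] hlinear_mult_left hlinear_mult_right hlinear_id
  have b4: "hbilinear (\<lambda>c d. b (a * c) (e * d))" for a e
    by (intro hbilinearI hlinear_comp[OF bl(1)] hlinear_comp[OF bl(2)] hlinear_mult_left hlinear_id)
  have 1: "sweedler b ((a \<otimes>\<^sub>h e) * t) = sweedler (\<lambda>c d. b (a * c) (e * d)) t" for a e
    by (rule htensor_eqI[where F="\<lambda>t. sweedler b ((a \<otimes>\<^sub>h e) * t)"])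
      (simp_all add: l hlinear_sweedler b4 htens_mult sweedler_htens b)
  show ?thesis
    by (rule htensor_eqI[where F="\<lambda>s. sweedler b (s * t)"])
      (simp_all add: l b3 1 sweedler_htens b1)
qed

text \<open>The cross relations of a smash product in an algebra into which the coordinates map by
  \<open>\<alpha>\<close> and the symmetries by \<open>\<beta>\<close>, the latter acting on coordinates through \<open>A\<close>.\<close>

definition covariant :: "(uio_h \<Rightarrow> (uio_h, uio_h) htensor) \<Rightarrow> (uio_h \<Rightarrow> 'a hend) \<Rightarrow>
    ('a::hnontrivial \<Rightarrow> 'b::{halgebra,hcomplete}) \<Rightarrow> (uio_h \<Rightarrow> 'b) \<Rightarrow> uio_h \<Rightarrow> bool"
  where "covariant \<Delta> A \<alpha> \<beta> L \<longleftrightarrow> (\<forall>a. \<beta> L * \<alpha> a = sweedler (\<lambda>L1 L2. \<alpha> (app (A L1) a) * \<beta> L2) (\<Delta> L))"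

lemma covariant_bilinear:
  fixes A :: "uio_h \<Rightarrow> 'a::hnontrivial hend" and \<alpha> :: "'a \<Rightarrow> 'b::{halgebra,hcomplete}"
  assumes "hlinear A" "hlinear \<alpha>" "hlinear \<beta>"
  shows "hbilinear (\<lambda>L1 L2. \<alpha> (app (A L1) a) * \<beta> L2)"
  by (intro mult_bilinear assms hlinear_comp[OF assms(2)] hlinear_comp[OF hlinear_app_left])

text \<open>The set of symmetries obeying the cross relations is a subalgebra because the coproduct is
  multiplicative; in particular coassociativity is not needed.\<close>

lemma covariant_all:
  fixes A :: "uio_h \<Rightarrow> 'a::hnontrivial hend" and \<alpha> :: "'a \<Rightarrow> 'b::{halgebra,hcomplete}"
  assumes D: "alg_hom \<Delta>" and A: "alg_hom A"
    and a: "hlinear \<alpha>" and B: "alg_hom \<beta>"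
    and gen: "\<And>g. covariant \<Delta> A \<alpha> \<beta> (fps_const (io g))"
  shows "covariant \<Delta> A \<alpha> \<beta> L"
proof -
  note D' = halgebra_homD[OF D] and A' = halgebra_homD[OF A] and B' = halgebra_homD[OF B]
  note bl = covariant_bilinear[OF A'(1) a B'(1)]
  have mult: "covariant \<Delta> A \<alpha> \<beta> (K * L)" if K: "covariant \<Delta> A \<alpha> \<beta> K" and L: "covariant \<Delta> A \<alpha> \<beta> L" for K L
    unfolding covariant_def
  proof
    fix x
    have "\<beta> (K * L) * \<alpha> x = \<beta> K * sweedler (\<lambda>L1 L2. \<alpha> (app (A L1) x) * \<beta> L2) (\<Delta> L)"
      using L by (simp add: B' mult.assoc covariant_def)
    also have "\<dots> = sweedler (\<lambda>L1 L2. \<beta> K * (\<alpha> (app (A L1) x) * \<beta> L2)) (\<Delta> L)"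
      by (rule hlinear_of_sweedler[OF _ bl]) (rule hlinear_mult_left[OF hlinear_id])
    also have "\<dots> = sweedler (\<lambda>L1 L2. sweedler (\<lambda>K1 K2. \<alpha> (app (A K1) (app (A L1) x)) * \<beta> K2 * \<beta> L2) (\<Delta> K)) (\<Delta> L)"
    proof -
      have "\<beta> K * (\<alpha> y * z) = sweedler (\<lambda>K1 K2. \<alpha> (app (A K1) y) * \<beta> K2 * z) (\<Delta> K)" for y z
        using K hlinear_of_sweedler[OF hlinear_mult_right[OF hlinear_id, where a=z] bl]
        by (simp add: covariant_def mult.assoc[symmetric])
      thus ?thesis by simp
    qed
    also have "\<dots> = sweedler (\<lambda>L1 L2. \<alpha> (app (A L1) x) * \<beta> L2) (\<Delta> K * \<Delta> L)"
      by (simp add: sweedler_mult[OF bl] A' B' mult.assoc)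
    finally show "\<beta> (K * L) * \<alpha> x = sweedler (\<lambda>L1 L2. \<alpha> (app (A L1) x) * \<beta> L2) (\<Delta> (K * L))"
      by (simp add: D')
  qed
  let ?S = "{L. \<forall>a. \<beta> L * \<alpha> a = sweedler (\<lambda>L1 L2. \<alpha> (app (A L1) a) * \<beta> L2) (\<Delta> L)}"
  have "L \<in> ?S"
  proof (rule uio_h_induct)
    show "hclosed ?S"
      by (intro hclosed_all_eq hlinear_mult_right B' hlinear_comp[OF hlinear_sweedler[OF bl]] D')
    show "1 \<in> ?S"
      by (simp add: D' A' B' one_htensor_def sweedler_htens[OF bl])
    show "fps_const (io g) * L \<in> ?S"
      if "L \<in> ?S" for g L
      using mult[OF gen, of L g] that unfolding covariant_def by blast
  qed
  thus ?thesis unfolding covariant_def by blast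
qed


subsection \<open>Module algebras\<close>

definition lmul :: "'a::halgebra \<Rightarrow> 'a hend" where "lmul a = Hend ((*) a)"

lemma app_lmul [simp]: "app (lmul a) x = a * x"
  unfolding lmul_def by (simp add: app_Hend hlinear_mult_left[OF hlinear_id])

lemma lmul_hom: "alg_hom (lmul :: 'a::{halgebra,hnontrivial} \<Rightarrow> _)"
  unfolding halgebra_hom_def
  by (intro conjI allI hlinearI; rule hend_eqI) (simp_all add: algebra_simps hscale_mult_left)

lemmas lmul_homD = halgebra_homD[OF lmul_hom]

text \<open>The product rule of a module algebra is the cross relation between the operators
  \<open>A L\<close> and the left multiplications, evaluated at an element. Hence
  \<open>covariant\<close> with \<open>lmul\<close> in the role of the coordinates reduces it to
  generators.\<close>

lemma module_algebraI:
  fixes A :: "uio_h \<Rightarrow> 'a::{halgebra,hnontrivial} hend"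
  assumes A: "alg_hom A"
    and one: "\<And>L. app (A L) 1 = counit L *\<^sub>h 1"
    and cov: "\<And>L. covariant \<Delta> A lmul A L"
  shows "module_algebra \<Delta> counit (\<lambda>L. app (A L))"
  unfolding module_algebra_def
proof (intro conjI allI)
  note A' = halgebra_homD[OF A]
  show "hbilinear (\<lambda>L. app (A L))"
    by (intro hbilinearI hlinear_app hlinear_comp[OF hlinear_app_left] A')
  fix L a b
  have "app (A L) (a * b) = app (A L * lmul a) b" by simp
  also have "\<dots> = sweedler (\<lambda>L1 L2. app (lmul (app (A L1) a) * A L2) b) (\<Delta> L)"
    using cov[of L] hlinear_of_sweedler[OF hlinear_app_left covariant_bilinear[OF A'(1) lmul_homD(1) A'(1)]]
    by (simp add: covariant_def)
  finally show "app (A L) (a * b) = sweedler (\<lambda>L1 L2. app (A L1) a * app (A L2) b) (\<Delta> L)" by simp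
qed (simp_all add: one halgebra_homD[OF A])

text \<open>The action in terms of \<open>M\<close>, \<open>N\<close>, \<open>P\<close> and of
  coordinates with lower index, which moves the metric into the value of \<open>P\<close>.\<close>

fun vector_value :: "(spacetime \<Rightarrow> 'a::halgebra) \<Rightarrow> io_gen \<Rightarrow> spacetime \<Rightarrow> 'a" where
  "vector_value X (GP \<mu>) \<nu> = fps_const (- \<i> * eta \<nu> * delta \<mu> \<nu>) *\<^sub>h 1"
| "vector_value X (GM i) Tm = 0"
| "vector_value X (GM i) (Sp j) = (\<Sum>k\<in>UNIV. fps_const (\<i> * eps i j k) *\<^sub>h X (Sp k))"
| "vector_value X (GN i) Tm = fps_const (- \<i>) *\<^sub>h X (Sp i)"
| "vector_value X (GN i) (Sp j) = fps_const (- \<i> * delta i j) *\<^sub>h X Tm"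

lemma vector_action_iff:
  fixes act :: "uio_h \<Rightarrow> 'a::halgebra \<Rightarrow> 'a"
  assumes act: "hbilinear act"
  shows "vector_action X act \<longleftrightarrow> (\<forall>g \<nu>. act (fps_const (io g)) (X \<nu>) = vector_value X g \<nu>)"
proof
  note l = hlinear_simps[OF hbilinearD(1)[OF act]] hlinear_simps[OF hbilinearD(2)[OF act]]
  have eta: "fps_const (eta \<nu>) *\<^sub>h fps_const (eta \<nu>) *\<^sub>h x = x" for x :: 'a and \<nu>
    by (simp add: hscale_hscale hscale_one)
  have cancel: "y = fps_const (eta \<nu>) *\<^sub>h z" if "fps_const (eta \<nu>) *\<^sub>h y = z" for y z :: 'a and \<nu>
    using that eta by metis
  assume v: "vector_action X act"
  have P: "act (Pg \<mu>) (X \<nu>) = vector_value X (GP \<mu>) \<nu>" for \<mu> \<nu>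
    using v cancel unfolding vector_action_def
    by (fastforce simp: l hscale_hscale mult.commute mult.left_commute)
  have T: "act (Mten \<mu> \<nu>) (X \<rho>) = fps_const (eta \<rho>) *\<^sub>h (fps_const (\<i> * delta \<mu> \<rho>) *\<^sub>h X \<nu> - fps_const (\<i> * delta \<nu> \<rho>) *\<^sub>h X \<mu>)" for \<mu> \<nu> \<rho>
    by (rule cancel) (use v in \<open>simp add: vector_action_def l\<close>)
  have N: "act (Ng i) (X \<nu>) = vector_value X (GN i) \<nu>" for i \<nu>
    using T[of Tm "Sp i" \<nu>]
    by (cases \<nu>) (auto simp: delta_def hscale_minus_left hscale_minus_right hscale_m1 hscale_one simp flip: fps_const_neg)
  have M: "act (Mg i) (X \<nu>) = vector_value X (GM i) \<nu>" for i \<nu>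
  proof (cases \<nu>)
    case Tm
    thus ?thesis using T[of "Sp I1" "Sp I2" \<nu>] T[of "Sp I2" "Sp I3" \<nu>] T[of "Sp I3" "Sp I1" \<nu>]
      by (cases i) (simp_all add: sum_space hscale_one delta_def)
  next
    case (Sp j)
    thus ?thesis using T[of "Sp I1" "Sp I2" \<nu>] T[of "Sp I2" "Sp I3" \<nu>] T[of "Sp I3" "Sp I1" \<nu>]
      by (cases i; cases j) (simp_all add: sum_space hscale_one delta_def hscale_minus_left flip: fps_const_neg)
  qed
  show "\<forall>g \<nu>. act (fps_const (io g)) (X \<nu>) = vector_value X g \<nu>"
    using P N M unfolding all_io_gen Pg_def Ng_def Mg_def by blast
next
  note l = hlinear_simps[OF hbilinearD(1)[OF act]] hlinear_simps[OF hbilinearD(2)[OF act]]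
  assume "\<forall>g \<nu>. act (fps_const (io g)) (X \<nu>) = vector_value X g \<nu>"
  hence v: "act (Pg \<mu>) (X \<nu>) = vector_value X (GP \<mu>) \<nu>" "act (Ng i) (X \<nu>) = vector_value X (GN i) \<nu>"
    "act (Mg i) (X \<nu>) = vector_value X (GM i) \<nu>" for \<mu> \<nu> i
    unfolding all_io_gen Pg_def Ng_def Mg_def by blast+
  have T: "act (Mten \<mu> \<nu>) (fps_const (eta \<rho>) *\<^sub>h X \<rho>)
        = fps_const (\<i> * delta \<mu> \<rho>) *\<^sub>h X \<nu> - fps_const (\<i> * delta \<nu> \<rho>) *\<^sub>h X \<mu>" for \<mu> \<nu> \<rho>
  proof (cases \<rho>)
    case Tm
    thus ?thesis
      by (cases \<mu>; cases \<nu>)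
        (simp_all add: l v delta_def sum_space hscale_minus_left hscale_minus_right hscale_m1 hscale_one flip: fps_const_neg)
  next
    case (Sp k)
    show ?thesis
    proof (cases \<mu>)
      case \<mu>: (Sp i)
      show ?thesis
      proof (cases \<nu>)
        case (Sp j)
        thus ?thesis using \<open>\<rho> = Sp k\<close> \<mu>
          by (cases i; cases j; cases k)
            (simp_all add: l v delta_def sum_space hscale_minus_left hscale_minus_right hscale_m1 hscale_one flip: fps_const_neg)
      qed (use Sp \<mu> in \<open>auto simp: l v delta_def hscale_one hscale_minus_left simp flip: fps_const_neg\<close>)
    qed (cases \<nu>; use Sp in \<open>auto simp: l v delta_def hscale_one hscale_minus_left simp flip: fps_const_neg\<close>)
  qed
  have "act (Pg \<mu>) (fps_const (eta \<nu>) *\<^sub>h X \<nu>) = fps_const (- \<i> * delta \<mu> \<nu>) *\<^sub>h 1" for \<mu> \<nu>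
    by (cases \<nu>) (simp_all add: l v hscale_hscale delta_def)
  thus "vector_action X act" unfolding vector_action_def using T by blast
qed

text \<open>Each generator maps a coordinate to a combination of coordinates and 1, so induction on
  \<open>L\<close> fixes the action on coordinates; the product rule extends this to the whole
  algebra. The assumption \<open>gen\<close> abstracts \<open>x4_induct\<close> and
  \<open>uan3_induct\<close>.\<close>

lemma module_algebra_unique:
  fixes act act' :: "uio_h \<Rightarrow> 'a::{halgebra,hcomplete} \<Rightarrow> 'a"
  assumes m: "module_algebra \<Delta> \<epsilon> act" and m': "module_algebra \<Delta> \<epsilon> act'"
    and v: "vector_action X act" and v': "vector_action X act'"
    and gen: "\<And>S a. hclosed S \<Longrightarrow> 1 \<in> S \<Longrightarrow> (\<And>\<mu> u. u \<in> S \<Longrightarrow> X \<mu> * u \<in> S) \<Longrightarrow> a \<in> S"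
  shows "act = act'"
proof -
  have bl: "hbilinear act" "hbilinear act'" using m m' by (simp_all add: module_algebra_def)
  have one: "act L 1 = act' L 1" for L using m m' by (simp add: module_algebra_def)
  note vv = v[unfolded vector_action_iff[OF bl(1)]] v'[unfolded vector_action_iff[OF bl(2)]]
  note l = hlinear_simps[OF hbilinearD(1)[OF bl(1)]] hlinear_simps[OF hbilinearD(1)[OF bl(2)]]
  have X: "L \<in> {L. \<forall>\<nu>. act L (X \<nu>) = act' L (X \<nu>)}" for L
  proof (rule uio_h_induct_right)
    show "hclosed {L. \<forall>\<nu>. act L (X \<nu>) = act' L (X \<nu>)}"
      by (intro hclosed_all_eq hbilinearD(2) bl)
    show "1 \<in> {L. \<forall>\<nu>. act L (X \<nu>) = act' L (X \<nu>)}" using m m' by (simp add: module_algebra_def)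
    fix g L assume L: "L \<in> {L. \<forall>\<nu>. act L (X \<nu>) = act' L (X \<nu>)}"
    have "act L (vector_value X g \<nu>) = act' L (vector_value X g \<nu>)" for \<nu>
      by (cases "(X, g, \<nu>)" rule: vector_value.cases) (use L in \<open>simp_all add: l one\<close>)
    thus "L * fps_const (io g) \<in> {L. \<forall>\<nu>. act L (X \<nu>) = act' L (X \<nu>)}"
      using m m' vv by (simp add: module_algebra_def)
  qed
  have "a \<in> {a. \<forall>L. act L a = act' L a}" for a
  proof (rule gen)
    show "hclosed {a. \<forall>L. act L a = act' L a}" by (intro hclosed_all_eq hbilinearD(1) bl)
    fix \<mu> u assume u: "u \<in> {a. \<forall>L. act L a = act' L a}"
    have "act L (X \<mu> * u) = sweedler (\<lambda>L1 L2. act L1 (X \<mu>) * act L2 u) (\<Delta> L)"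
      "act' L (X \<mu> * u) = sweedler (\<lambda>L1 L2. act' L1 (X \<mu>) * act' L2 u) (\<Delta> L)" for L
      using m m' by (simp_all add: module_algebra_def)
    thus "X \<mu> * u \<in> {a. \<forall>L. act L a = act' L a}" using u X by simp
  qed (use one in simp)
  thus ?thesis by blast
qed


section \<open>The classical action\<close>

text \<open>The derivative by the coordinate with upper index. Truncated subtraction of exponents
  does no harm: where the exponent is 0, so is the coefficient.\<close>

definition pderiv_op :: "spacetime \<Rightarrow> x4 fps hend"
  where "pderiv_op \<mu> = Hend (hfree (\<lambda>m. fps_const
    (Poly_Mapping.single (m - Poly_Mapping.single \<mu> 1) (of_nat (Poly_Mapping.lookup m \<mu>)))))"

lemma pderiv_op_monomial: "app (pderiv_op \<mu>) (fps_const (Poly_Mapping.single m 1))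
    = fps_const (Poly_Mapping.single (m - Poly_Mapping.single \<mu> 1) (of_nat (Poly_Mapping.lookup m \<mu>)))"
  by (simp add: pderiv_op_def app_Hend hlinear_hfree hscale_one)

lemma pderiv_op_mult: "app (pderiv_op \<mu>) (f * g) = app (pderiv_op \<mu>) f * g + f * app (pderiv_op \<mu>) g"
proof -
  let ?D = "app (pderiv_op \<mu>)"
  let ?e = "\<lambda>m. fps_const (Poly_Mapping.single m (1::complex))"
  let ?u = "Poly_Mapping.single \<mu> (1::nat)"
  have d: "(m + n) - ?u = (m - ?u) + n" if "Poly_Mapping.lookup m \<mu> \<noteq> 0" for m n
    using that by (intro poly_mapping_eqI) (auto simp: lookup_minus lookup_add lookup_single when_def)
  have 0: "?D (?e m * ?e n) = ?D (?e m) * ?e n + ?e m * ?D (?e n)" for m n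
  proof -
    have "Poly_Mapping.single (m + n - ?u) (of_nat (Poly_Mapping.lookup m \<mu>))
        = Poly_Mapping.single (m - ?u + n) (of_nat (Poly_Mapping.lookup m \<mu>) :: complex)"
      using d[of m n] by (cases "Poly_Mapping.lookup m \<mu> = 0") simp_all
    moreover have "Poly_Mapping.single (m + n - ?u) (of_nat (Poly_Mapping.lookup n \<mu>))
        = Poly_Mapping.single (m + (n - ?u)) (of_nat (Poly_Mapping.lookup n \<mu>) :: complex)"
      using d[of n m] by (cases "Poly_Mapping.lookup n \<mu> = 0") (simp_all add: add.commute)
    ultimately show ?thesis
      by (simp add: mult_single pderiv_op_monomial lookup_add single_add)
  qed
  note l = hlinear_comp[OF hlinear_app] hlinear_mult_left hlinear_mult_right hlinear_id hlinear_plus hlinear_app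
  have 1: "?D (?e m * g) = ?D (?e m) * g + ?e m * ?D g" for m g
    by (rule free_hlinear_eqI[where F="\<lambda>g. ?D (?e m * g)"]) (intro l | rule 0)+
  show ?thesis
    by (rule free_hlinear_eqI[where F="\<lambda>f. ?D (f * g)"]) (intro l | rule 1)+
qed

lemma pderiv_op_1 [simp]: "app (pderiv_op \<mu>) 1 = 0"
  using pderiv_op_mult[of \<mu> 1 1] by simp

lemma pderiv_op_xg: "app (pderiv_op \<mu>) (xg \<nu>) = fps_const (eta \<nu> * delta \<mu> \<nu>) *\<^sub>h 1"
proof -
  have "app (pderiv_op \<mu>) (xvar \<nu>) = fps_const (delta \<mu> \<nu>) *\<^sub>h 1"
    unfolding xvar_def pderiv_op_monomial
    by (cases "\<mu> = \<nu>") (simp_all add: delta_def lookup_single hscale_one)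
  thus ?thesis by (simp add: xg_xvar app_simps hscale_hscale)
qed

lemma comm_pderiv_lmul: "comm (pderiv_op \<mu>) (lmul a) = lmul (app (pderiv_op \<mu>) a)"
  by (rule hend_eqI) (simp add: comm_def pderiv_op_mult)

lemma lmul_one: "lmul 1 = (1 :: 'a::{halgebra,hnontrivial} hend)"
  by (rule lmul_homD)

lemma comm_pderiv_xg: "comm (pderiv_op \<mu>) (lmul (xg \<nu>)) = fps_const (eta \<nu> * delta \<mu> \<nu>) *\<^sub>h 1"
  by (simp add: comm_pderiv_lmul pderiv_op_xg hlinear_simps[OF lmul_homD(1)] lmul_one)

lemma comm_lmul: "comm (lmul a) (lmul b) = 0" for a b :: "x4 fps"
  by (rule hend_eqI) (simp add: comm_def mult.left_commute)

text \<open>The commutator of two derivations is a derivation; this one vanishes on the coordinates,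
  hence everywhere.\<close>

lemma comm_pderiv_pderiv: "comm (pderiv_op \<mu>) (pderiv_op \<nu>) = 0"
proof (rule hend_eqI)
  fix f
  let ?E = "comm (pderiv_op \<mu>) (pderiv_op \<nu>)"
  have E: "comm ?E (lmul a) = lmul (app ?E a)" for a
    by (rule hend_eqI) (simp add: comm_def pderiv_op_mult app_simps algebra_simps)
  have "f \<in> {f. app ?E f = 0}"
  proof (rule x4_induct)
    show "hclosed {f. app ?E f = 0}" by (rule hclosed_equalizer[OF hlinear_app hlinear_zero])
    show "1 \<in> {f. app ?E f = 0}" by (simp add: comm_def app_simps)
    fix \<rho> u assume "u \<in> {f. app ?E f = 0}"
    moreover have "app ?E (xg \<rho>) = 0" by (simp add: comm_def pderiv_op_xg app_simps)
    ultimately show "xg \<rho> * u \<in> {f. app ?E f = 0}"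
      using arg_cong[OF E[of "xg \<rho>"], of "\<lambda>F. app F u"] by (simp add: comm_def[of ?E])
  qed
  thus "app ?E f = app 0 f" by simp
qed

text \<open>The vector fields of the Poincare group, normalized to have the values
  \<open>vector_value xg\<close> on the coordinates. Derivatives are by upper coordinates and the
  factors \<open>xg\<close> have lower indices, so no metric appears.\<close>

fun classical_gen :: "io_gen \<Rightarrow> x4 fps hend" where
  "classical_gen (GP \<mu>) = fps_const (- \<i>) *\<^sub>h pderiv_op \<mu>"
| "classical_gen (GN i) = fps_const \<i> *\<^sub>h (lmul (xg (Sp i)) * pderiv_op Tm - lmul (xg Tm) * pderiv_op (Sp i))"
| "classical_gen (GM k) = (\<Sum>i\<in>UNIV. \<Sum>j\<in>UNIV. fps_const (\<i> * eps k i j) *\<^sub>h (lmul (xg (Sp j)) * pderiv_op (Sp i)))"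

lemma comm_lmul_pderiv: "comm (lmul a) (pderiv_op \<mu>) = - comm (pderiv_op \<mu>) (lmul a)"
  by (rule comm_swap)

lemma io_rep_classical: "io_rep classical_gen"
proof -
  note simps = comm_simps comm_hscale comm_mult_left comm_mult_right comm_lmul_pderiv comm_pderiv_xg
    comm_lmul comm_pderiv_pderiv hscale_mult_left hscale_mult_right hscale_add_right hscale_diff_right
    hscale_minus_left hscale_minus_right hscale_hscale hscale_m1 hscale_one delta_def sum_space comm_sum
  show ?thesis
    unfolding io_rep_def all_space all_spacetime
    by (simp add: simps flip: fps_const_neg)
qed

definition classical_op :: "uio_h \<Rightarrow> x4 fps hend"
  where "classical_op = (THE A. alg_hom A \<and> (\<forall>g. A (fps_const (io g)) = classical_gen g))"

lemma classical_op: "alg_hom classical_op" "classical_op (fps_const (io g)) = classical_gen g"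
  using theI'[OF uio_hom_ex1[OF io_rep_classical]] unfolding classical_op_def by blast+

lemmas classical_hom = halgebra_homD[OF classical_op(1)]

lemma classical_gen_derivation: "comm (classical_gen g) (lmul a) = lmul (app (classical_gen g) a)"
proof -
  note s = comm_simps comm_hscale comm_mult_left comm_pderiv_lmul comm_lmul
     hlinear_simps[OF lmul_homD(1)] lmul_homD(3) app_sum comm_sum
  show ?thesis by (cases g) (simp_all add: s)
qed

lemma classical_gen_1: "app (classical_gen g) 1 = 0"
  by (cases g) (simp_all add: app_sum)

lemma classical_gen_xg: "app (classical_gen g) (xg \<nu>) = vector_value xg g \<nu>"
proof -
  note s = app_sum pderiv_op_xg hscale_hscale delta_def sum_space hscale_one hscale_minus_left hscale_minus_right
    hscale_m1 hscale_mult_right mult.commute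
  show ?thesis
  proof (cases g)
    case (GM i) show ?thesis
    proof (cases \<nu>)
      case (Sp j) with GM show ?thesis by (cases j) (simp_all add: s)
    qed (simp add: GM s)
  next
    case (GN i) thus ?thesis by (cases \<nu>) (auto simp: s simp flip: fps_const_neg)
  qed (simp add: s)
qed

lemma classical_1: "app (classical_op L) 1 = counit L *\<^sub>h 1"
proof -
  have "L \<in> {L. app (classical_op L) 1 = counit L *\<^sub>h 1}"
  proof (rule uio_h_induct_right)
    show "hclosed {L. app (classical_op L) 1 = counit L *\<^sub>h (1 :: x4 fps)}"
      by (intro hclosed_equalizer hlinear_comp[OF hlinear_app_left] classical_hom hlinear_hscale_left counit_hom)
  qed (simp_all add: classical_hom counit_simps classical_op classical_gen_1 hscale_one app_simps)
  thus ?thesis by simp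
qed

text \<open>For a primitive element the Sweedler sum has two terms, and the cross relation becomes a
  commutator.\<close>

lemma covariant_primitive:
  fixes A :: "uio_h \<Rightarrow> 'a::hnontrivial hend" and \<alpha> :: "'a \<Rightarrow> 'b::{halgebra,hcomplete}"
  assumes A: "alg_hom A"
    and a: "hlinear \<alpha>" and B: "alg_hom \<beta>"
    and gen: "\<And>g a. comm (\<beta> (fps_const (io g))) (\<alpha> a) = \<alpha> (app (A (fps_const (io g))) a)"
  shows "covariant primitive_coproduct A \<alpha> \<beta> L"
proof (rule covariant_all[OF primitive_coproduct(1) A a B])
  note bl = covariant_bilinear[OF halgebra_homD(1)[OF A] a halgebra_homD(1)[OF B]]
  show "covariant primitive_coproduct A \<alpha> \<beta> (fps_const (io g))" for g
    using gen[of g]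
    by (simp add: covariant_def primitive_coproduct hlinear_simps[OF hlinear_sweedler[OF bl]]
        sweedler_htens[OF bl] halgebra_homD[OF A] halgebra_homD[OF B] comm_def diff_eq_eq)
qed

lemma classical_action: "classical_action = (\<lambda>L. app (classical_op L))"
  unfolding classical_action_def
proof (rule the_equality)
  have m: "module_algebra primitive_coproduct counit (\<lambda>L. app (classical_op L))"
    by (intro module_algebraI classical_op(1) classical_1 covariant_primitive lmul_homD)
      (simp add: classical_op classical_gen_derivation)
  have v: "vector_action xg (\<lambda>L. app (classical_op L))"
    using m by (subst vector_action_iff) (simp_all add: module_algebra_def classical_op classical_gen_xg)
  show "module_algebra primitive_coproduct counit (\<lambda>L. app (classical_op L)) \<and> vector_action xg (\<lambda>L. app (classical_op L))"
    using m v by blast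
  fix act assume "module_algebra primitive_coproduct counit act \<and> vector_action xg act"
  thus "act = (\<lambda>L. app (classical_op L))"
    using module_algebra_unique[OF _ m _ v x4_induct] by blast
qed


section \<open>The undeformed algebra\<close>

text \<open>Elements of the undeformed algebra are represented by their left multiplication operators: this
  replaces the smash product, whose associativity is not yet known, by composition.\<close>

definition op_tensor :: "'v::hmodule hend \<Rightarrow> 'w::hmodule hend \<Rightarrow> ('v, 'w) htensor hend"
  where "op_tensor F G = Hend (sweedler (\<lambda>x y. app F x \<otimes>\<^sub>h app G y))"

lemma op_tensor_htens [simp]: "app (op_tensor F G) (x \<otimes>\<^sub>h y) = app F x \<otimes>\<^sub>h app G y"
proof -
  have "hbilinear (\<lambda>x y. app F x \<otimes>\<^sub>h app G y)" by (rule htens_bilinear[OF hlinear_app hlinear_app])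
  thus ?thesis by (simp add: op_tensor_def app_Hend hlinear_sweedler sweedler_htens)
qed

lemma htensor_hend_eqI:
  fixes F G :: "('v::hmodule, 'w::hmodule) htensor hend"
  assumes "\<And>x y. app F (x \<otimes>\<^sub>h y) = app G (x \<otimes>\<^sub>h y)" shows "F = G"
  by (rule hend_eqI) (rule htensor_eqI[where F="app F" and G="app G", OF hlinear_app hlinear_app assms])

type_synonym undeformed_op = "undeformed hend"

lemma op_tensor_mult: "op_tensor F G * op_tensor F' G' = (op_tensor (F * F') (G * G') :: undeformed_op)"
  by (rule htensor_hend_eqI) simp

lemma op_tensor_1: "op_tensor 1 1 = (1 :: undeformed_op)"
  by (rule htensor_hend_eqI) simp

lemma hbilinear_op_tensor: "hbilinear (op_tensor :: x4 fps hend \<Rightarrow> uio_h hend \<Rightarrow> undeformed_op)"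
  by (intro hbilinearI hlinearI; rule htensor_hend_eqI) (simp_all add: htens_simps)

lemmas op_tensor_hlinear = hbilinearD[OF hbilinear_op_tensor]

definition coord :: "x4 fps \<Rightarrow> undeformed_op" where "coord f = op_tensor (lmul f) 1"

lemma coord_hom: "alg_hom coord"
  unfolding halgebra_hom_def coord_def
  by (simp add: op_tensor_mult lmul_homD op_tensor_1 lmul_one hlinear_comp[OF op_tensor_hlinear(2) lmul_homD(1)])

lemma coord_htens [simp]: "app (coord f) (g \<otimes>\<^sub>h L) = (f * g) \<otimes>\<^sub>h L"
  by (simp add: coord_def)

text \<open>The first leg acts on coordinates, the second multiplies symmetries from the left.
  Composed with the coproduct this is left multiplication by \<open>1 \<otimes> L\<close> in the
  smash product.\<close>

definition sym_op :: "(uio_h, uio_h) htensor \<Rightarrow> undeformed_op"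
  where "sym_op = sweedler (\<lambda>L M. op_tensor (classical_op L) (lmul M))"

lemma sym_op_bilinear: "hbilinear (\<lambda>L M. op_tensor (classical_op L) (lmul M) :: undeformed_op)"
  by (intro hbilinearI hlinear_comp[OF op_tensor_hlinear(1)] hlinear_comp[OF op_tensor_hlinear(2)] classical_hom lmul_homD)

lemma sym_op_hom: "alg_hom sym_op"
proof -
  note s = sweedler_htens[OF sym_op_bilinear, folded sym_op_def]
  note hl = hlinear_sweedler[OF sym_op_bilinear, folded sym_op_def]
  note l = hlinear_comp[OF hl] hlinear_mult_left hlinear_mult_right hlinear_id hl
  have 1: "sym_op ((a \<otimes>\<^sub>h b) * t) = sym_op (a \<otimes>\<^sub>h b) * sym_op t" for a b t
    by (rule htensor_eqI[where F="\<lambda>t. sym_op ((a \<otimes>\<^sub>h b) * t)"])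
      (simp_all add: l htens_mult s op_tensor_mult classical_hom lmul_homD)
  have 2: "sym_op (r * t) = sym_op r * sym_op t" for r t
    by (rule htensor_eqI[where F="\<lambda>r. sym_op (r * t)"]) (simp_all add: l 1)
  show ?thesis unfolding halgebra_hom_def
    by (simp add: hl 2 one_htensor_def s classical_hom lmul_one op_tensor_1)
qed

definition symmetry :: "uio_h \<Rightarrow> undeformed_op" where "symmetry L = sym_op (primitive_coproduct L)"

lemma symmetry_hom: "alg_hom symmetry"
  unfolding halgebra_hom_def symmetry_def
  by (simp add: halgebra_homD[OF sym_op_hom] halgebra_homD[OF primitive_coproduct(1)]
      hlinear_comp[OF halgebra_homD(1)[OF sym_op_hom]])

lemmas coord_homD = halgebra_homD[OF coord_hom]
lemmas symmetry_homD = halgebra_homD[OF symmetry_hom]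

lemma symmetry_gen: "symmetry (fps_const (io g)) = op_tensor (classical_gen g) 1 + op_tensor 1 (lmul (fps_const (io g)))"
  by (simp add: symmetry_def primitive_coproduct hlinear_simps[OF halgebra_homD(1)[OF sym_op_hom]])
    (simp add: sym_op_def sweedler_htens[OF sym_op_bilinear] classical_op classical_hom lmul_one)

lemma comm_symmetry_coord: "comm (symmetry (fps_const (io g))) (coord f) = coord (app (classical_gen g) f)"
  by (simp add: symmetry_gen coord_def comm_def op_tensor_mult classical_gen_derivation[symmetric]
      hlinear_simps[OF op_tensor_hlinear(2)] algebra_simps)

lemma covariant_undeformed: "covariant primitive_coproduct classical_op coord symmetry L"
  by (intro covariant_primitive classical_op(1) coord_homD symmetry_hom) (simp add: comm_symmetry_coord classical_op)

definition left_mult :: "undeformed \<Rightarrow> undeformed_op"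
  where "left_mult = sweedler (\<lambda>f L. coord f * symmetry L)"

lemma left_mult_bilinear: "hbilinear (\<lambda>f L. coord f * symmetry L)"
  by (rule mult_bilinear[OF coord_homD(1) symmetry_homD(1)])

lemma left_mult_htens: "left_mult (f \<otimes>\<^sub>h L) = coord f * symmetry L"
  by (simp add: left_mult_def sweedler_htens[OF left_mult_bilinear])

lemma hlinear_left_mult: "hlinear left_mult"
  unfolding left_mult_def by (rule hlinear_sweedler[OF left_mult_bilinear])

lemma smash_bilinear: "hbilinear (\<lambda>L1 L2. (f * app (classical_op L1) g) \<otimes>\<^sub>h (L2 * M :: uio_h))"
  by (intro htens_bilinear hlinear_mult_left hlinear_mult_right[OF hlinear_id] hlinear_comp[OF hlinear_app_left] classical_hom(1))

lemma left_mult_smash: "app (coord f * symmetry L) (g \<otimes>\<^sub>h M)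
    = sweedler (\<lambda>L1 L2. (f * app (classical_op L1) g) \<otimes>\<^sub>h (L2 * M)) (primitive_coproduct L)"
proof -
  have "app (coord f) (app (sym_op t) (g \<otimes>\<^sub>h M)) = sweedler (\<lambda>L1 L2. (f * app (classical_op L1) g) \<otimes>\<^sub>h (L2 * M)) t" for t
    by (rule htensor_eqI[where F="\<lambda>t. app (coord f) (app (sym_op t) (g \<otimes>\<^sub>h M))"])
      (simp_all add: hlinear_comp[OF hlinear_app] hlinear_comp[OF hlinear_app_left]
        halgebra_homD(1)[OF sym_op_hom, unfolded sym_op_def] hlinear_sweedler[OF smash_bilinear] sweedler_htens[OF smash_bilinear] sym_op_def sweedler_htens[OF sym_op_bilinear])
  thus ?thesis by (simp add: symmetry_def)
qed

lemma undeformed_mult: "undeformed_mult u w = app (left_mult u) w"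
proof -
  have bl: "hbilinear (\<lambda>u. app (left_mult u))"
    by (intro hbilinearI hlinear_app hlinear_comp[OF hlinear_app_left] hlinear_left_mult)
  have "undeformed_mult = (\<lambda>u. app (left_mult u))"
    unfolding undeformed_mult_def smash_mult_def classical_action
  proof (rule the_equality)
    show "hbilinear (\<lambda>u. app (left_mult u)) \<and> (\<forall>f L g M. app (left_mult (f \<otimes>\<^sub>h L)) (g \<otimes>\<^sub>h M)
        = sweedler (\<lambda>L1 L2. (f * app (classical_op L1) g) \<otimes>\<^sub>h (L2 * M)) (primitive_coproduct L))"
      using bl left_mult_smash by (simp add: left_mult_htens)
    fix m assume "hbilinear m \<and> (\<forall>f L g M. m (f \<otimes>\<^sub>h L) (g \<otimes>\<^sub>h M)
        = sweedler (\<lambda>L1 L2. (f * app (classical_op L1) g) \<otimes>\<^sub>h (L2 * M)) (primitive_coproduct L))"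
    thus "m = (\<lambda>u. app (left_mult u))"
      using left_mult_smash by (intro hbilinear_htensor_eqI) (simp_all add: bl left_mult_htens)
  qed
  from fun_cong[OF fun_cong[OF this, of u], of w] show ?thesis .
qed

definition eval_one :: "undeformed_op \<Rightarrow> undeformed" where "eval_one F = app F (1 \<otimes>\<^sub>h 1)"

lemma hlinear_eval_one: "hlinear eval_one"
  unfolding eval_one_def by (rule hlinear_app_left)

text \<open>The classical part of a generator kills the polynomial 1, so only left multiplication in
  the second factor remains.\<close>

lemma symmetry_one: "app (symmetry L) (1 \<otimes>\<^sub>h M) = 1 \<otimes>\<^sub>h (L * M)"
proof -
  have "L \<in> {L. \<forall>M. app (symmetry L) (1 \<otimes>\<^sub>h M) = 1 \<otimes>\<^sub>h (L * M)}"
  proof (rule uio_h_induct)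
    show "hclosed {L. \<forall>M. app (symmetry L) (1 \<otimes>\<^sub>h M) = 1 \<otimes>\<^sub>h (L * M)}"
      by (intro hclosed_all_eq hlinear_comp[OF hlinear_app_left] symmetry_homD hlinear_comp[OF hlinear_htens_right] hlinear_mult_right hlinear_id)
  qed (simp_all add: symmetry_homD symmetry_gen classical_gen_1 htens_simps mult.assoc)
  thus ?thesis by blast
qed

lemma eval_left_mult: "eval_one (left_mult u) = u"
proof (rule htensor_eqI[where F="\<lambda>u. eval_one (left_mult u)"])
  show "hlinear (\<lambda>u. eval_one (left_mult u))" by (rule hlinear_comp[OF hlinear_eval_one hlinear_left_mult])
qed (simp_all add: left_mult_htens eval_one_def symmetry_one)

text \<open>Associativity of the undeformed smash product, in the form that left multiplication is
  multiplicative. The essential input is the cross relation moving \<open>symmetry L\<close> past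
  \<open>coord g\<close>.\<close>

lemma left_mult_mult: "left_mult (app (left_mult u) w) = left_mult u * left_mult w"
proof -
  note l = hlinear_comp[OF hlinear_left_mult] hlinear_left_mult hlinear_comp[OF hlinear_app_left]
    hlinear_app hlinear_mult_left hlinear_mult_right
  have 0: "left_mult (app (left_mult (f \<otimes>\<^sub>h L)) (g \<otimes>\<^sub>h M)) = left_mult (f \<otimes>\<^sub>h L) * left_mult (g \<otimes>\<^sub>h M)" for f L g M
  proof -
    note bl = covariant_bilinear[OF classical_hom(1) coord_homD(1) symmetry_homD(1)]
    have "left_mult (f \<otimes>\<^sub>h L) * left_mult (g \<otimes>\<^sub>h M) = coord f * (symmetry L * coord g) * symmetry M"
      by (simp add: left_mult_htens mult.assoc)
    also have "\<dots> = coord f * sweedler (\<lambda>L1 L2. coord (app (classical_op L1) g) * symmetry L2) (primitive_coproduct L) * symmetry M"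
      using covariant_undeformed[of L] by (simp add: covariant_def)
    also have "\<dots> = sweedler (\<lambda>L1 L2. coord f * (coord (app (classical_op L1) g) * symmetry L2) * symmetry M) (primitive_coproduct L)"
      by (rule hlinear_of_sweedler[OF _ bl]) (intro l hlinear_id)
    also have "\<dots> = sweedler (\<lambda>L1 L2. left_mult ((f * app (classical_op L1) g) \<otimes>\<^sub>h (L2 * M))) (primitive_coproduct L)"
      by (simp add: left_mult_htens coord_homD symmetry_homD mult.assoc)
    also have "\<dots> = left_mult (sweedler (\<lambda>L1 L2. (f * app (classical_op L1) g) \<otimes>\<^sub>h (L2 * M)) (primitive_coproduct L))"
      by (rule hlinear_of_sweedler[OF hlinear_left_mult smash_bilinear, symmetric])
    also have "\<dots> = left_mult (app (left_mult (f \<otimes>\<^sub>h L)) (g \<otimes>\<^sub>h M))"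
      by (simp only: left_mult_htens[of f L] left_mult_smash)
    finally show ?thesis ..
  qed
  have 1: "left_mult (app (left_mult (f \<otimes>\<^sub>h L)) w) = left_mult (f \<otimes>\<^sub>h L) * left_mult w" for f L
    by (rule htensor_eqI[where F="\<lambda>w. left_mult (app (left_mult (f \<otimes>\<^sub>h L)) w)"]) (intro l | rule 0)+
  show ?thesis
    by (rule htensor_eqI[where F="\<lambda>u. left_mult (app (left_mult u) w)"]) (intro l | rule 1)+
qed

text \<open>The operators that are left multiplications, each recovered from its value at the unit.
  Being an equalizer, the set is closed.\<close>

definition left_ops :: "undeformed_op set" where "left_ops = {F. left_mult (eval_one F) = F}"

lemma hclosed_left_ops: "hclosed left_ops"
  unfolding left_ops_def by (intro hclosed_equalizer hlinear_comp[OF hlinear_left_mult] hlinear_eval_one hlinear_id)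

lemma left_mult_left_ops: "left_mult u \<in> left_ops"
  by (simp add: left_ops_def eval_left_mult)

lemma left_ops_mult: "F \<in> left_ops \<Longrightarrow> G \<in> left_ops \<Longrightarrow> F * G \<in> left_ops"
  unfolding left_ops_def by (metis (mono_tags, lifting) app_ops(4) eval_one_def left_mult_mult mem_Collect_eq)

lemma coord_left_ops: "coord f \<in> left_ops" and symmetry_left_ops: "symmetry L \<in> left_ops"
  using left_mult_left_ops[of "f \<otimes>\<^sub>h 1"] left_mult_left_ops[of "1 \<otimes>\<^sub>h L"]
  by (simp_all add: left_mult_htens coord_homD symmetry_homD)


section \<open>Covariant coordinates with noncommuting components\<close>

definition gm :: "spacetime \<Rightarrow> spacetime \<Rightarrow> complex" where "gm \<mu> \<nu> = eta \<mu> * delta \<mu> \<nu>"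

lemma gm_sym: "gm \<mu> \<nu> = gm \<nu> \<mu>"
  by (simp add: gm_def delta_def)

lemma gm_contract:
  fixes f :: "spacetime \<Rightarrow> 'b::hmodule"
  shows "(\<Sum>\<rho>\<in>UNIV. fps_const (eta \<rho>) *\<^sub>h fps_const (gm \<mu> \<rho>) *\<^sub>h f \<rho>) = f \<mu>"
proof -
  have "(\<Sum>\<rho>\<in>UNIV. fps_const (eta \<rho>) *\<^sub>h fps_const (gm \<mu> \<rho>) *\<^sub>h f \<rho>) = (\<Sum>\<rho>\<in>UNIV. if \<rho> = \<mu> then f \<mu> else 0)"
    by (rule sum.cong) (auto simp: gm_def delta_def hscale_hscale hscale_one)
  thus ?thesis by simp
qed

lemma comm_zero_sym: "comm x y = 0 \<Longrightarrow> comm y x = 0" for x :: "'a::ring"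
  using comm_swap[of y x] by simp

text \<open>The index calculus is kept abstract, on commutators, a square root \<open>S\<close> of
  \<open>1 - h^2 P^2\<close> close to 1 and the inverse \<open>G\<close> of \<open>1 + S\<close>, so
  that covariant expressions are not split into components.\<close>

locale poincare_heisenberg =
  fixes x P :: "spacetime \<Rightarrow> 'b::{halgebra,hcomplete}" and M :: "spacetime \<Rightarrow> spacetime \<Rightarrow> 'b"
    and S G :: 'b
  assumes xx: "comm (x \<mu>) (x \<nu>) = 0"
    and PP: "comm (P \<mu>) (P \<nu>) = 0"
    and Px: "comm (P \<mu>) (x \<nu>) = fps_const (- \<i>) *\<^sub>h fps_const (gm \<mu> \<nu>) *\<^sub>h 1"
    and Mx: "comm (M \<mu> \<nu>) (x \<rho>) = fps_const \<i> *\<^sub>h (fps_const (gm \<mu> \<rho>) *\<^sub>h x \<nu> - fps_const (gm \<nu> \<rho>) *\<^sub>h x \<mu>)"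
    and MP: "comm (M \<mu> \<nu>) (P \<rho>) = fps_const \<i> *\<^sub>h (fps_const (gm \<mu> \<rho>) *\<^sub>h P \<nu> - fps_const (gm \<nu> \<rho>) *\<^sub>h P \<mu>)"
    and MM: "comm (M \<mu> \<nu>) (M \<rho> \<sigma>) = fps_const \<i> *\<^sub>h (fps_const (gm \<mu> \<rho>) *\<^sub>h M \<nu> \<sigma> - fps_const (gm \<nu> \<rho>) *\<^sub>h M \<mu> \<sigma>
        + fps_const (gm \<mu> \<sigma>) *\<^sub>h M \<rho> \<nu> - fps_const (gm \<nu> \<sigma>) *\<^sub>h M \<rho> \<mu>)"
    and M_antisym: "M \<nu> \<mu> = - M \<mu> \<nu>"
    and S_square: "S * S = 1 - fps_X ^ 2 *\<^sub>h (\<Sum>\<mu>\<in>UNIV. fps_const (eta \<mu>) *\<^sub>h (P \<mu> * P \<mu>))"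
    and S_small: "hsmall 1 (S - 1)"
    and G: "G * (1 + S) = 1" "(1 + S) * G = 1"
begin

definition vector :: "(spacetime \<Rightarrow> 'b) \<Rightarrow> bool"
  where "vector V \<longleftrightarrow> (\<forall>\<mu> \<nu> \<rho>. comm (M \<mu> \<nu>) (V \<rho>)
    = fps_const \<i> *\<^sub>h (fps_const (gm \<mu> \<rho>) *\<^sub>h V \<nu> - fps_const (gm \<nu> \<rho>) *\<^sub>h V \<mu>))"

definition tensor2 :: "(spacetime \<Rightarrow> spacetime \<Rightarrow> 'b) \<Rightarrow> bool"
  where "tensor2 T \<longleftrightarrow> (\<forall>\<mu> \<nu> \<rho> \<sigma>. comm (M \<mu> \<nu>) (T \<rho> \<sigma>)
    = fps_const \<i> *\<^sub>h (fps_const (gm \<mu> \<rho>) *\<^sub>h T \<nu> \<sigma> - fps_const (gm \<nu> \<rho>) *\<^sub>h T \<mu> \<sigma>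
        + fps_const (gm \<mu> \<sigma>) *\<^sub>h T \<rho> \<nu> - fps_const (gm \<nu> \<sigma>) *\<^sub>h T \<rho> \<mu>))"

lemmas hs = hscale_add_right hscale_diff_right hscale_minus_right hscale_mult_left hscale_mult_right

lemma vectorD: "vector V \<Longrightarrow> comm (M \<mu> \<nu>) (V \<rho>)
    = fps_const \<i> *\<^sub>h (fps_const (gm \<mu> \<rho>) *\<^sub>h V \<nu> - fps_const (gm \<nu> \<rho>) *\<^sub>h V \<mu>)"
  and tensor2D: "tensor2 T \<Longrightarrow> comm (M \<mu> \<nu>) (T \<rho> \<sigma>)
    = fps_const \<i> *\<^sub>h (fps_const (gm \<mu> \<rho>) *\<^sub>h T \<nu> \<sigma> - fps_const (gm \<nu> \<rho>) *\<^sub>h T \<mu> \<sigma>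
        + fps_const (gm \<mu> \<sigma>) *\<^sub>h T \<rho> \<nu> - fps_const (gm \<nu> \<sigma>) *\<^sub>h T \<rho> \<mu>)"
  by (simp_all add: vector_def tensor2_def)

lemma vector_x: "vector x" and vector_P: "vector P" and tensor2_M: "tensor2 M"
  using Mx MP MM by (simp_all add: vector_def tensor2_def)

lemma vector_mult_right: "vector V \<Longrightarrow> (\<And>\<mu> \<nu>. comm (M \<mu> \<nu>) s = 0) \<Longrightarrow> vector (\<lambda>\<rho>. V \<rho> * s)"
  unfolding vector_def[of "\<lambda>\<rho>. V \<rho> * s"] by (simp add: vectorD comm_mult_right hs algebra_simps)

lemma vector_mult_left: "vector V \<Longrightarrow> (\<And>\<mu> \<nu>. comm (M \<mu> \<nu>) s = 0) \<Longrightarrow> vector (\<lambda>\<rho>. s * V \<rho>)"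
  unfolding vector_def[of "\<lambda>\<rho>. s * V \<rho>"] by (simp add: vectorD comm_mult_right hs algebra_simps)

lemma vector_diff: "vector V \<Longrightarrow> vector W \<Longrightarrow> vector (\<lambda>\<rho>. V \<rho> - W \<rho>)"
  unfolding vector_def[of "\<lambda>\<rho>. V \<rho> - W \<rho>"] by (simp add: vectorD comm_simps hs algebra_simps)

lemma vector_hscale: "vector V \<Longrightarrow> vector (\<lambda>\<rho>. c *\<^sub>h V \<rho>)"
  unfolding vector_def[of "\<lambda>\<rho>. c *\<^sub>h V \<rho>"] by (simp add: vectorD comm_hscale hs hscale_left_commute[of c])

lemma tensor2_diff: "tensor2 T \<Longrightarrow> tensor2 U \<Longrightarrow> tensor2 (\<lambda>\<rho> \<sigma>. T \<rho> \<sigma> - U \<rho> \<sigma>)"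
  unfolding tensor2_def[of "\<lambda>\<rho> \<sigma>. T \<rho> \<sigma> - U \<rho> \<sigma>"] by (simp add: tensor2D comm_simps hs algebra_simps)

lemma tensor2_add: "tensor2 T \<Longrightarrow> tensor2 U \<Longrightarrow> tensor2 (\<lambda>\<rho> \<sigma>. T \<rho> \<sigma> + U \<rho> \<sigma>)"
  unfolding tensor2_def[of "\<lambda>\<rho> \<sigma>. T \<rho> \<sigma> + U \<rho> \<sigma>"] by (simp add: tensor2D comm_simps hs algebra_simps)

lemma tensor2_transpose: "tensor2 T \<Longrightarrow> tensor2 (\<lambda>\<rho> \<sigma>. T \<sigma> \<rho>)"
  unfolding tensor2_def[of "\<lambda>\<rho> \<sigma>. T \<sigma> \<rho>"] by (simp add: tensor2D hs algebra_simps)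

lemma tensor2_vectors: "vector V \<Longrightarrow> vector W \<Longrightarrow> tensor2 (\<lambda>\<rho> \<sigma>. V \<rho> * W \<sigma>)"
  unfolding tensor2_def by (simp add: vectorD comm_mult_right hs algebra_simps)

text \<open>Contraction with the metric preserves covariance: the two terms in which the summation
  index is hit cancel.\<close>

lemma vector_contract:
  assumes T: "tensor2 T" and V: "vector V"
  shows "vector (\<lambda>\<rho>. \<Sum>\<sigma>\<in>UNIV. fps_const (eta \<sigma>) *\<^sub>h (T \<rho> \<sigma> * V \<sigma>))"
  unfolding vector_def
proof (intro allI)
  fix \<mu> \<nu> \<rho>
  let ?W = "\<lambda>\<rho>. \<Sum>\<sigma>\<in>UNIV. fps_const (eta \<sigma>) *\<^sub>h (T \<rho> \<sigma> * V \<sigma>)"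
  let ?i = "fps_const \<i>" and ?e = "\<lambda>\<sigma>. fps_const (eta \<sigma>)" and ?g = "\<lambda>\<mu> \<sigma>. fps_const (gm \<mu> \<sigma>)"
  have "comm (M \<mu> \<nu>) (?W \<rho>) = (\<Sum>\<sigma>\<in>UNIV. ?e \<sigma> *\<^sub>h comm (M \<mu> \<nu>) (T \<rho> \<sigma> * V \<sigma>))"
    by (simp only: comm_sum comm_hscale)
  also have "\<dots> = (\<Sum>\<sigma>\<in>UNIV. ?i *\<^sub>h ?g \<mu> \<rho> *\<^sub>h ?e \<sigma> *\<^sub>h (T \<nu> \<sigma> * V \<sigma>) - ?i *\<^sub>h ?g \<nu> \<rho> *\<^sub>h ?e \<sigma> *\<^sub>h (T \<mu> \<sigma> * V \<sigma>)
      + ?i *\<^sub>h (?e \<sigma> *\<^sub>h ?g \<mu> \<sigma> *\<^sub>h (T \<rho> \<nu> * V \<sigma>)) - ?i *\<^sub>h (?e \<sigma> *\<^sub>h ?g \<nu> \<sigma> *\<^sub>h (T \<rho> \<mu> * V \<sigma>))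
      + ?i *\<^sub>h (?e \<sigma> *\<^sub>h ?g \<mu> \<sigma> *\<^sub>h (T \<rho> \<sigma> * V \<nu>)) - ?i *\<^sub>h (?e \<sigma> *\<^sub>h ?g \<nu> \<sigma> *\<^sub>h (T \<rho> \<sigma> * V \<mu>)))"
    by (rule sum.cong[OF refl])
      (simp add: comm_mult_right tensor2D[OF T] vectorD[OF V] hs algebra_simps hscale_left_commute[of "?e _"])
  also have "\<dots> = ?i *\<^sub>h ?g \<mu> \<rho> *\<^sub>h ?W \<nu> - ?i *\<^sub>h ?g \<nu> \<rho> *\<^sub>h ?W \<mu> + ?i *\<^sub>h (T \<rho> \<nu> * V \<mu>) - ?i *\<^sub>h (T \<rho> \<mu> * V \<nu>)
      + ?i *\<^sub>h (T \<rho> \<mu> * V \<nu>) - ?i *\<^sub>h (T \<rho> \<nu> * V \<mu>)"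
    by (simp only: sum.distrib sum_subtractf hscale_sum_right[symmetric] gm_contract)
  finally show "comm (M \<mu> \<nu>) (?W \<rho>) = ?i *\<^sub>h (?g \<mu> \<rho> *\<^sub>h ?W \<nu> - ?g \<nu> \<rho> *\<^sub>h ?W \<mu>)"
    by (simp add: hs)
qed

section \<open>The mass Casimir, its square root and their commutators\<close>

definition P_square :: 'b where "P_square = (\<Sum>\<mu>\<in>UNIV. fps_const (eta \<mu>) *\<^sub>h (P \<mu> * P \<mu>))"

lemma M_P_square: "comm (M \<mu> \<nu>) P_square = 0"
proof -
  let ?i = "fps_const \<i>" and ?e = "\<lambda>\<sigma>. fps_const (eta \<sigma>)" and ?g = "\<lambda>\<mu> \<sigma>. fps_const (gm \<mu> \<sigma>)"
  have "comm (M \<mu> \<nu>) P_square = (\<Sum>\<sigma>\<in>UNIV. ?i *\<^sub>h (?e \<sigma> *\<^sub>h ?g \<mu> \<sigma> *\<^sub>h (P \<nu> * P \<sigma>)) - ?i *\<^sub>h (?e \<sigma> *\<^sub>h ?g \<nu> \<sigma> *\<^sub>h (P \<mu> * P \<sigma>))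
      + ?i *\<^sub>h (?e \<sigma> *\<^sub>h ?g \<mu> \<sigma> *\<^sub>h (P \<sigma> * P \<nu>)) - ?i *\<^sub>h (?e \<sigma> *\<^sub>h ?g \<nu> \<sigma> *\<^sub>h (P \<sigma> * P \<mu>)))"
    unfolding P_square_def comm_sum comm_hscale
    by (rule sum.cong[OF refl]) (simp add: comm_mult_right MP hs algebra_simps hscale_left_commute[of "?e _"])
  also have "\<dots> = ?i *\<^sub>h (P \<nu> * P \<mu>) - ?i *\<^sub>h (P \<mu> * P \<nu>) + ?i *\<^sub>h (P \<mu> * P \<nu>) - ?i *\<^sub>h (P \<nu> * P \<mu>)"
    by (simp only: sum.distrib sum_subtractf hscale_sum_right[symmetric] gm_contract)
  finally show ?thesis by simp
qed

lemma comm_S: assumes "comm P_square z = 0" shows "comm S z = 0"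
  by (rule comm_sqrt[OF S_small]) (use assms in \<open>simp add: S_square P_square_def[symmetric] comm_simps comm_hscale\<close>)

lemma comm_G: assumes "comm z S = 0" shows "comm z G = 0"
  by (simp add: comm_inverse[OF G(2,1)] comm_simps assms)

lemma P_P_square: "comm (P \<mu>) P_square = 0"
  by (simp add: P_square_def comm_sum comm_hscale comm_mult_right PP)

lemma M_S: "comm (M \<mu> \<nu>) S = 0" and P_S: "comm (P \<mu>) S = 0"
  using comm_S[of "M \<mu> \<nu>"] comm_S[of "P \<mu>"] M_P_square[of \<mu> \<nu>] P_P_square[of \<mu>]
    comm_swap[of _ P_square] comm_swap[of _ S] by simp_all

lemma M_G: "comm (M \<mu> \<nu>) G = 0" and P_G: "comm (P \<mu>) G = 0" and S_G: "comm S G = 0"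
  by (simp_all add: comm_G M_S P_S comm_simps)

lemma xP: "comm (x \<mu>) (P \<nu>) = fps_const \<i> *\<^sub>h fps_const (gm \<nu> \<mu>) *\<^sub>h 1"
  using comm_swap[of "x \<mu>" "P \<nu>"] Px[of \<nu> \<mu>] by (simp add: hscale_minus_left flip: fps_const_neg)

lemma P_square_x: "comm P_square (x \<nu>) = - (fps_const \<i> *\<^sub>h P \<nu>) - fps_const \<i> *\<^sub>h P \<nu>"
proof -
  let ?i = "fps_const \<i>" and ?e = "\<lambda>\<sigma>. fps_const (eta \<sigma>)" and ?g = "\<lambda>\<mu> \<sigma>. fps_const (gm \<mu> \<sigma>)"
  have "comm P_square (x \<nu>) = (\<Sum>\<sigma>\<in>UNIV. - (?i *\<^sub>h (?e \<sigma> *\<^sub>h ?g \<nu> \<sigma> *\<^sub>h P \<sigma>)) - ?i *\<^sub>h (?e \<sigma> *\<^sub>h ?g \<nu> \<sigma> *\<^sub>h P \<sigma>))"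
    unfolding P_square_def
    by (simp add: comm_sum comm_hscale comm_mult_left Px hs gm_sym[of \<nu>] hscale_left_commute[of "?e _"]
        hscale_minus_left flip: fps_const_neg)
  also have "\<dots> = - (?i *\<^sub>h P \<nu>) - ?i *\<^sub>h P \<nu>"
    by (simp only: sum_negf sum_subtractf hscale_sum_right[symmetric] gm_contract)
  finally show ?thesis .
qed

text \<open>Formally \<open>\<i> h^2 P_\<nu> S^-1\<close>. The inverse of \<open>S\<close> is not
  among the data, so the commutator is kept and only the product \<open>dS \<nu> * S\<close> is
  evaluated.\<close>

definition dS :: "spacetime \<Rightarrow> 'b" where "dS \<nu> = comm S (x \<nu>)"

lemma S_square_x: "comm (S * S) (x \<nu>) = 2 * (fps_X ^ 2 *\<^sub>h fps_const \<i> *\<^sub>h P \<nu>)"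
  by (simp add: S_square P_square_def[symmetric] comm_simps comm_hscale P_square_x hs mult_2)

text \<open>The commutators with \<open>S\<close> and with \<open>S S\<close> can be interchanged,
  and \<open>[S S, x]\<close> is a multiple of a momentum, which commutes with
  \<open>S\<close>.\<close>

lemma S_dS: "comm S (dS \<nu>) = 0"
proof (rule comm_sqrt[OF S_small])
  have "comm (S * S) (dS \<nu>) = comm S (comm (S * S) (x \<nu>))"
    by (simp add: dS_def comm_def algebra_simps)
  also have "\<dots> = 0"
    using P_S[of \<nu>] comm_swap[of S "P \<nu>"] by (simp add: S_square_x mult_2 comm_simps comm_hscale)
  finally show "comm (S * S) (dS \<nu>) = 0" .
qed

lemma dS_S: "dS \<nu> * S = fps_X ^ 2 *\<^sub>h fps_const \<i> *\<^sub>h P \<nu>"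
proof -
  let ?u = "fps_X ^ 2 *\<^sub>h fps_const \<i> *\<^sub>h P \<nu>"
  have "S * dS \<nu> + dS \<nu> * S = ?u + ?u"
    using S_square_x[of \<nu>] by (simp add: comm_mult_left dS_def[symmetric] mult_2)
  hence "dS \<nu> * S + dS \<nu> * S = ?u + ?u" using S_dS[of \<nu>] by (simp add: comm_eq_0_iff)
  hence "fps_const (1/2) *\<^sub>h (dS \<nu> * S + dS \<nu> * S) = fps_const (1/2) *\<^sub>h (?u + ?u)" by simp
  moreover have "fps_const (1/2) *\<^sub>h (z + z) = z" for z :: 'b
    unfolding hscale_add_right hscale_add_left[symmetric] by (simp add: hscale_one)
  ultimately show ?thesis by simp
qed

section \<open>The spin tensor and its contraction with the momentum\<close>

definition Sig :: "spacetime \<Rightarrow> spacetime \<Rightarrow> 'b"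
  where "Sig \<mu> \<nu> = M \<mu> \<nu> - x \<mu> * P \<nu> + x \<nu> * P \<mu>"

lemma tensor2_Sig: "tensor2 Sig"
  unfolding Sig_def
  by (intro tensor2_add tensor2_diff tensor2_M tensor2_vectors vector_x vector_P
      tensor2_transpose[OF tensor2_vectors[OF vector_x vector_P]])

lemma Sig_antisym: "Sig \<nu> \<mu> = - Sig \<mu> \<nu>"
  by (simp add: Sig_def M_antisym[of \<nu>])

text \<open>The orbital part \<open>x_\<mu> P_\<nu> - x_\<nu> P_\<mu>\<close> has the same
  commutators with \<open>x\<close> and \<open>P\<close> as \<open>M\<close>.\<close>

lemma Sig_x: "comm (Sig \<mu> \<nu>) (x \<rho>) = 0" and Sig_P: "comm (Sig \<mu> \<nu>) (P \<rho>) = 0"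
  by (simp_all add: Sig_def comm_simps comm_mult_left xx PP Px xP Mx MP hs hscale_minus_left
      gm_sym[of \<rho>] flip: fps_const_neg)

lemma Sig_P_square: "comm (Sig \<mu> \<nu>) P_square = 0"
  by (simp add: P_square_def comm_sum comm_hscale comm_mult_right Sig_P)

lemma Sig_S: "comm (Sig \<mu> \<nu>) S = 0"
  using comm_S[of "Sig \<mu> \<nu>"] Sig_P_square[of \<mu> \<nu>] comm_swap[of _ P_square] comm_swap[of _ S] by simp

lemma Sig_G: "comm (Sig \<mu> \<nu>) G = 0"
  by (rule comm_G[OF Sig_S])

text \<open>The orbital part commutes with \<open>Sig\<close>, so \<open>M\<close> may replace the
  first factor; then the claim is the tensor law of \<open>Sig\<close>.\<close>

lemma Sig_Sig: "comm (Sig \<mu> \<nu>) (Sig \<rho> \<sigma>) = fps_const \<i> *\<^sub>h (fps_const (gm \<mu> \<rho>) *\<^sub>h Sig \<nu> \<sigma> - fps_const (gm \<nu> \<rho>) *\<^sub>h Sig \<mu> \<sigma>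
        + fps_const (gm \<mu> \<sigma>) *\<^sub>h Sig \<rho> \<nu> - fps_const (gm \<nu> \<sigma>) *\<^sub>h Sig \<rho> \<mu>)"
proof -
  have c: "comm (x a) (Sig \<rho> \<sigma>) = 0" "comm (P a) (Sig \<rho> \<sigma>) = 0" for a
    by (rule comm_zero_sym, rule Sig_x Sig_P)+
  have "comm (Sig \<mu> \<nu>) (Sig \<rho> \<sigma>) = comm (M \<mu> \<nu>) (Sig \<rho> \<sigma>)"
    by (simp add: Sig_def[of \<mu>] comm_simps comm_mult_left c)
  thus ?thesis using tensor2_Sig by (simp add: tensor2_def)
qed

definition W :: "spacetime \<Rightarrow> 'b" where "W \<mu> = (\<Sum>\<rho>\<in>UNIV. fps_const (eta \<rho>) *\<^sub>h (Sig \<mu> \<rho> * P \<rho>))"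

lemma vector_W: "vector W"
  using vector_contract[OF tensor2_Sig vector_P] by (simp add: W_def[abs_def])

lemma W_commute: "comm z (W \<mu>) = 0" if "\<And>\<nu>. comm z (P \<nu>) = 0" "\<And>\<mu> \<nu>. comm z (Sig \<mu> \<nu>) = 0"
  by (simp add: W_def comm_sum comm_hscale comm_mult_right that)

lemma P_W: "comm (P \<nu>) (W \<mu>) = 0" and S_W: "comm S (W \<mu>) = 0" and G_W: "comm G (W \<mu>) = 0"
proof -
  show "comm (P \<nu>) (W \<mu>) = 0"
    by (rule W_commute) (rule PP comm_zero_sym[OF Sig_P])+
  show "comm S (W \<mu>) = 0"
    by (rule W_commute) (rule comm_zero_sym[OF P_S] comm_zero_sym[OF Sig_S])+
  show "comm G (W \<mu>) = 0"
    by (rule W_commute) (rule comm_zero_sym[OF P_G] comm_zero_sym[OF Sig_G])+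
qed

lemma x_W: "comm (x \<mu>) (W \<nu>) = - (fps_const \<i> *\<^sub>h Sig \<mu> \<nu>)"
proof -
  let ?i = "fps_const \<i>" and ?e = "\<lambda>\<sigma>. fps_const (eta \<sigma>)" and ?g = "\<lambda>\<mu> \<sigma>. fps_const (gm \<mu> \<sigma>)"
  have "comm (x \<mu>) (W \<nu>) = (\<Sum>\<sigma>\<in>UNIV. ?i *\<^sub>h (?e \<sigma> *\<^sub>h ?g \<mu> \<sigma> *\<^sub>h Sig \<nu> \<sigma>))"
    by (simp add: W_def comm_sum comm_hscale comm_mult_right xP comm_zero_sym[OF Sig_x] hs gm_sym[of \<mu>]
        hscale_left_commute[of "?e _"])
  also have "\<dots> = ?i *\<^sub>h Sig \<nu> \<mu>"
    by (simp only: hscale_sum_right[symmetric] gm_contract)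
  finally show ?thesis by (simp add: Sig_antisym[of \<nu> \<mu>] hs)
qed

lemma Sig_W: "comm (Sig \<mu> \<rho>) (W \<nu>) = fps_const \<i> *\<^sub>h (fps_const (gm \<mu> \<nu>) *\<^sub>h W \<rho> - fps_const (gm \<rho> \<nu>) *\<^sub>h W \<mu>
    + Sig \<nu> \<rho> * P \<mu> - Sig \<nu> \<mu> * P \<rho>)"
proof -
  let ?i = "fps_const \<i>" and ?e = "\<lambda>\<sigma>. fps_const (eta \<sigma>)" and ?g = "\<lambda>\<mu> \<sigma>. fps_const (gm \<mu> \<sigma>)"
  have "comm (Sig \<mu> \<rho>) (W \<nu>) = (\<Sum>\<sigma>\<in>UNIV. ?i *\<^sub>h ?g \<mu> \<nu> *\<^sub>h ?e \<sigma> *\<^sub>h (Sig \<rho> \<sigma> * P \<sigma>) - ?i *\<^sub>h ?g \<rho> \<nu> *\<^sub>h ?e \<sigma> *\<^sub>h (Sig \<mu> \<sigma> * P \<sigma>)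
      + ?i *\<^sub>h (?e \<sigma> *\<^sub>h ?g \<mu> \<sigma> *\<^sub>h (Sig \<nu> \<rho> * P \<sigma>)) - ?i *\<^sub>h (?e \<sigma> *\<^sub>h ?g \<rho> \<sigma> *\<^sub>h (Sig \<nu> \<mu> * P \<sigma>)))"
    unfolding W_def comm_sum comm_hscale
    by (rule sum.cong[OF refl])
      (simp add: comm_mult_right Sig_P Sig_Sig hs algebra_simps hscale_left_commute[of "?e _"])
  also have "\<dots> = ?i *\<^sub>h ?g \<mu> \<nu> *\<^sub>h W \<rho> - ?i *\<^sub>h ?g \<rho> \<nu> *\<^sub>h W \<mu> + ?i *\<^sub>h (Sig \<nu> \<rho> * P \<mu>) - ?i *\<^sub>h (Sig \<nu> \<mu> * P \<rho>)"
    by (simp only: sum.distrib sum_subtractf hscale_sum_right[symmetric] gm_contract W_def)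
  finally show ?thesis by (simp add: hs)
qed

text \<open>An antisymmetric tensor is contracted with the symmetric product of two momenta.\<close>

lemma W_P: "(\<Sum>\<rho>\<in>UNIV. fps_const (eta \<rho>) *\<^sub>h (W \<rho> * P \<rho>)) = 0"
proof -
  let ?t = "\<lambda>\<rho> \<sigma>. fps_const (eta \<rho>) *\<^sub>h fps_const (eta \<sigma>) *\<^sub>h (Sig \<rho> \<sigma> * P \<sigma> * P \<rho>)"
  let ?s = "\<Sum>\<rho>\<in>UNIV. \<Sum>\<sigma>\<in>UNIV. ?t \<rho> \<sigma>"
  have t: "?t \<sigma> \<rho> = - ?t \<rho> \<sigma>" for \<rho> \<sigma>
    using PP[of \<rho> \<sigma>]
    by (simp add: Sig_antisym[of \<sigma> \<rho>] hs mult.assoc comm_eq_0_iff hscale_left_commute[of "fps_const (eta \<sigma>)"])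
  have "?s = (\<Sum>\<rho>\<in>UNIV. \<Sum>\<sigma>\<in>UNIV. ?t \<sigma> \<rho>)" by (rule sum.swap)
  also have "\<dots> = (\<Sum>\<rho>\<in>UNIV. \<Sum>\<sigma>\<in>UNIV. - ?t \<rho> \<sigma>)" by (intro sum.cong refl t)
  also have "\<dots> = - ?s" by (simp only: sum_negf)
  finally have "?s + ?s = 0" by (simp add: eq_neg_iff_add_eq_0)
  hence "fps_const (1/2) *\<^sub>h (?s + ?s) = 0" by simp
  moreover have "fps_const (1/2) *\<^sub>h (z + z) = z" for z :: 'b
    unfolding hscale_add_right hscale_add_left[symmetric] by (simp add: hscale_one)
  ultimately have "?s = 0" by simp
  thus ?thesis by (simp add: W_def sum_distrib_right hscale_sum_right hs)
qed

text \<open>Expanding the first factor with \<open>Sig_W\<close> gives four terms; the one with the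
  metric contains \<open>W\<close> contracted with \<open>P\<close> and drops out by
  \<open>W_P\<close>.\<close>

lemma W_W: "comm (W \<mu>) (W \<nu>) = fps_const \<i> *\<^sub>h (P \<mu> * W \<nu> - P \<nu> * W \<mu> + P_square * Sig \<mu> \<nu>)"
proof -
  let ?i = "fps_const \<i>" and ?e = "\<lambda>\<sigma>. fps_const (eta \<sigma>)" and ?g = "\<lambda>\<mu> \<sigma>. fps_const (gm \<mu> \<sigma>)"
  have "comm (W \<mu>) (W \<nu>) = (\<Sum>\<rho>\<in>UNIV. ?e \<rho> *\<^sub>h (comm (Sig \<mu> \<rho>) (W \<nu>) * P \<rho>))"
    by (subst W_def) (simp add: comm_sum comm_hscale comm_mult_left P_W)
  also have "\<dots> = (\<Sum>\<rho>\<in>UNIV. ?i *\<^sub>h ?g \<mu> \<nu> *\<^sub>h ?e \<rho> *\<^sub>h (W \<rho> * P \<rho>) - ?i *\<^sub>h (?e \<rho> *\<^sub>h ?g \<nu> \<rho> *\<^sub>h (W \<mu> * P \<rho>))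
      + ?i *\<^sub>h (?e \<rho> *\<^sub>h (Sig \<nu> \<rho> * P \<mu> * P \<rho>)) - ?i *\<^sub>h (?e \<rho> *\<^sub>h (Sig \<nu> \<mu> * P \<rho> * P \<rho>)))"
    by (simp add: Sig_W hs ring_distribs hscale_left_commute[of "?e _"] gm_sym[of \<nu>])
  also have "\<dots> = ?i *\<^sub>h ?g \<mu> \<nu> *\<^sub>h 0 - ?i *\<^sub>h (W \<mu> * P \<nu>)
      + ?i *\<^sub>h (\<Sum>\<rho>\<in>UNIV. ?e \<rho> *\<^sub>h (Sig \<nu> \<rho> * P \<mu> * P \<rho>)) - ?i *\<^sub>h (\<Sum>\<rho>\<in>UNIV. ?e \<rho> *\<^sub>h (Sig \<nu> \<mu> * P \<rho> * P \<rho>))"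
    by (simp only: sum.distrib sum_subtractf hscale_sum_right[symmetric] gm_contract W_P)
  also have "(\<Sum>\<rho>\<in>UNIV. ?e \<rho> *\<^sub>h (Sig \<nu> \<rho> * P \<mu> * P \<rho>)) = W \<nu> * P \<mu>"
    using PP by (simp add: W_def sum_distrib_right hs mult.assoc comm_eq_0_iff)
  also have "(\<Sum>\<rho>\<in>UNIV. ?e \<rho> *\<^sub>h (Sig \<nu> \<mu> * P \<rho> * P \<rho>)) = - (Sig \<mu> \<nu> * P_square)"
    by (simp add: Sig_antisym[of \<nu> \<mu>] P_square_def sum_distrib_left hs mult.assoc sum_negf)
  finally show ?thesis
    using P_W Sig_P_square[of \<mu> \<nu>] by (simp add: hs comm_eq_0_iff)
qed

section \<open>Snyder coordinates\<close>

definition Y :: "spacetime \<Rightarrow> 'b" where "Y \<mu> = x \<mu> * S - fps_X ^ 2 *\<^sub>h (G * W \<mu>)"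

lemma vector_Y: "vector Y"
  unfolding Y_def
  by (intro vector_diff vector_hscale vector_mult_right vector_mult_left vector_x vector_W M_S M_G)

lemma P_Y: "comm (P \<mu>) (Y \<nu>) = fps_const (- \<i>) *\<^sub>h fps_const (gm \<mu> \<nu>) *\<^sub>h S"
  by (simp add: Y_def comm_simps comm_hscale comm_mult_right P_S P_G P_W Px hs)

lemma S_Y: "comm S (Y \<nu>) = fps_X ^ 2 *\<^sub>h fps_const \<i> *\<^sub>h P \<nu>"
  by (simp add: Y_def comm_simps comm_hscale comm_mult_right S_G S_W dS_def[symmetric] dS_S)

text \<open>\<open>[x S, x S]\<close> gives the orbital part of \<open>M\<close>. The terms with
  \<open>G G P W\<close> cancel between \<open>[x S, G W]\<close> and \<open>[G W, G W]\<close>.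
  What remains is \<open>Sig\<close> with coefficient \<open>2 G S + h^2 P^2 G G\<close>, which is 1
  because \<open>h^2 P^2 = (1 - S)(1 + S)\<close>.\<close>

lemma Y_Y: "comm (Y \<mu>) (Y \<nu>) = fps_X ^ 2 *\<^sub>h fps_const \<i> *\<^sub>h M \<mu> \<nu>"
proof -
  let ?k = "\<lambda>z. fps_X ^ 2 *\<^sub>h z" and ?i = "\<lambda>z. fps_const \<i> *\<^sub>h z"
  have xS: "comm (x a) S = - dS a" for a by (simp add: dS_def comm_swap[of S])
  have dSG: "comm (dS a) G = 0" for a
    by (rule comm_G) (use S_dS[of a] in \<open>simp add: comm_swap[of S]\<close>)
  have xG: "comm (x a) G = G * dS a * G" for a
    by (simp add: comm_inverse[OF G(2,1)] comm_simps xS)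
  have T1: "comm (x \<mu> * S) (x \<nu> * S) = ?k (?i (x \<mu> * P \<nu> - x \<nu> * P \<mu>))"
  proof -
    have "comm (x \<mu> * S) (x \<nu> * S) = x \<mu> * (dS \<nu> * S) - x \<nu> * (dS \<mu> * S)"
      by (simp add: comm_mult_left comm_mult_right comm_simps xx xS dS_def[symmetric] mult.assoc)
    thus ?thesis by (simp add: dS_S hs)
  qed
  have T2: "comm (x a * S) (G * W b) = ?k (?i (G * G * (P a * W b))) - ?i (G * S * Sig a b)" for a b
  proof -
    have "comm S (G * W b) = 0" by (simp add: comm_mult_right S_G S_W)
    hence "comm (x a * S) (G * W b) = comm (x a) (G * W b) * S" by (simp only: comm_mult_left) simp
    also have "\<dots> = G * dS a * (G * (W b * S)) - ?i (G * (Sig a b * S))"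
      by (simp add: comm_mult_right xG x_W hs ring_distribs mult.assoc)
    \<comment> \<open>The factors are reordered so that \<open>dS a\<close> meets \<open>S\<close>:
      only this product is known explicitly.\<close>
    also have "G * dS a * (G * (W b * S)) = G * G * (dS a * S * W b)"
      using S_W[of b] dSG[of a] by (simp add: comm_eq_0_iff mult.assoc[symmetric]) (simp add: mult.assoc)
    also have "Sig a b * S = S * Sig a b" using Sig_S by (simp add: comm_eq_0_iff)
    finally show ?thesis by (simp add: dS_S hs mult.assoc)
  qed
  have T4: "comm (G * W \<mu>) (G * W \<nu>) = ?i (G * G * (P \<mu> * W \<nu> - P \<nu> * W \<mu> + P_square * Sig \<mu> \<nu>))"
    using G_W comm_swap[of G] by (simp add: comm_mult_left comm_mult_right comm_simps W_W hs ring_distribs mult.assoc)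
  have PS: "?k P_square = (1 - S) * (1 + S)"
    using S_square unfolding P_square_def[symmetric] by (simp add: algebra_simps)
  have GS: "G * S = S * G" using S_G by (simp add: comm_eq_0_iff)
  have GP: "?k (G * G * (P_square * z)) = G * z - G * S * z" for z
  proof -
    have "?k (G * G * (P_square * z)) = G * G * (?k P_square * z)" by (simp add: hs)
    also have "\<dots> = G * (G * (1 - S)) * ((1 + S) * z)" by (simp add: PS mult.assoc)
    also have "G * (1 - S) = (1 - S) * G" by (simp add: algebra_simps GS)
    also have "G * ((1 - S) * G) * ((1 + S) * z) = G * (1 - S) * (G * (1 + S)) * z" by (simp only: mult.assoc)
    finally show ?thesis by (simp only: G(1) mult_1_right right_diff_distrib left_diff_distrib)
  qed
  have GG: "G * z + G * S * z = z" for z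
    using G(1) by (metis distrib_left distrib_right mult.right_neutral mult_1)
  have key: "G * S * z + (G * S * z + ?k (G * G * (P_square * z))) = z" for z
    unfolding GP using GG[of z] by (simp add: add.commute)
  have sw: "comm (G * W \<mu>) (x \<nu> * S) = - comm (x \<nu> * S) (G * W \<mu>)" by (rule comm_swap)
  have "comm (Y \<mu>) (Y \<nu>) = ?k (?i (x \<mu> * P \<nu> - x \<nu> * P \<mu>)) - ?k (comm (x \<mu> * S) (G * W \<nu>))
      + ?k (comm (x \<nu> * S) (G * W \<mu>)) + ?k (?k (comm (G * W \<mu>) (G * W \<nu>)))"
    by (simp add: Y_def comm_simps comm_hscale T1 sw hs)
  also have "\<dots> = ?k (?i (x \<mu> * P \<nu> - x \<nu> * P \<mu> + G * S * Sig \<mu> \<nu> + G * S * Sig \<mu> \<nu> + ?k (G * G * (P_square * Sig \<mu> \<nu>))))"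
    unfolding T2 T4 Sig_antisym[of \<nu> \<mu>]
    by (simp add: hs ring_distribs hscale_left_commute[of "fps_const \<i>"])
  also have "\<dots> = ?k (?i (x \<mu> * P \<nu> - x \<nu> * P \<mu> + Sig \<mu> \<nu>))"
    by (simp only: add.assoc key)
  also have "\<dots> = ?k (?i (M \<mu> \<nu>))" by (simp add: Sig_def)
  finally show ?thesis .
qed

end


section \<open>Realization of the kappa-Minkowski coordinates\<close>

lemma comm_symmetry: "comm (symmetry K) (symmetry L) = symmetry (comm K L)"
  by (simp add: hom_comm[OF symmetry_hom])

lemmas symmetry_simps = symmetry_homD(2,3) hlinear_simps[OF symmetry_homD(1)]
lemmas coord_simps = coord_homD(2,3) hlinear_simps[OF coord_homD(1)]

lemma comm_symmetry_coord_Mten: "comm (symmetry (Mten \<mu> \<nu>)) (coord f) = coord (app (classical_op (Mten \<mu> \<nu>)) f)"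
  by (cases "(\<mu>, \<nu>)" rule: Mten.cases)
    (simp_all add: symmetry_simps coord_simps hlinear_simps[OF classical_hom(1)] comm_simps comm_sum comm_hscale app_sum
      Ng_def Mg_def comm_symmetry_coord classical_op del: fps_const_neg)

lemma Mten_antisym: "Mten \<nu> \<mu> = - Mten \<mu> \<nu>"
proof (cases \<mu>; cases \<nu>)
  fix i j assume "\<mu> = Sp i" "\<nu> = Sp j"
  thus ?thesis by (simp add: eps_antisym(1)[of j i] hscale_minus_left sum_negf flip: fps_const_neg)
qed simp_all

lemmas scalar_simps = hscale_add_right hscale_diff_right hscale_minus_right hscale_minus_left hscale_hscale
  hscale_m1 hscale_one

lemma comm_Mten_Pg: "comm (Mten \<mu> \<nu>) (Pg \<rho>)
    = fps_const \<i> *\<^sub>h (fps_const (gm \<mu> \<rho>) *\<^sub>h Pg \<nu> - fps_const (gm \<nu> \<rho>) *\<^sub>h Pg \<mu>)"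
proof -
  have SS: "comm (Mten (Sp i) (Sp j)) (Pg (Sp k)) = fps_const \<i> *\<^sub>h (fps_const (gm (Sp i) (Sp k)) *\<^sub>h Pg (Sp j) - fps_const (gm (Sp j) (Sp k)) *\<^sub>h Pg (Sp i))"
    for i j k
    by (cases i; cases j; cases k) (simp_all add: comm_simps comm_hscale io_rels sum_space gm_def delta_def scalar_simps flip: fps_const_neg)
  show ?thesis
    by (cases \<mu>; cases \<nu>; cases \<rho>; (simp only: SS)?; (simp add: comm_simps comm_sum comm_hscale io_rels gm_def delta_def scalar_simps flip: fps_const_neg)?)
qed

lemma comm_Mten_Mten: "comm (Mten \<mu> \<nu>) (Mten \<rho> \<sigma>)
    = fps_const \<i> *\<^sub>h (fps_const (gm \<mu> \<rho>) *\<^sub>h Mten \<nu> \<sigma> - fps_const (gm \<nu> \<rho>) *\<^sub>h Mten \<mu> \<sigma>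
        + fps_const (gm \<mu> \<sigma>) *\<^sub>h Mten \<rho> \<nu> - fps_const (gm \<nu> \<sigma>) *\<^sub>h Mten \<rho> \<mu>)"
proof -
  define R where "R \<mu> \<nu> \<rho> \<sigma> = fps_const \<i> *\<^sub>h (fps_const (gm \<mu> \<rho>) *\<^sub>h Mten \<nu> \<sigma> - fps_const (gm \<nu> \<rho>) *\<^sub>h Mten \<mu> \<sigma>
        + fps_const (gm \<mu> \<sigma>) *\<^sub>h Mten \<rho> \<nu> - fps_const (gm \<nu> \<sigma>) *\<^sub>h Mten \<rho> \<mu>)" for \<mu> \<nu> \<rho> \<sigma>
  \<comment> \<open>Both sides change sign when the two indices of a pair are exchanged, so one
    ordering of each mixed pair suffices.\<close>
  have sw1: "R \<nu> \<mu> \<rho> \<sigma> = - R \<mu> \<nu> \<rho> \<sigma>" for \<mu> \<nu> \<rho> \<sigma>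
    unfolding R_def hscale_minus_right[symmetric] by (rule arg_cong[where f="hscale _"]) simp
  have sw2: "R \<mu> \<nu> \<sigma> \<rho> = - R \<mu> \<nu> \<rho> \<sigma>" for \<mu> \<nu> \<rho> \<sigma>
    unfolding R_def hscale_minus_right[symmetric] Mten_antisym[of \<nu> \<rho>] Mten_antisym[of \<mu> \<rho>] Mten_antisym[of \<nu> \<sigma>] Mten_antisym[of \<mu> \<sigma>]
    by (rule arg_cong[where f="hscale _"]) (simp add: hscale_minus_right)
  note s = comm_simps comm_hscale io_rels sum_space delta_def scalar_simps
  have d: "gm (Sp i) (Sp j) = delta i j" "gm Tm (Sp i) = 0" "gm (Sp i) Tm = 0" "gm Tm Tm = -1" for i j
    by (simp_all add: gm_def delta_def)
  have NN: "comm (Ng i) (Ng j) = R Tm (Sp i) Tm (Sp j)" for i j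
    by (simp add: R_def d io_rels hscale_sum_right sum_negf scalar_simps flip: fps_const_neg)
  have MN: "comm (Mten (Sp i) (Sp j)) (Ng k) = R (Sp i) (Sp j) Tm (Sp k)" for i j k
    unfolding R_def d by (cases i; cases j; cases k) (simp_all add: s flip: fps_const_neg)
  have NM: "comm (Ng k) (Mten (Sp i) (Sp j)) = R Tm (Sp k) (Sp i) (Sp j)" for i j k
  proof -
    have "comm (Ng k) (Mten (Sp i) (Sp j)) = - R (Sp i) (Sp j) Tm (Sp k)" by (subst comm_swap) (simp only: MN)
    also have "\<dots> = R Tm (Sp k) (Sp i) (Sp j)" unfolding R_def d by (simp add: scalar_simps delta_def)
    finally show ?thesis .
  qed
  have MM: "comm (Mten (Sp i) (Sp j)) (Mten (Sp k) (Sp l)) = R (Sp i) (Sp j) (Sp k) (Sp l)" for i j k l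
    unfolding R_def d by (cases i; cases j; cases k; cases l) (simp_all add: s flip: fps_const_neg)
  have T: "R Tm Tm \<rho> \<sigma> = 0" for \<rho> \<sigma>
    unfolding R_def by simp
  have T': "R \<rho> \<sigma> Tm Tm = 0" for \<rho> \<sigma>
    unfolding R_def by (cases \<rho>; cases \<sigma>) (simp_all add: d scalar_simps)
  have "comm (Mten \<mu> \<nu>) (Mten \<rho> \<sigma>) = R \<mu> \<nu> \<rho> \<sigma>"
    by (cases \<mu>; cases \<nu>; cases \<rho>; cases \<sigma>)
      (simp_all add: NN MN NM MM T T' sw1[of Tm "Sp _"] sw2[of _ _ Tm "Sp _"] comm_simps del: Mten.simps(4))
  thus ?thesis by (simp add: R_def)
qed


text \<open>The constant coefficient of \<open>1 + sqrtP\<close> is 2, hence the seed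
  \<open>1/2\<close> of the recursive inverse.\<close>

definition one_plus_sqrtP_inv :: uio_h
  where "one_plus_sqrtP_inv = fps_left_inverse (1 + sqrtP) ((1/2) *\<^sub>c 1)"

lemma one_plus_sqrtP_inv: "one_plus_sqrtP_inv * (1 + sqrtP) = 1" "(1 + sqrtP) * one_plus_sqrtP_inv = 1"
proof -
  have "(1 + sqrtP) $ 0 = (1 + 1) *\<^sub>c 1" unfolding cscale_add_left by (simp add: sqrtP_def cscale_one)
  hence i: "(1/2) *\<^sub>c 1 * (1 + sqrtP) $ 0 = 1" "(1 + sqrtP) $ 0 * (1/2) *\<^sub>c 1 = 1"
    by (simp_all add: cscale_mult_left cscale_mult_right cscale_cscale cscale_one)
  show "one_plus_sqrtP_inv * (1 + sqrtP) = 1" "(1 + sqrtP) * one_plus_sqrtP_inv = 1"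
    using fps_left_inverse[OF i(1)] fps_right_inverse[OF i(2)]
      fps_left_inverse_eq_fps_right_inverse[OF i] by (simp_all add: one_plus_sqrtP_inv_def)
qed

lemma classical_op_Mten: "app (classical_op (Mten \<mu> \<nu>)) (xg \<rho>)
    = fps_const \<i> *\<^sub>h (fps_const (gm \<mu> \<rho>) *\<^sub>h xg \<nu> - fps_const (gm \<nu> \<rho>) *\<^sub>h xg \<mu>)"
proof -
  have bl: "hbilinear (\<lambda>L. app (classical_op L))"
    by (intro hbilinearI hlinear_app hlinear_comp[OF hlinear_app_left] classical_hom(1))
  have "vector_action xg (\<lambda>L. app (classical_op L))"
    unfolding vector_action_iff[OF bl] by (simp add: classical_op classical_gen_xg)
  hence "fps_const (eta \<rho>) *\<^sub>h app (classical_op (Mten \<mu> \<nu>)) (xg \<rho>)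
      = fps_const (\<i> * delta \<mu> \<rho>) *\<^sub>h xg \<nu> - fps_const (\<i> * delta \<nu> \<rho>) *\<^sub>h xg \<mu>"
    by (simp add: vector_action_def app_simps)
  hence "fps_const (eta \<rho>) *\<^sub>h fps_const (eta \<rho>) *\<^sub>h app (classical_op (Mten \<mu> \<nu>)) (xg \<rho>)
      = fps_const (eta \<rho>) *\<^sub>h (fps_const (\<i> * delta \<mu> \<rho>) *\<^sub>h xg \<nu> - fps_const (\<i> * delta \<nu> \<rho>) *\<^sub>h xg \<mu>)" by simp
  thus ?thesis
    by (auto simp: hscale_hscale hscale_one hscale_diff_right gm_def delta_def mult.commute)
qed

interpretation realization: poincare_heisenberg "\<lambda>\<mu>. coord (xg \<mu>)" "\<lambda>\<mu>. symmetry (Pg \<mu>)"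
  "\<lambda>\<mu> \<nu>. symmetry (Mten \<mu> \<nu>)" "symmetry sqrtP" "symmetry one_plus_sqrtP_inv"
proof
  fix \<mu> \<nu> \<rho> \<sigma>
  show "comm (coord (xg \<mu>)) (coord (xg \<nu>)) = 0"
    by (simp add: comm_def coord_simps(2)[symmetric] mult.commute)
  show "comm (symmetry (Pg \<mu>)) (symmetry (Pg \<nu>)) = 0"
    by (simp add: comm_symmetry io_rels symmetry_simps)
  show "comm (symmetry (Pg \<mu>)) (coord (xg \<nu>)) = fps_const (- \<i>) *\<^sub>h fps_const (gm \<mu> \<nu>) *\<^sub>h 1"
    by (simp only: Pg_def comm_symmetry_coord classical_gen_xg vector_value.simps coord_simps)
      (auto simp: hscale_hscale gm_def delta_def)
  show "comm (symmetry (Mten \<mu> \<nu>)) (coord (xg \<rho>)) =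
       fps_const \<i> *\<^sub>h (fps_const (gm \<mu> \<rho>) *\<^sub>h coord (xg \<nu>) - fps_const (gm \<nu> \<rho>) *\<^sub>h coord (xg \<mu>))"
    by (simp add: comm_symmetry_coord_Mten classical_op_Mten coord_simps)
  show "comm (symmetry (Mten \<mu> \<nu>)) (symmetry (Pg \<rho>)) =
       fps_const \<i> *\<^sub>h (fps_const (gm \<mu> \<rho>) *\<^sub>h symmetry (Pg \<nu>) - fps_const (gm \<nu> \<rho>) *\<^sub>h symmetry (Pg \<mu>))"
    by (simp only: comm_symmetry comm_Mten_Pg symmetry_simps)
  show "comm (symmetry (Mten \<mu> \<nu>)) (symmetry (Mten \<rho> \<sigma>)) =
       fps_const \<i> *\<^sub>h (fps_const (gm \<mu> \<rho>) *\<^sub>h symmetry (Mten \<nu> \<sigma>) - fps_const (gm \<nu> \<rho>) *\<^sub>h symmetry (Mten \<mu> \<sigma>)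
        + fps_const (gm \<mu> \<sigma>) *\<^sub>h symmetry (Mten \<rho> \<nu>) - fps_const (gm \<nu> \<sigma>) *\<^sub>h symmetry (Mten \<rho> \<mu>))"
    by (simp only: comm_symmetry comm_Mten_Mten symmetry_simps)
  show "symmetry (Mten \<nu> \<mu>) = - symmetry (Mten \<mu> \<nu>)"
    by (subst Mten_antisym) (simp only: symmetry_simps)
  have "fps_const P2 = (\<Sum>\<mu>\<in>UNIV. fps_const (eta \<mu>) *\<^sub>h (Pg \<mu> * Pg \<mu>))"
    by (simp add: fps_const_P2 sum_spacetime sum_space hscale_m1 hscale_one)
  thus "symmetry sqrtP * symmetry sqrtP =
      1 - fps_X\<^sup>2 *\<^sub>h (\<Sum>\<mu>\<in>UNIV. fps_const (eta \<mu>) *\<^sub>h (symmetry (Pg \<mu>) * symmetry (Pg \<mu>)))"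
    by (simp add: symmetry_simps(2)[symmetric] sqrtP_square) (simp add: symmetry_simps)
  show "hsmall 1 (symmetry sqrtP - 1)"
    using hsmall_hlinear[OF symmetry_homD(1) sqrtP_small] by (simp add: symmetry_simps)
  show "symmetry one_plus_sqrtP_inv * (1 + symmetry sqrtP) = 1" "(1 + symmetry sqrtP) * symmetry one_plus_sqrtP_inv = 1"
    using arg_cong[OF one_plus_sqrtP_inv(1), of symmetry] arg_cong[OF one_plus_sqrtP_inv(2), of symmetry]
    by (simp_all add: symmetry_simps)
qed

fun kappa_coord :: "spacetime \<Rightarrow> undeformed_op" where
  "kappa_coord Tm = realization.Y Tm"
| "kappa_coord (Sp i) = realization.Y (Sp i) - fps_X *\<^sub>h symmetry (Ng i)"

lemma gm_simps [simp]: "gm (Sp i) (Sp j) = delta i j" "gm Tm (Sp i) = 0" "gm (Sp i) Tm = 0" "gm Tm Tm = -1"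
  by (simp_all add: gm_def delta_def)

lemma N_Y: "comm (symmetry (Ng i)) (realization.Y Tm) = fps_const (- \<i>) *\<^sub>h realization.Y (Sp i)"
  "comm (symmetry (Ng i)) (realization.Y (Sp j)) = fps_const (- \<i> * delta i j) *\<^sub>h realization.Y Tm"
  using realization.vectorD[OF realization.vector_Y, of Tm "Sp i" Tm] realization.vectorD[OF realization.vector_Y, of Tm "Sp i" "Sp j"]
  by (simp_all add: scalar_simps flip: fps_const_neg)

lemma M_Y: "comm (symmetry (Mg i)) (realization.Y Tm) = 0"
  "comm (symmetry (Mg i)) (realization.Y (Sp j)) = (\<Sum>k\<in>UNIV. fps_const (\<i> * eps i j k) *\<^sub>h realization.Y (Sp k))"
proof -
  have M: "Mg I1 = Mten (Sp I2) (Sp I3)" "Mg I2 = Mten (Sp I3) (Sp I1)" "Mg I3 = Mten (Sp I1) (Sp I2)"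
    by (simp_all add: sum_space hscale_one)
  note v = realization.vectorD[OF realization.vector_Y]
  show "comm (symmetry (Mg i)) (realization.Y Tm) = 0"
    by (cases i) (simp_all only: M v gm_simps, simp_all)
  show "comm (symmetry (Mg i)) (realization.Y (Sp j)) = (\<Sum>k\<in>UNIV. fps_const (\<i> * eps i j k) *\<^sub>h realization.Y (Sp k))"
    by (cases i; cases j) (simp_all only: M v gm_simps, simp_all add: sum_space delta_def scalar_simps flip: fps_const_neg)
qed

lemma N_N: "comm (symmetry (Ng i)) (symmetry (Ng j)) = - (fps_const \<i> *\<^sub>h symmetry (Mten (Sp i) (Sp j)))"
  by (simp add: comm_symmetry io_rels symmetry_simps hscale_sum_right sum_negf scalar_simps flip: fps_const_neg)

text \<open>The shift by \<open>h N\<close> makes the spatial coordinates commute: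
  \<open>[h N_i, h N_j]\<close> is opposite to \<open>[Y_i, Y_j]\<close>, and the mixed terms
  cancel, being symmetric in \<open>i\<close> and \<open>j\<close>. Its commutator with
  \<open>Y_0\<close> supplies the term linear in \<open>h\<close> of the time relation.\<close>

lemma an3_rep_kappa_coord: "an3_rep kappa_coord"
  unfolding an3_rep_def
proof (intro conjI allI)
  fix i j
  have "comm (kappa_coord Tm) (kappa_coord (Sp i)) = fps_X ^ 2 *\<^sub>h fps_const \<i> *\<^sub>h symmetry (Ng i) - fps_X *\<^sub>h fps_const \<i> *\<^sub>h realization.Y (Sp i)"
    using N_Y(1)[of i] realization.Y_Y[of Tm "Sp i"] comm_swap[of "realization.Y Tm" "symmetry (Ng i)"]
    by (simp add: comm_simps comm_hscale scalar_simps flip: fps_const_neg)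
  thus "comm (kappa_coord Tm) (kappa_coord (Sp i)) = (- fps_const \<i> * fps_X) *\<^sub>h kappa_coord (Sp i)"
    by (simp add: scalar_simps power2_eq_square mult.commute mult.left_commute del: fps_const_neg)
  have sw: "comm (realization.Y (Sp i)) (symmetry (Ng j)) = - comm (symmetry (Ng j)) (realization.Y (Sp i))" by (rule comm_swap)
  have d: "delta j i = delta i j" by (simp add: delta_def)
  show "comm (kappa_coord (Sp i)) (kappa_coord (Sp j)) = 0"
    unfolding kappa_coord.simps comm_simps comm_hscale realization.Y_Y sw N_Y N_N d
    by (simp add: scalar_simps power2_eq_square mult.assoc del: Mten.simps)
qed

section \<open>Cross relations of the realized coordinates with the symmetries\<close>

lemma M_kappa_coord: "comm (symmetry (Mg i)) (kappa_coord Tm) = 0"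
  "comm (symmetry (Mg i)) (kappa_coord (Sp j)) = (\<Sum>k\<in>UNIV. fps_const (\<i> * eps i j k) *\<^sub>h kappa_coord (Sp k))"
  by (simp_all add: M_Y comm_simps comm_hscale comm_symmetry io_rels symmetry_simps hscale_sum_right
      scalar_simps sum_subtractf mult.commute)

lemma N_kappa_coord: "comm (symmetry (Ng i)) (kappa_coord Tm) = fps_const (- \<i>) *\<^sub>h kappa_coord (Sp i) - fps_const \<i> *\<^sub>h fps_X *\<^sub>h symmetry (Ng i)"
  "comm (symmetry (Ng i)) (kappa_coord (Sp j)) = fps_const (- \<i> * delta i j) *\<^sub>h kappa_coord Tm
    + fps_X *\<^sub>h (\<Sum>k\<in>UNIV. fps_const (\<i> * eps i j k) *\<^sub>h symmetry (Mg k))"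
  by (simp_all add: N_Y N_N comm_simps comm_hscale symmetry_simps hscale_sum_right scalar_simps
      mult.commute flip: fps_const_neg)

lemma P_kappa_coord: "comm (symmetry (Pg (Sp k))) (kappa_coord Tm) = 0"
  "comm (symmetry (Pg (Sp k))) (kappa_coord (Sp j)) = fps_const (- \<i> * delta k j) *\<^sub>h symmetry Xi"
  "comm (symmetry (Pg Tm)) (kappa_coord Tm) = fps_const \<i> *\<^sub>h symmetry sqrtP"
  "comm (symmetry (Pg Tm)) (kappa_coord (Sp j)) = - (fps_const \<i> *\<^sub>h fps_X *\<^sub>h symmetry (Pg (Sp j)))"
proof -
  have sw: "comm (Pg \<mu>) (Ng i) = - comm (Ng i) (Pg \<mu>)" for \<mu> i by (rule comm_swap)
  have d: "delta j k = delta k j" by (simp add: delta_def)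
  show "comm (symmetry (Pg (Sp k))) (kappa_coord Tm) = 0"
    "comm (symmetry (Pg (Sp k))) (kappa_coord (Sp j)) = fps_const (- \<i> * delta k j) *\<^sub>h symmetry Xi"
    "comm (symmetry (Pg Tm)) (kappa_coord Tm) = fps_const \<i> *\<^sub>h symmetry sqrtP"
    "comm (symmetry (Pg Tm)) (kappa_coord (Sp j)) = - (fps_const \<i> *\<^sub>h fps_X *\<^sub>h symmetry (Pg (Sp j)))"
    by (simp_all add: realization.P_Y comm_simps comm_hscale comm_symmetry sw io_rels symmetry_simps d Xi_def
        scalar_simps mult.commute flip: fps_const_neg)
qed

text \<open>The contributions of \<open>h P_0\<close> and \<open>sqrtP\<close> cancel for spatial
  coordinates and add up to a multiple of \<open>Xi\<close> for time. So conjugation by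
  \<open>Xi\<close> shifts \<open>X_0\<close> by \<open>\<i> h\<close> and fixes the spatial
  coordinates.\<close>

lemma Xi_kappa_coord: "comm (symmetry Xi) (kappa_coord Tm) = fps_const \<i> *\<^sub>h fps_X *\<^sub>h symmetry Xi"
  "comm (symmetry Xi) (kappa_coord (Sp j)) = 0"
proof -
  have e: "comm (symmetry Xi) z = fps_X *\<^sub>h comm (symmetry (Pg Tm)) z + comm (symmetry sqrtP) z" for z
    by (simp add: Xi_def symmetry_simps comm_simps comm_hscale)
  have S: "comm (symmetry sqrtP) (kappa_coord \<nu>) = fps_X ^ 2 *\<^sub>h fps_const \<i> *\<^sub>h symmetry (Pg \<nu>)" for \<nu>
    by (cases \<nu>) (simp_all add: realization.S_Y comm_simps comm_hscale comm_symmetry symmetry_simps comm_zero_sym[OF comm_sqrtP(3)])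
  show "comm (symmetry Xi) (kappa_coord Tm) = fps_const \<i> *\<^sub>h fps_X *\<^sub>h symmetry Xi"
    "comm (symmetry Xi) (kappa_coord (Sp j)) = 0"
    unfolding e S P_kappa_coord
    by (simp_all add: Xi_def symmetry_simps scalar_simps power2_eq_square mult.commute mult.left_commute)
qed

lemma Xi_inv_kappa_coord: "comm (symmetry Xi_inv) (kappa_coord Tm) = - (fps_const \<i> *\<^sub>h fps_X *\<^sub>h symmetry Xi_inv)"
  "comm (symmetry Xi_inv) (kappa_coord (Sp j)) = 0"
proof -
  have inv: "symmetry Xi * symmetry Xi_inv = 1" "symmetry Xi_inv * symmetry Xi = 1"
    by (simp_all add: symmetry_simps(2)[symmetric] Xi_inv symmetry_simps(1))
  have c: "comm (symmetry Xi_inv) z = - (symmetry Xi_inv * comm (symmetry Xi) z * symmetry Xi_inv)" for z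
    unfolding comm_swap[of "symmetry Xi_inv" z] comm_inverse[OF inv] comm_swap[of z "symmetry Xi"] by simp
  show "comm (symmetry Xi_inv) (kappa_coord Tm) = - (fps_const \<i> *\<^sub>h fps_X *\<^sub>h symmetry Xi_inv)"
    "comm (symmetry Xi_inv) (kappa_coord (Sp j)) = 0"
    unfolding c Xi_kappa_coord by (simp_all add: hscale_mult_left hscale_mult_right mult.assoc inv)
qed


section \<open>Bijectivity modulo \<open>h\<close>\<close>

text \<open>Successive approximation: \<open>f\<close> picks an approximate preimage and
  \<open>g\<close> the remaining error divided by \<open>h\<close>. Iterating \<open>g\<close>
  yields the terms of a series whose sum is a preimage.\<close>

lemma surj_mod_h:
  fixes F :: "'a::hcomplete \<Rightarrow> 'b::hcomplete"
  assumes F: "hlinear F" and s: "\<And>b. \<exists>a. hsmall 1 (b - F a)"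
  shows "surj F"
proof -
  have "\<exists>a c. b = F a + fps_X *\<^sub>h c" for b
  proof -
    obtain a where "hsmall 1 (b - F a)" using s by blast
    then obtain c where "b - F a = fps_X *\<^sub>h c" by (rule hsmall_1E)
    thus ?thesis by (metis add.commute diff_add_cancel)
  qed
  then obtain f g where fg: "\<And>b. b = F (f b) + fps_X *\<^sub>h g b" by metis
  have "\<exists>a. F a = b" for b
  proof
    define u where "u n = f ((g ^^ n) b)" for n
    have r: "b - F (\<Sum>n<N. fps_X ^ n *\<^sub>h u n) = fps_X ^ N *\<^sub>h (g ^^ N) b" for N
    proof (induction N)
      case (Suc N)
      have "fps_X ^ N *\<^sub>h (g ^^ N) b = fps_X ^ N *\<^sub>h F (u N) + fps_X ^ Suc N *\<^sub>h (g ^^ Suc N) b"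
        by (subst fg) (simp add: u_def hscale_add_right hscale_hscale mult.commute)
      thus ?case using Suc by (simp add: hlinear_simps[OF F] algebra_simps)
    qed (simp add: hlinear_simps[OF F] hscale_one)
    show "F (hsum u) = b"
    proof (rule hsmall_eq)
      fix N
      have "hsmall N (F (hsum u) - F (\<Sum>n<N. fps_X ^ n *\<^sub>h u n))"
        using hsmall_hlinear[OF F hsum[of N u]] by (simp add: hlinear_simps[OF F])
      moreover have "hsmall N (F (\<Sum>n<N. fps_X ^ n *\<^sub>h u n) - b)"
        unfolding hsmall_diff_commute[of _ _ b] r by (rule hsmall_X)
      ultimately show "hsmall N (F (hsum u) - b)" by (rule hsmall_trans)
    qed
  qed
  thus ?thesis unfolding surj_def by metis
qed

text \<open>A kernel element is divisible by \<open>h\<close>, and since the target has no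
  \<open>h\<close>-torsion the quotient lies in the kernel again; so it is divisible by every power
  of \<open>h\<close>.\<close>

lemma inj_mod_h:
  fixes F :: "'a::hcomplete \<Rightarrow> 'b::hmodule"
  assumes F: "hlinear F" and tf: "\<And>b::'b. fps_X *\<^sub>h b = 0 \<Longrightarrow> b = 0"
    and small: "\<And>a. F a = 0 \<Longrightarrow> hsmall 1 a"
  shows "inj F"
proof (rule injI)
  fix x y assume "F x = F y"
  hence 0: "F (x - y) = 0" by (simp add: hlinear_simps[OF F])
  have "x - y = 0"
  proof (rule hsmall_all)
    fix n
    have "\<exists>z. x - y = fps_X ^ n *\<^sub>h z \<and> F z = 0"
    proof (induction n)
      case 0 thus ?case by (intro exI[of _ "x - y"]) (simp add: hscale_one \<open>F (x - y) = 0\<close>)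
    next
      case (Suc n)
      then obtain z where z: "x - y = fps_X ^ n *\<^sub>h z" "F z = 0" by blast
      obtain w where w: "z = fps_X *\<^sub>h w" using small[OF z(2)] by (rule hsmall_1E)
      hence "F w = 0" using z(2) tf by (simp add: hlinear_simps[OF F])
      thus ?case using z(1) w by (intro exI[of _ w]) (simp add: hscale_hscale mult.commute)
    qed
    thus "hsmall n (x - y)" unfolding hsmall_def by blast
  qed
  thus "x = y" by simp
qed

text \<open>The difference \<open>d\<close> of two points with equal image satisfies
  \<open>d = - h Z d\<close>, so it is divisible by every power of \<open>h\<close>. For
  surjectivity, \<open>b\<close> is its own approximate preimage.\<close>

lemma bij_perturbation:
  fixes Z :: "'a::hcomplete \<Rightarrow> 'a"
  assumes Z: "hlinear Z" shows "bij (\<lambda>x. x + fps_X *\<^sub>h Z x)"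
proof (rule bijI)
  have lin: "hlinear (\<lambda>x. x + fps_X *\<^sub>h Z x)" by (intro hlinear_plus hlinear_hscale hlinear_id Z)
  have "hsmall 1 (b - (b + fps_X *\<^sub>h Z b))" for b
    using hsmall_minus[OF hsmall_1[of "Z b"]] by simp
  thus "surj (\<lambda>x. x + fps_X *\<^sub>h Z x)" by (intro surj_mod_h[OF lin]) blast
  show "inj (\<lambda>x. x + fps_X *\<^sub>h Z x)"
  proof (rule injI)
    fix x y assume e: "x + fps_X *\<^sub>h Z x = y + fps_X *\<^sub>h Z y"
    have e: "x - y = - (fps_X *\<^sub>h Z (x - y))" using e by (simp add: hlinear_simps[OF Z] hscale_diff_right algebra_simps)
    have "hsmall n (x - y)" for n
    proof (induction n)
      case (Suc n)
      show ?case by (subst e) (intro hsmall_minus hsmall_Suc hsmall_hlinear[OF Z] Suc)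
    qed simp
    thus "x = y" by (rule hsmall_eq)
  qed
qed


section \<open>The realization homomorphism\<close>

definition realize :: "uan3 \<Rightarrow> undeformed_op"
  where "realize = (SOME F. alg_hom F \<and> (\<forall>\<mu>. F (Xg \<mu>) = kappa_coord \<mu>))"

lemma realize: "alg_hom realize" "realize (Xg \<mu>) = kappa_coord \<mu>"
  using someI_ex[OF uan3_hom_ex[OF an3_rep_kappa_coord]] unfolding realize_def by blast+

lemmas realize_hom = halgebra_homD[OF realize(1)]
lemmas realize_simps = realize_hom(2,3) realize(2) hlinear_simps[OF realize_hom(1)]

text \<open>Stated for any closed subalgebra of operators containing \<open>coord\<close> and
  \<open>symmetry\<close>, because it is applied twice: with \<open>left_ops\<close> the realization
  stays inside the undeformed algebra, with \<open>proj_ops\<close> it acts on polynomials.\<close>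

lemma
  assumes R: "hclosed R" and mult: "\<And>F G. F \<in> R \<Longrightarrow> G \<in> R \<Longrightarrow> F * G \<in> R"
    and coord: "\<And>f. coord f \<in> R" and symm: "\<And>L. symmetry L \<in> R"
  shows Sig_mem: "realization.Sig \<mu> \<nu> \<in> R" and kappa_coord_mem: "kappa_coord \<mu> \<in> R" and realize_mem: "realize g \<in> R"
proof -
  note i = hclosedD(2)[OF R] hclosedD(3)[OF R] hclosed_diff[OF R] hclosed_sum[OF R] mult coord symm
  show Sig: "realization.Sig \<mu> \<nu> \<in> R" for \<mu> \<nu> unfolding realization.Sig_def by (intro i)
  have "realization.Y \<mu> \<in> R" for \<mu> unfolding realization.Y_def realization.W_def by (intro i Sig)
  thus k: "kappa_coord \<mu> \<in> R" for \<mu> by (cases \<mu>) (auto intro: i)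
  have "g \<in> {g. realize g \<in> R}"
  proof (rule uan3_induct)
    show "hclosed {g. realize g \<in> R}" by (rule hclosed_vimage[OF realize_hom(1) R])
    show "1 \<in> {g. realize g \<in> R}" using coord[of 1] by (simp add: realize_simps coord_simps)
  qed (simp add: realize_simps mult k)
  thus "realize g \<in> R" by simp
qed

lemma hsmall_kappa_coord: "hsmall 1 (kappa_coord \<mu> - coord (xg \<mu>))"
proof -
  have "realization.Y \<mu> - coord (xg \<mu>) = coord (xg \<mu>) * (symmetry sqrtP - 1) - fps_X ^ 2 *\<^sub>h (symmetry one_plus_sqrtP_inv * realization.W \<mu>)" for \<mu>
    by (simp add: realization.Y_def algebra_simps)
  moreover have "hsmall 1 (fps_X ^ 2 *\<^sub>h z)" for z :: undeformed_op
    by (rule hsmall_mono[OF hsmall_X]) simp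
  ultimately have Y: "hsmall 1 (realization.Y \<mu> - coord (xg \<mu>))" for \<mu>
    using hsmall_diff hsmall_mult_left[OF realization.S_small] by metis
  show ?thesis
  proof (cases \<mu>)
    case (Sp i)
    have "kappa_coord \<mu> - coord (xg \<mu>) = (realization.Y \<mu> - coord (xg \<mu>)) - fps_X *\<^sub>h symmetry (Ng i)"
      using Sp by simp
    thus ?thesis using hsmall_diff[OF Y hsmall_1] by (simp only:)
  qed (use Y in simp)
qed

lemma hsmall_realize_words: "hsmall 1 (realize (prod_list (map Xg \<mu>s)) - coord (prod_list (map xg \<mu>s)))"
  by (induction \<mu>s) (simp_all add: realize_simps coord_simps hsmall_mult_cong hsmall_kappa_coord del: One_nat_def)


subsection \<open>Projection to the coordinates\<close>

text \<open>The vacuum projection. Its target is the representation on polynomials in which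
  \<open>coord\<close> multiplies and \<open>symmetry\<close> acts classically.\<close>

definition proj :: "undeformed \<Rightarrow> x4 fps" where "proj = sweedler (\<lambda>f L. counit L *\<^sub>h f)"

lemma proj_bilinear: "hbilinear (\<lambda>f L. counit L *\<^sub>h (f :: x4 fps))"
  by (intro hbilinearI hlinear_hscale_left counit_hom hlinear_hscale hlinear_id)

lemma hlinear_proj: "hlinear proj" and proj_htens: "proj (f \<otimes>\<^sub>h L) = counit L *\<^sub>h f"
  by (simp_all add: proj_def hlinear_sweedler sweedler_htens proj_bilinear)

lemma proj_coord: "proj (app (coord f) w) = f * proj w"
  by (rule htensor_eqI[where F="\<lambda>w. proj (app (coord f) w)"])
    (simp_all add: hlinear_comp[OF hlinear_proj hlinear_app] hlinear_mult_left[OF hlinear_proj] proj_htens hscale_mult_right)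

lemma proj_symmetry: "proj (app (symmetry L) w) = app (classical_op L) (proj w)"
proof -
  have gen: "proj (app (symmetry (fps_const (io g))) w) = app (classical_gen g) (proj w)" for g w
  proof (rule htensor_eqI[where F="\<lambda>w. proj (app (symmetry (fps_const (io g))) w)"])
    show "hlinear (\<lambda>w. proj (app (symmetry (fps_const (io g))) w))" by (rule hlinear_comp[OF hlinear_proj hlinear_app])
    show "hlinear (\<lambda>w. app (classical_gen g) (proj w))" by (rule hlinear_comp[OF hlinear_app hlinear_proj])
  qed (simp add: symmetry_gen hlinear_simps[OF hlinear_proj] proj_htens counit_simps app_simps)
  have "L \<in> {L. \<forall>w. proj (app (symmetry L) w) = app (classical_op L) (proj w)}"
  proof (rule uio_h_induct)
    show "hclosed {L. \<forall>w. proj (app (symmetry L) w) = app (classical_op L) (proj w)}"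
      by (intro hclosed_all_eq hlinear_comp[OF hlinear_proj] hlinear_comp[OF hlinear_app_left] symmetry_homD(1) classical_hom(1))
  qed (simp_all add: symmetry_simps classical_hom gen classical_op)
  thus ?thesis by blast
qed

text \<open>Operators acting on the quotient of the undeformed algebra by the left ideal generated by
  the kernel of the counit.\<close>

definition proj_ops :: "undeformed_op set"
  where "proj_ops = {F. \<forall>w. proj (app F w) = proj (app F (proj w \<otimes>\<^sub>h 1))}"

lemma hclosed_proj_ops: "hclosed proj_ops"
  unfolding proj_ops_def by (intro hclosed_all_eq hlinear_comp[OF hlinear_proj] hlinear_app_left)

lemma proj_ops_mult: assumes F: "F \<in> proj_ops" and G: "G \<in> proj_ops" shows "F * G \<in> proj_ops"
proof -
  have f: "proj (app F w) = proj (app F (proj w \<otimes>\<^sub>h 1))" for w using F by (simp add: proj_ops_def)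
  have g: "proj (app G w) = proj (app G (proj w \<otimes>\<^sub>h 1))" for w using G by (simp add: proj_ops_def)
  have "proj (app F (app G w)) = proj (app F (app G (proj w \<otimes>\<^sub>h 1)))" for w
    by (metis f g)
  thus ?thesis by (simp add: proj_ops_def)
qed

lemma coord_proj_ops: "coord f \<in> proj_ops" and symmetry_proj_ops: "symmetry L \<in> proj_ops"
  by (simp_all add: proj_ops_def proj_coord proj_symmetry proj_htens counit_simps hscale_one)

lemmas mem_proj_ops = Sig_mem[OF hclosed_proj_ops proj_ops_mult coord_proj_ops symmetry_proj_ops]
  realize_mem[OF hclosed_proj_ops proj_ops_mult coord_proj_ops symmetry_proj_ops]

lemmas mem_left_ops = realize_mem[OF hclosed_left_ops left_ops_mult coord_left_ops symmetry_left_ops]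

text \<open>The polynomial obtained by applying \<open>F\<close> to the vacuum 1.\<close>

definition symb :: "undeformed_op \<Rightarrow> x4 fps" where "symb F = proj (eval_one F)"

lemma hlinear_symb: "hlinear symb"
  unfolding symb_def by (rule hlinear_comp[OF hlinear_proj hlinear_eval_one])

lemmas symb_simps = hlinear_simps[OF hlinear_symb]

text \<open>An operator in \<open>proj_ops\<close> sees the vector it acts on only through its
  projection.\<close>

lemma symb_mult_cong: "F \<in> proj_ops \<Longrightarrow> symb G = symb H \<Longrightarrow> symb (F * G) = symb (F * H)"
  unfolding symb_def eval_one_def proj_ops_def app_ops by (metis (mono_tags, lifting) mem_Collect_eq)

lemma symb_coord_mult: "symb (coord f * F) = f * symb F"
  by (simp add: symb_def eval_one_def proj_coord)

lemma symb_symmetry_mult: "symb (symmetry L * F) = app (classical_op L) (symb F)"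
  by (simp add: symb_def eval_one_def proj_symmetry)

lemma symb_1: "symb 1 = 1"
  by (simp add: symb_def eval_one_def proj_htens counit_simps hscale_one)

lemma symb_symmetry: "symb (symmetry L) = counit L *\<^sub>h 1"
  using symb_symmetry_mult[of L 1] by (simp add: symb_1 classical_1)

text \<open>Its square is 1 since the counit kills \<open>P2\<close>; complex power series form a
  domain, and the constant coefficient 1 excludes the root \<open>-1\<close>.\<close>

lemma counit_sqrtP: "counit sqrtP = 1"
proof -
  have "counit (Pg \<mu>) = 0" for \<mu> by (simp add: Pg_def counit)
  hence "counit sqrtP * counit sqrtP = 1"
    by (simp add: counit_hom(3)[symmetric] sqrtP_square) (simp add: counit_simps fps_const_P2)
  hence "(counit sqrtP - 1) * (counit sqrtP + 1) = 0" by (simp add: algebra_simps)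
  moreover have "counit sqrtP $ 0 = 1"
    using hsmall_hlinear[OF counit_hom(1) sqrtP_small] by (simp add: counit_simps hsmall_fps_iff)
  hence "(counit sqrtP + 1) $ 0 \<noteq> 0" by simp
  hence "counit sqrtP + 1 \<noteq> 0" by (metis fps_zero_nth)
  ultimately show ?thesis by simp
qed

text \<open>The spin term ends in a momentum, which annihilates the vacuum, as does the boost, while
  \<open>sqrtP\<close> acts there as 1.\<close>

lemma symb_kappa_coord: "symb (kappa_coord \<mu>) = xg \<mu>"
proof -
  have SigP: "symb (realization.Sig \<mu> \<nu> * symmetry (Pg \<rho>)) = 0" for \<mu> \<nu> \<rho>
    using symb_mult_cong[OF mem_proj_ops(1), of "symmetry (Pg \<rho>)" 0]
    by (simp add: symb_symmetry symb_simps Pg_def counit)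
  hence "symb (realization.W \<mu>) = 0" for \<mu>
    by (simp add: realization.W_def symb_simps)
  hence "symb (realization.Y \<mu>) = xg \<mu>" for \<mu>
    by (simp add: realization.Y_def symb_simps symb_symmetry_mult app_simps symb_coord_mult symb_symmetry counit_sqrtP hscale_one)
  moreover have "symb (symmetry (Ng i)) = 0" for i by (simp add: symb_symmetry Ng_def counit)
  ultimately show ?thesis by (cases \<mu>) (simp_all add: symb_simps)
qed


subsection \<open>The linear isomorphism with polynomials\<close>

text \<open>Noncommutative polynomials evaluated on the vacuum. Bijectivity of this map plays the
  part of a Poincare-Birkhoff-Witt theorem for \<open>uan3\<close>.\<close>

definition norm_symb :: "uan3 \<Rightarrow> x4 fps" where "norm_symb g = symb (realize g)"

lemma hlinear_norm_symb: "hlinear norm_symb"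
  unfolding norm_symb_def by (rule hlinear_comp[OF hlinear_symb realize_hom(1)])

lemmas norm_symb_simps = hlinear_simps[OF hlinear_norm_symb]

lemma norm_symb_1: "norm_symb 1 = 1"
  by (simp add: norm_symb_def realize_simps symb_1)

lemma norm_symb_Xg: "norm_symb (Xg \<mu>) = xg \<mu>"
  by (simp add: norm_symb_def realize_simps symb_kappa_coord)

lemma hsmall_norm_symb_Xg: "hsmall 1 (norm_symb (Xg \<mu> * u) - xg \<mu> * norm_symb u)"
proof -
  have "hsmall 1 (symb ((kappa_coord \<mu> - coord (xg \<mu>)) * realize u))"
    by (intro hsmall_hlinear[OF hlinear_symb] hsmall_mult_right hsmall_kappa_coord)
  thus ?thesis
    by (simp add: norm_symb_def realize_simps left_diff_distrib symb_simps symb_coord_mult)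
qed

text \<open>Modulo \<open>h\<close>, ordered monomials give a section, because the generators commute modulo \<open>h\<close>.\<close>

definition Xup :: "spacetime \<Rightarrow> uan3" where "Xup \<mu> = fps_const (eta \<mu>) *\<^sub>h Xg \<mu>"

definition ordered_monomial :: "(spacetime \<Rightarrow>\<^sub>0 nat) \<Rightarrow> uan3"
  where "ordered_monomial m = Xup Tm ^ Poly_Mapping.lookup m Tm * (Xup (Sp I1) ^ Poly_Mapping.lookup m (Sp I1)
    * (Xup (Sp I2) ^ Poly_Mapping.lookup m (Sp I2) * Xup (Sp I3) ^ Poly_Mapping.lookup m (Sp I3)))"

lemma hsmall_comm_Xg: "hsmall 1 (comm (Xg \<mu>) u)"
proof -
  have g: "hsmall 1 (comm (Xg \<mu>) (Xg \<nu>))" for \<mu> \<nu>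
  proof -
    have TS: "hsmall 1 (comm (Xg Tm) (Xg (Sp i)))" for i
    proof -
      have "comm (Xg Tm) (Xg (Sp i)) = fps_X *\<^sub>h (- fps_const \<i>) *\<^sub>h Xg (Sp i)"
        using an3_rep_Xg by (simp add: an3_rep_def hscale_hscale mult.commute)
      thus ?thesis using hsmall_1 by metis
    qed
    show ?thesis
      using an3_rep_Xg TS hsmall_minus[OF TS] comm_swap[of "Xg (Sp _)" "Xg Tm"]
      by (cases \<mu>; cases \<nu>) (simp_all add: an3_rep_def comm_simps)
  qed
  have "u \<in> {u. hsmall 1 (comm (Xg \<mu>) u)}"
  proof (rule uan3_induct)
    show "hclosed {u. hsmall 1 (comm (Xg \<mu>) u)}"
      by (rule hclosed_hsmall_1) (auto intro: hlinearI simp: comm_simps comm_hscale)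
  qed (simp_all add: comm_mult_right hsmall_add hsmall_mult_left hsmall_mult_right g del: One_nat_def)
  thus ?thesis by simp
qed

lemma hsmall_Xup_left_commute: "hsmall 1 (u * (Xup \<mu> * v) - Xup \<mu> * (u * v))"
proof -
  have "hsmall 1 ((fps_const (eta \<mu>) *\<^sub>h comm (Xg \<mu>) u) * v)"
    by (intro hsmall_mult_right hsmall_scale hsmall_comm_Xg)
  hence "hsmall 1 (- ((fps_const (eta \<mu>) *\<^sub>h comm (Xg \<mu>) u) * v))" by (rule hsmall_minus)
  moreover have "- ((fps_const (eta \<mu>) *\<^sub>h comm (Xg \<mu>) u) * v) = u * (Xup \<mu> * v) - Xup \<mu> * (u * v)"
    by (simp add: Xup_def comm_def hscale_mult_left hscale_mult_right algebra_simps hscale_diff_right)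
  ultimately show ?thesis by simp
qed

text \<open>Moving a coordinate past the earlier blocks costs only commutators, which are divisible
  by \<open>h\<close>.\<close>

lemma hsmall_ordered_monomial: "hsmall 1 (ordered_monomial (Poly_Mapping.single \<mu> 1 + m) - Xup \<mu> * ordered_monomial m)"
proof (cases \<mu>)
  case (Sp i)
  show ?thesis
  proof (cases i)
    case I1
    thus ?thesis using Sp hsmall_Xup_left_commute by (simp add: ordered_monomial_def lookup_add lookup_single mult.assoc)
  next
    case I2
    have "hsmall 1 (a * (b * (Xup \<mu> * c)) - Xup \<mu> * (a * (b * c)))" for a b c
      using hsmall_Xup_left_commute[of "a * b" \<mu> c] by (simp add: mult.assoc)
    thus ?thesis using Sp I2 by (simp add: ordered_monomial_def lookup_add lookup_single mult.assoc)
  next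
    case I3
    have "hsmall 1 (a * (b * (c * (Xup \<mu> * d))) - Xup \<mu> * (a * (b * (c * d))))" for a b c d
      using hsmall_Xup_left_commute[of "a * b * c" \<mu> d] by (simp add: mult.assoc)
    thus ?thesis using Sp I3 by (simp add: ordered_monomial_def lookup_add lookup_single mult.assoc)
  qed
qed (simp add: ordered_monomial_def lookup_add lookup_single mult.assoc)

definition order_map :: "x4 fps \<Rightarrow> uan3" where "order_map = hfree ordered_monomial"

lemma hlinear_order_map: "hlinear order_map"
  unfolding order_map_def by (rule hlinear_hfree)

lemma hsmall_order_map: "hsmall 1 (order_map (xg \<mu> * c) - Xg \<mu> * order_map c)"
proof -
  have l: "hlinear (\<lambda>c. order_map (xvar \<mu> * c) - Xup \<mu> * order_map c)"
    by (intro hlinear_sub hlinear_comp[OF hlinear_order_map] hlinear_mult_left hlinear_id hlinear_order_map)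
  have "c \<in> {c. hsmall 1 (order_map (xvar \<mu> * c) - Xup \<mu> * order_map c)}"
    by (rule free_hclosed_induct[OF hclosed_hsmall_1[OF l]])
      (simp add: order_map_def xvar_def mult_single hscale_one hsmall_ordered_monomial[simplified])
  hence "hsmall 1 (fps_const (eta \<mu>) *\<^sub>h (order_map (xvar \<mu> * c) - Xup \<mu> * order_map c))"
    by (intro hsmall_scale) simp
  thus ?thesis
    by (simp add: xg_xvar Xup_def hscale_mult_left hlinear_simps[OF hlinear_order_map] hscale_diff_right hscale_hscale hscale_one)
qed

lemma hlinear_order_defect: "hlinear (\<lambda>u. u - order_map (norm_symb u))" "hlinear (\<lambda>c. c - norm_symb (order_map c))"
  by (intro hlinear_sub hlinear_comp[OF hlinear_order_map] hlinear_comp[OF hlinear_norm_symb]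
      hlinear_norm_symb hlinear_order_map hlinear_id)+

lemma order_map_1: "order_map 1 = 1"
  unfolding order_map_def using hfree_single[of ordered_monomial 0 1]
  by (simp add: hscale_one ordered_monomial_def)

lemma hsmall_mult_left_diff: "hsmall n (x - y) \<Longrightarrow> hsmall n (z * x - z * (y::'a::halgebra))"
  using hsmall_mult_left[of n "x - y" z] by (simp add: right_diff_distrib)

lemma hsmall_hlinear_diff: "hlinear f \<Longrightarrow> hsmall n (x - y) \<Longrightarrow> hsmall n (f x - f y)"
  using hsmall_hlinear[of f n "x - y"] by (simp add: hlinear_diff)

lemma surj_norm_symb: "surj norm_symb"
proof (rule surj_mod_h[OF hlinear_norm_symb])
  fix c
  have "c \<in> {c. hsmall 1 (c - norm_symb (order_map c))}"
  proof (rule x4_induct[OF hclosed_hsmall_1[OF hlinear_order_defect(2)]])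
    fix \<mu> c assume "c \<in> {c. hsmall 1 (c - norm_symb (order_map c))}"
    hence 1: "hsmall 1 (xg \<mu> * c - xg \<mu> * norm_symb (order_map c))" by (simp add: hsmall_mult_left_diff del: One_nat_def)
    have 2: "hsmall 1 (xg \<mu> * norm_symb (order_map c) - norm_symb (Xg \<mu> * order_map c))"
      unfolding hsmall_diff_commute[of _ "xg \<mu> * _"] by (rule hsmall_norm_symb_Xg)
    have 3: "hsmall 1 (norm_symb (Xg \<mu> * order_map c) - norm_symb (order_map (xg \<mu> * c)))"
      unfolding hsmall_diff_commute[of _ "norm_symb (Xg _ * _)"] by (rule hsmall_hlinear_diff[OF hlinear_norm_symb hsmall_order_map])
    show "xg \<mu> * c \<in> {c. hsmall 1 (c - norm_symb (order_map c))}"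
      using hsmall_trans[OF hsmall_trans[OF 1 2] 3] by simp
  qed (simp add: order_map_1 norm_symb_1)
  thus "\<exists>a. hsmall 1 (c - norm_symb a)" by blast
qed

text \<open>\<open>order_map\<close> is a left inverse modulo \<open>h\<close>, so a kernel element
  is divisible by \<open>h\<close>; power series over a vector space have no torsion, and
  \<open>inj_mod_h\<close> applies.\<close>

lemma inj_norm_symb: "inj norm_symb"
proof (rule inj_mod_h[OF hlinear_norm_symb fps_X_torsion_free])
  fix u assume u: "norm_symb u = 0"
  have "u \<in> {u. hsmall 1 (u - order_map (norm_symb u))}"
  proof (rule uan3_induct[OF hclosed_hsmall_1[OF hlinear_order_defect(1)]])
    fix \<mu> u assume "u \<in> {u. hsmall 1 (u - order_map (norm_symb u))}"
    hence 1: "hsmall 1 (Xg \<mu> * u - Xg \<mu> * order_map (norm_symb u))" by (simp add: hsmall_mult_left_diff del: One_nat_def)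
    have 2: "hsmall 1 (Xg \<mu> * order_map (norm_symb u) - order_map (xg \<mu> * norm_symb u))"
      unfolding hsmall_diff_commute[of _ "Xg \<mu> * _"] by (rule hsmall_order_map)
    have 3: "hsmall 1 (order_map (xg \<mu> * norm_symb u) - order_map (norm_symb (Xg \<mu> * u)))"
      unfolding hsmall_diff_commute[of _ "order_map (xg _ * _)"] by (rule hsmall_hlinear_diff[OF hlinear_order_map hsmall_norm_symb_Xg])
    show "Xg \<mu> * u \<in> {u. hsmall 1 (u - order_map (norm_symb u))}"
      using hsmall_trans[OF hsmall_trans[OF 1 2] 3] by simp
  qed (simp add: order_map_1 norm_symb_1)
  thus "hsmall 1 u" by (simp add: u hlinear_simps[OF hlinear_order_map])
qed

definition quantize :: "x4 fps \<Rightarrow> uan3" where "quantize = inv norm_symb"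

lemma norm_symb_quantize [simp]: "norm_symb (quantize f) = f"
  unfolding quantize_def by (rule surj_f_inv_f[OF surj_norm_symb])

lemma quantize_norm_symb [simp]: "quantize (norm_symb g) = g"
  unfolding quantize_def by (rule inv_f_f[OF inj_norm_symb])

lemma hlinear_quantize: "hlinear quantize"
  by (rule hlinearI; rule injD[OF inj_norm_symb]) (simp_all add: norm_symb_simps)

lemma hsmall_realize: "hsmall 1 (realize g - coord (norm_symb g))"
proof -
  have l: "hlinear (\<lambda>g. realize g - coord (norm_symb g))"
    by (intro hlinear_sub hlinear_comp[OF coord_homD(1)] hlinear_norm_symb realize_hom(1))
  have "g \<in> {g. hsmall 1 (realize g - coord (norm_symb g))}"
  proof (rule uan3_induct[OF hclosed_hsmall_1[OF l]])
    show "1 \<in> {g. hsmall 1 (realize g - coord (norm_symb g))}"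
      by (simp add: realize_simps coord_simps norm_symb_1)
    fix \<mu> u assume "u \<in> {g. hsmall 1 (realize g - coord (norm_symb g))}"
    hence 1: "hsmall 1 (realize (Xg \<mu> * u) - coord (xg \<mu>) * coord (norm_symb u))"
      by (simp add: realize_simps hsmall_mult_cong hsmall_kappa_coord del: One_nat_def)
    have "hsmall 1 (coord (xg \<mu> * norm_symb u - norm_symb (Xg \<mu> * u)))"
      using hsmall_norm_symb_Xg by (intro hsmall_hlinear[OF coord_homD(1)]) (simp add: hsmall_diff_commute)
    hence "hsmall 1 (coord (xg \<mu>) * coord (norm_symb u) - coord (norm_symb (Xg \<mu> * u)))"
      by (simp add: coord_simps)
    from hsmall_trans[OF 1 this] show "Xg \<mu> * u \<in> {g. hsmall 1 (realize g - coord (norm_symb g))}" by simp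
  qed
  thus ?thesis by simp
qed


section \<open>The deformed action\<close>

declare kappa_coord.simps [simp del]

text \<open>Defined by transport, the action is multiplicative in \<open>L\<close> at once. That it
  respects products in \<open>uan3\<close> through the kappa coproduct is the point still to be
  proved.\<close>

definition kappa_op :: "uio_h \<Rightarrow> uan3 hend"
  where "kappa_op L = Hend (\<lambda>g. quantize (app (classical_op L) (norm_symb g)))"

lemma app_kappa_op: "app (kappa_op L) g = quantize (app (classical_op L) (norm_symb g))"
  unfolding kappa_op_def
  by (subst app_Hend) (intro hlinear_comp[OF hlinear_quantize] hlinear_comp[OF hlinear_app] hlinear_norm_symb, rule refl)

lemma norm_symb_kappa_op: "norm_symb (app (kappa_op L) g) = app (classical_op L) (norm_symb g)"
  by (simp add: app_kappa_op)

instance uan3 :: hnontrivial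
  by standard (rule exI[of _ 1], simp)

lemma kappa_op_hom: "alg_hom kappa_op"
  unfolding halgebra_hom_def
  by (intro conjI allI hlinearI; rule hend_eqI; rule injD[OF inj_norm_symb])
    (simp_all add: norm_symb_kappa_op norm_symb_simps classical_hom hlinear_simps[OF classical_hom(1)])

lemmas kappa_op_homD = halgebra_homD[OF kappa_op_hom]
lemmas kappa_op_simps = kappa_op_homD(2,3) hlinear_simps[OF kappa_op_homD(1)]

lemma kappa_op_1: "app (kappa_op L) 1 = counit L *\<^sub>h 1"
  by (rule injD[OF inj_norm_symb]) (simp add: norm_symb_kappa_op norm_symb_1 classical_1 norm_symb_simps)

text \<open>Both \<open>realize (app (kappa_op L) g)\<close> and
  \<open>symmetry L * realize g\<close> have the same symbol, and multiplying by
  \<open>realize a\<close> preserves this. It translates products in \<open>uan3\<close> into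
  products of operators.\<close>

lemma norm_symb_mult: "norm_symb (a * app (kappa_op L) g) = symb (realize a * (symmetry L * realize g))"
proof -
  have "symb (realize a * realize (app (kappa_op L) g)) = symb (realize a * (symmetry L * realize g))"
  proof (rule symb_mult_cong[OF mem_proj_ops(2)])
    show "symb (realize (app (kappa_op L) g)) = symb (symmetry L * realize g)"
      using norm_symb_kappa_op[of L g] by (simp add: symb_symmetry_mult norm_symb_def)
  qed
  thus ?thesis by (simp add: norm_symb_def realize_simps)
qed

text \<open>The cross relations of the deformed algebra write the commutator of a symmetry with a
  coordinate as a coordinate part plus a symmetry; taking symbols turns them into a recursion for
  the action.\<close>

lemma kappa_op_Xg:
  assumes c: "comm (symmetry L) (kappa_coord \<mu>) = realize a + symmetry K"
  shows "app (kappa_op L) (Xg \<mu> * g) = Xg \<mu> * app (kappa_op L) g + a * g + app (kappa_op K) g"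
proof (rule injD[OF inj_norm_symb])
  have "norm_symb (app (kappa_op L) (Xg \<mu> * g)) = symb (symmetry L * kappa_coord \<mu> * realize g)"
    using norm_symb_mult[of 1 L "Xg \<mu> * g"] by (simp add: realize_simps mult.assoc)
  also have "symmetry L * kappa_coord \<mu> = kappa_coord \<mu> * symmetry L + realize a + symmetry K"
    using c by (simp add: comm_def algebra_simps)
  also have "symb ((kappa_coord \<mu> * symmetry L + realize a + symmetry K) * realize g)
      = norm_symb (Xg \<mu> * app (kappa_op L) g) + norm_symb (a * g) + norm_symb (app (kappa_op K) g)"
    using norm_symb_mult[of "Xg \<mu>" L g] norm_symb_mult[of a 1 g] norm_symb_mult[of 1 K g]
    by (simp add: distrib_right symb_simps realize_simps symmetry_simps mult.assoc kappa_op_simps)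
  finally show "norm_symb (app (kappa_op L) (Xg \<mu> * g)) = norm_symb (Xg \<mu> * app (kappa_op L) g + a * g + app (kappa_op K) g)"
    by (simp add: norm_symb_simps)
qed

lemma realize_sum: "realize (\<Sum>i\<in>I. f i) = (\<Sum>i\<in>I. realize (f i))"
  by (rule hlinear_sum[OF realize_hom(1)])

section \<open>Recursive formulas for the deformed action\<close>

lemma kappa_op_Xi: "app (kappa_op Xi) (Xg Tm * g) = Xg Tm * app (kappa_op Xi) g + fps_const \<i> *\<^sub>h fps_X *\<^sub>h app (kappa_op Xi) g"
  "app (kappa_op Xi) (Xg (Sp j) * g) = Xg (Sp j) * app (kappa_op Xi) g"
  using kappa_op_Xg[where L=Xi and \<mu>=Tm and a=0 and K="fps_const \<i> *\<^sub>h fps_X *\<^sub>h Xi" and g=g]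
    kappa_op_Xg[where L=Xi and \<mu>="Sp j" and a=0 and K=0 and g=g]
  by (simp_all add: Xi_kappa_coord realize_simps symmetry_simps kappa_op_simps)

lemma kappa_op_Xi_inv: "app (kappa_op Xi_inv) (Xg Tm * g) = Xg Tm * app (kappa_op Xi_inv) g - fps_const \<i> *\<^sub>h fps_X *\<^sub>h app (kappa_op Xi_inv) g"
  "app (kappa_op Xi_inv) (Xg (Sp j) * g) = Xg (Sp j) * app (kappa_op Xi_inv) g"
  using kappa_op_Xg[where L=Xi_inv and \<mu>=Tm and a=0 and K="- (fps_const \<i> *\<^sub>h fps_X *\<^sub>h Xi_inv)" and g=g]
    kappa_op_Xg[where L=Xi_inv and \<mu>="Sp j" and a=0 and K=0 and g=g]
  by (simp_all add: Xi_inv_kappa_coord realize_simps symmetry_simps kappa_op_simps)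

lemma kappa_op_P: "app (kappa_op (Pg (Sp k))) (Xg Tm * g) = Xg Tm * app (kappa_op (Pg (Sp k))) g"
  "app (kappa_op (Pg (Sp k))) (Xg (Sp j) * g) = Xg (Sp j) * app (kappa_op (Pg (Sp k))) g + fps_const (- \<i> * delta k j) *\<^sub>h app (kappa_op Xi) g"
  "app (kappa_op (Pg Tm)) (Xg Tm * g) = Xg Tm * app (kappa_op (Pg Tm)) g + fps_const \<i> *\<^sub>h app (kappa_op sqrtP) g"
  "app (kappa_op (Pg Tm)) (Xg (Sp j) * g) = Xg (Sp j) * app (kappa_op (Pg Tm)) g - fps_const \<i> *\<^sub>h fps_X *\<^sub>h app (kappa_op (Pg (Sp j))) g"
  using kappa_op_Xg[where L="Pg (Sp k)" and \<mu>=Tm and a=0 and K=0 and g=g]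
    kappa_op_Xg[where L="Pg (Sp k)" and \<mu>="Sp j" and a=0 and K="fps_const (- \<i> * delta k j) *\<^sub>h Xi" and g=g]
    kappa_op_Xg[where L="Pg Tm" and \<mu>=Tm and a=0 and K="fps_const \<i> *\<^sub>h sqrtP" and g=g]
    kappa_op_Xg[where L="Pg Tm" and \<mu>="Sp j" and a=0 and K="- (fps_const \<i> *\<^sub>h fps_X *\<^sub>h Pg (Sp j))" and g=g]
  by (simp_all add: P_kappa_coord realize_simps symmetry_simps kappa_op_simps del: fps_const_neg)

lemma kappa_op_M: "app (kappa_op (Mg i)) (Xg Tm * g) = Xg Tm * app (kappa_op (Mg i)) g"
  "app (kappa_op (Mg i)) (Xg (Sp j) * g) = Xg (Sp j) * app (kappa_op (Mg i)) g + (\<Sum>k\<in>UNIV. fps_const (\<i> * eps i j k) *\<^sub>h Xg (Sp k)) * g"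
  using kappa_op_Xg[where L="Mg i" and \<mu>=Tm and a=0 and K=0 and g=g]
    kappa_op_Xg[where L="Mg i" and \<mu>="Sp j" and a="\<Sum>k\<in>UNIV. fps_const (\<i> * eps i j k) *\<^sub>h Xg (Sp k)" and K=0 and g=g]
  by (simp_all add: M_kappa_coord realize_simps realize_sum symmetry_simps kappa_op_simps)

lemma kappa_op_N: "app (kappa_op (Ng i)) (Xg Tm * g) = Xg Tm * app (kappa_op (Ng i)) g
    + (fps_const (- \<i>) *\<^sub>h Xg (Sp i)) * g - fps_const \<i> *\<^sub>h fps_X *\<^sub>h app (kappa_op (Ng i)) g"
  "app (kappa_op (Ng i)) (Xg (Sp j) * g) = Xg (Sp j) * app (kappa_op (Ng i)) g
    + (fps_const (- \<i> * delta i j) *\<^sub>h Xg Tm) * g + fps_X *\<^sub>h (\<Sum>k\<in>UNIV. fps_const (\<i> * eps i j k) *\<^sub>h app (kappa_op (Mg k)) g)"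
  using kappa_op_Xg[where L="Ng i" and \<mu>=Tm and a="fps_const (- \<i>) *\<^sub>h Xg (Sp i)" and K="- (fps_const \<i> *\<^sub>h fps_X *\<^sub>h Ng i)" and g=g]
    kappa_op_Xg[where L="Ng i" and \<mu>="Sp j" and a="fps_const (- \<i> * delta i j) *\<^sub>h Xg Tm"
      and K="fps_X *\<^sub>h (\<Sum>k\<in>UNIV. fps_const (\<i> * eps i j k) *\<^sub>h Mg k)" and g=g]
  by (simp_all add: N_kappa_coord realize_simps realize_sum symmetry_simps kappa_op_simps app_sum del: fps_const_neg)

lemma kappa_op_Xi_cancel: "app (kappa_op Xi) (app (kappa_op Xi_inv) g) = g"
  using arg_cong[OF kappa_op_homD(3)[of Xi Xi_inv], of "\<lambda>F. app F g"] by (simp add: Xi_inv kappa_op_homD(2))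

lemma kappa_op_PXi_inv: "app (kappa_op (Pg (Sp k) * Xi_inv)) (Xg Tm * g)
    = Xg Tm * app (kappa_op (Pg (Sp k) * Xi_inv)) g - fps_const \<i> *\<^sub>h fps_X *\<^sub>h app (kappa_op (Pg (Sp k) * Xi_inv)) g"
  "app (kappa_op (Pg (Sp k) * Xi_inv)) (Xg (Sp j) * g) = Xg (Sp j) * app (kappa_op (Pg (Sp k) * Xi_inv)) g + fps_const (- \<i> * delta k j) *\<^sub>h g"
  by (simp_all add: kappa_op_homD(3) kappa_op_Xi_inv kappa_op_P kappa_op_Xi_cancel app_simps del: fps_const_neg)

section \<open>Moving symmetries past realized elements\<close>

lemma symmetry_kappa_coord: "symmetry L * (kappa_coord \<mu> * z) = kappa_coord \<mu> * (symmetry L * z) + comm (symmetry L) (kappa_coord \<mu>) * z"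
  by (simp add: comm_def algebra_simps)

lemma hlinear_cov: "hlinear (\<lambda>g. symmetry L * realize g)" "hlinear (\<lambda>g. realize (app (kappa_op K) g) * symmetry L)"
  "hlinear (\<lambda>g. realize g * symmetry L)" "hlinear (\<lambda>g. realize (app (kappa_op K) g))"
  by (intro hlinear_mult_left hlinear_mult_right hlinear_comp[OF realize_hom(1)] hlinear_app realize_hom(1))+

lemmas cov_simps = realize_simps mult.assoc symmetry_kappa_coord ring_distribs hscale_mult_left hscale_mult_right
  counit_simps kappa_op_1 hscale_one symmetry_simps

text \<open>The cross relation of a grouplike element. It precedes the momenta because commuting
  \<open>P_k\<close> with a spatial coordinate produces \<open>Xi\<close>.\<close>

lemma cov_Xi: "symmetry Xi * realize g = realize (app (kappa_op Xi) g) * symmetry Xi"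
  (is "?F g = ?G g")
proof -
  have c: "counit Xi = 1" by (simp add: Xi_def counit_simps counit_sqrtP Pg_def)
  have "g \<in> {g. ?F g = ?G g}"
  proof (rule uan3_induct)
    show "hclosed {g. ?F g = ?G g}"
      by (intro hclosed_equalizer hlinear_cov)
    fix \<mu> u assume "u \<in> {g. ?F g = ?G g}"
    thus "Xg \<mu> * u \<in> {g. ?F g = ?G g}"
      by (cases \<mu>) (simp_all add: cov_simps Xi_kappa_coord kappa_op_Xi)
  qed (simp add: cov_simps c)
  thus ?thesis by simp
qed

lemma cov_P: "symmetry (Pg (Sp k)) * realize g = realize (app (kappa_op (Pg (Sp k))) g) * symmetry Xi + realize g * symmetry (Pg (Sp k))"
  (is "?F g = ?G g")
proof -
  have c: "counit (Pg \<mu>) = 0" for \<mu> by (simp add: Pg_def counit)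
  have "g \<in> {g. ?F g = ?G g}"
  proof (rule uan3_induct)
    show "hclosed {g. ?F g = ?G g}" by (intro hclosed_equalizer hlinear_cov hlinear_plus)
    fix \<mu> u assume "u \<in> {g. ?F g = ?G g}"
    thus "Xg \<mu> * u \<in> {g. ?F g = ?G g}"
      by (cases \<mu>) (simp_all add: cov_simps P_kappa_coord kappa_op_P cov_Xi del: fps_const_neg)
  qed (simp add: cov_simps c)
  thus ?thesis by simp
qed

lemma cov_P0: "symmetry (Pg Tm) * realize g = realize (app (kappa_op (Pg Tm)) g) * symmetry Xi
    + realize (app (kappa_op Xi_inv) g) * symmetry (Pg Tm)
    + fps_X *\<^sub>h (\<Sum>m\<in>UNIV. realize (app (kappa_op (Pg (Sp m) * Xi_inv)) g) * symmetry (Pg (Sp m)))"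
  (is "?F g = ?G g")
proof -
  have c: "counit (Pg \<mu>) = 0" for \<mu> by (simp add: Pg_def counit)
  have "counit Xi_inv * counit Xi = 1" by (simp add: counit_hom(3)[symmetric] Xi_inv counit_hom(2))
  hence ci: "counit Xi_inv = 1" by (simp add: Xi_def counit_simps counit_sqrtP c)
  \<comment> \<open>Substituting this leaves \<open>Xi\<close>, covered by \<open>cov_Xi\<close>,
    and \<open>Pg Tm\<close>, covered by the induction hypothesis.\<close>
  have S: "sqrtP = Xi - fps_X *\<^sub>h Pg Tm" by (simp add: Xi_def)
  have "g \<in> {g. ?F g = ?G g}"
  proof (rule uan3_induct)
    show "hclosed {g. ?F g = ?G g}"
      by (intro hclosed_equalizer hlinear_cov hlinear_plus hlinear_hscale hlinear_setsum)
    fix \<mu> u assume u: "u \<in> {g. ?F g = ?G g}"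
    show "Xg \<mu> * u \<in> {g. ?F g = ?G g}"
    proof (cases \<mu>)
      case Tm
      thus ?thesis using u
        by (simp add: cov_simps P_kappa_coord kappa_op_P kappa_op_Xi_inv kappa_op_PXi_inv S cov_Xi kappa_op_simps app_simps
            sum_space hscale_add_right hscale_diff_right hscale_left_commute[of fps_X "fps_const _"])
    next
      case (Sp j)
      thus ?thesis using u
        by (cases j) (simp_all add: cov_simps P_kappa_coord kappa_op_P kappa_op_Xi_inv kappa_op_PXi_inv cov_P
            sum_space hscale_add_right hscale_diff_right delta_def hscale_left_commute[of fps_X "fps_const _"]
            hscale_minus_left hscale_minus_right flip: fps_const_neg)
    qed
  qed (simp add: cov_simps c ci)
  thus ?thesis by simp
qed

lemma cov_M: "symmetry (Mg i) * realize g = realize (app (kappa_op (Mg i)) g) + realize g * symmetry (Mg i)"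
  (is "?F g = ?G g")
proof -
  have "g \<in> {g. ?F g = ?G g}"
  proof (rule uan3_induct)
    show "hclosed {g. ?F g = ?G g}" by (intro hclosed_equalizer hlinear_cov hlinear_plus)
    fix \<mu> u assume "u \<in> {g. ?F g = ?G g}"
    thus "Xg \<mu> * u \<in> {g. ?F g = ?G g}"
      by (cases \<mu>) (simp_all add: cov_simps M_kappa_coord kappa_op_M realize_sum)
  qed (simp add: cov_simps Mg_def)
  thus ?thesis by simp
qed

text \<open>The rotations created when a boost passes a spatial coordinate build up the last sum;
  \<open>cov_M\<close> moves them past the remaining factors.\<close>

lemma cov_N: "symmetry (Ng i) * realize g = realize (app (kappa_op (Ng i)) g)
    + realize (app (kappa_op Xi_inv) g) * symmetry (Ng i)
    - fps_X *\<^sub>h (\<Sum>j\<in>UNIV. \<Sum>m\<in>UNIV. fps_const (eps i j m) *\<^sub>h (realize (app (kappa_op (Pg (Sp j) * Xi_inv)) g) * symmetry (Mg m)))"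
  (is "?F g = ?G g")
proof -
  have c: "counit (Pg \<mu>) = 0" "counit (Ng i) = 0" for \<mu> by (simp_all add: Pg_def Ng_def counit)
  have "counit Xi_inv * counit Xi = 1" by (simp add: counit_hom(3)[symmetric] Xi_inv counit_hom(2))
  hence ci: "counit Xi_inv = 1" by (simp add: Xi_def counit_simps counit_sqrtP c)
  have "g \<in> {g. ?F g = ?G g}"
  proof (rule uan3_induct)
    show "hclosed {g. ?F g = ?G g}"
      by (intro hclosed_equalizer hlinear_cov hlinear_plus hlinear_sub hlinear_hscale hlinear_setsum)
    fix \<mu> u assume u: "u \<in> {g. ?F g = ?G g}"
    show "Xg \<mu> * u \<in> {g. ?F g = ?G g}"
    proof (cases \<mu>)
      case Tm
      thus ?thesis using u
        by (cases i) (simp_all add: cov_simps N_kappa_coord kappa_op_N kappa_op_Xi_inv kappa_op_PXi_inv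
            sum_space hscale_add_right hscale_diff_right hscale_left_commute[of fps_X "fps_const _"]
            hscale_minus_left hscale_minus_right hscale_m1 hscale_one flip: fps_const_neg)
    next
      case (Sp j)
      thus ?thesis using u
        by (cases i; cases j) (simp_all add: cov_simps N_kappa_coord kappa_op_N kappa_op_Xi_inv kappa_op_PXi_inv cov_M
            sum_space hscale_add_right hscale_diff_right delta_def hscale_left_commute[of fps_X "fps_const _"]
            hscale_minus_left hscale_minus_right hscale_m1 hscale_one flip: fps_const_neg)
    qed
  qed (simp add: cov_simps c ci)
  thus ?thesis by simp
qed

lemma covariant_kappa: "covariant kappa_coproduct kappa_op realize symmetry L"
proof (rule covariant_all[OF kappa_coproduct(1) kappa_op_hom realize_hom(1) symmetry_hom])
  note bl = covariant_bilinear[OF kappa_op_homD(1) realize_hom(1) symmetry_homD(1)]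
  note s = covariant_def kappa_coproduct hlinear_simps[OF hlinear_sweedler[OF bl]] sweedler_htens[OF bl]
    kappa_op_simps symmetry_simps
  fix g
  show "covariant kappa_coproduct kappa_op realize symmetry (fps_const (io g))"
  proof (cases g)
    case (GM i) thus ?thesis using cov_M[of i] by (simp add: s Mg_def)
  next
    case (GN i) thus ?thesis using cov_N[of i] by (simp add: s Ng_def)
  next
    case (GP \<mu>) thus ?thesis using cov_P cov_P0 by (cases \<mu>) (simp_all add: s Pg_def)
  qed
qed

text \<open>The product rule is the covariance of the realization applied to the vacuum; injectivity
  of \<open>norm_symb\<close> brings it back to \<open>uan3\<close>.\<close>

lemma kappa_action: "kappa_action = (\<lambda>L. app (kappa_op L))"
  unfolding kappa_action_def
proof (rule the_equality)
  note bl = covariant_bilinear[OF kappa_op_homD(1) realize_hom(1) symmetry_homD(1)]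
  note bl' = covariant_bilinear[OF kappa_op_homD(1) lmul_homD(1) kappa_op_homD(1)]
  have "covariant kappa_coproduct kappa_op lmul kappa_op L" for L
    unfolding covariant_def
  proof (intro allI hend_eqI, rule injD[OF inj_norm_symb])
    fix f g
    have l: "hlinear (\<lambda>b. symb (b * realize g))" "hlinear (\<lambda>b. norm_symb (app b g))"
      by (intro hlinear_comp[OF hlinear_symb] hlinear_comp[OF hlinear_norm_symb] hlinear_mult_right hlinear_id hlinear_app_left)+
    have "norm_symb (app (kappa_op L) (f * g)) = symb (symmetry L * realize f * realize g)"
      using norm_symb_mult[of 1 L "f * g"] by (simp add: realize_simps mult.assoc)
    also have "\<dots> = sweedler (\<lambda>L1 L2. symb (realize (app (kappa_op L1) f) * symmetry L2 * realize g)) (kappa_coproduct L)"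
      using covariant_kappa[of L] hlinear_of_sweedler[OF l(1) bl] by (simp add: covariant_def)
    also have "\<dots> = sweedler (\<lambda>L1 L2. norm_symb (app (lmul (app (kappa_op L1) f) * kappa_op L2) g)) (kappa_coproduct L)"
      by (simp add: norm_symb_mult mult.assoc)
    also have "\<dots> = norm_symb (app (sweedler (\<lambda>L1 L2. lmul (app (kappa_op L1) f) * kappa_op L2) (kappa_coproduct L)) g)"
      by (rule hlinear_of_sweedler[OF l(2) bl', symmetric])
    finally show "norm_symb (app (kappa_op L * lmul f) g)
        = norm_symb (app (sweedler (\<lambda>L1 L2. lmul (app (kappa_op L1) f) * kappa_op L2) (kappa_coproduct L)) g)" by simp
  qed
  hence m: "module_algebra kappa_coproduct counit (\<lambda>L. app (kappa_op L))"
    by (intro module_algebraI kappa_op_hom kappa_op_1)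
  have "norm_symb (vector_value Xg g \<nu>) = vector_value xg g \<nu>" for g \<nu>
    by (cases "(Xg, g, \<nu>)" rule: vector_value.cases) (simp_all add: norm_symb_simps norm_symb_1 norm_symb_Xg)
  hence "app (kappa_op (fps_const (io g))) (Xg \<nu>) = vector_value Xg g \<nu>" for g \<nu>
    by (intro injD[OF inj_norm_symb]) (simp add: norm_symb_kappa_op norm_symb_Xg classical_op classical_gen_xg)
  hence v: "vector_action Xg (\<lambda>L. app (kappa_op L))"
    using m by (subst vector_action_iff) (simp_all add: module_algebra_def)
  show "module_algebra kappa_coproduct counit (\<lambda>L. app (kappa_op L)) \<and> vector_action Xg (\<lambda>L. app (kappa_op L))"
    using m v by blast
  fix act assume "module_algebra kappa_coproduct counit act \<and> vector_action Xg act"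
  thus "act = (\<lambda>L. app (kappa_op L))"
    using module_algebra_unique[OF _ m _ v uan3_induct] by blast
qed


section \<open>The isomorphism\<close>

definition dsr_op :: "dsr \<Rightarrow> undeformed_op" where "dsr_op = sweedler (\<lambda>f L. realize f * symmetry L)"

lemma dsr_op_bilinear: "hbilinear (\<lambda>f L. realize f * symmetry L)"
  by (rule mult_bilinear[OF realize_hom(1) symmetry_homD(1)])

lemma dsr_op_htens: "dsr_op (f \<otimes>\<^sub>h L) = realize f * symmetry L"
  by (simp add: dsr_op_def sweedler_htens[OF dsr_op_bilinear])

lemma hlinear_dsr_op: "hlinear dsr_op"
  unfolding dsr_op_def by (rule hlinear_sweedler[OF dsr_op_bilinear])

text \<open>This allows operators to be traded for elements: composing left multiplications amounts
  to the undeformed product.\<close>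

lemma dsr_op_left_ops: "dsr_op x \<in> left_ops"
proof -
  have "x \<in> {x. dsr_op x \<in> left_ops}"
    by (rule htensor_hclosed_induct[OF hclosed_vimage[OF hlinear_dsr_op hclosed_left_ops]])
      (simp add: dsr_op_htens left_ops_mult mem_left_ops symmetry_left_ops)
  thus ?thesis by simp
qed

definition dsr_iso :: "dsr \<Rightarrow> undeformed" where "dsr_iso x = eval_one (dsr_op x)"

lemma hlinear_dsr_iso: "hlinear dsr_iso"
  unfolding dsr_iso_def by (rule hlinear_comp[OF hlinear_eval_one hlinear_dsr_op])

lemma undeformed_mult_dsr_iso: "undeformed_mult (dsr_iso x) (dsr_iso y) = eval_one (dsr_op x * dsr_op y)"
  using dsr_op_left_ops[of x] by (simp add: undeformed_mult dsr_iso_def left_ops_def eval_one_def)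

lemma eval_coord_symmetry: "eval_one (coord f * symmetry L) = f \<otimes>\<^sub>h L"
  using eval_left_mult[of "f \<otimes>\<^sub>h L"] by (simp add: left_mult_htens)

text \<open>The realization of the ordered quantization of \<open>f\<close> differs from \<open>f\<close> by a multiple of \<open>h\<close>, which
  can be chosen linearly in \<open>f\<close> because the polynomials are free; this turns the map into a
  perturbation of the identity.\<close>

lemma bij_dsr_iso: "bij dsr_iso"
proof -
  have "\<exists>z. realize (quantize (fps_const (Poly_Mapping.single m 1))) - coord (fps_const (Poly_Mapping.single m 1)) = fps_X *\<^sub>h z" for m
  proof -
    have "hsmall 1 (realize (quantize (fps_const (Poly_Mapping.single m 1))) - coord (fps_const (Poly_Mapping.single m 1)))"
      using hsmall_realize[of "quantize (fps_const (Poly_Mapping.single m 1))"] by simp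
    thus ?thesis by (rule hsmall_1E) blast
  qed
  hence "\<exists>z. \<forall>m. realize (quantize (fps_const (Poly_Mapping.single m 1))) - coord (fps_const (Poly_Mapping.single m 1)) = fps_X *\<^sub>h z m"
    by (intro choice allI)
  then obtain z where z: "\<And>m. realize (quantize (fps_const (Poly_Mapping.single m 1))) - coord (fps_const (Poly_Mapping.single m 1)) = fps_X *\<^sub>h z m"
    by blast
  have zeta: "realize (quantize f) - coord f = fps_X *\<^sub>h hfree z f" for f
    by (rule free_hlinear_eqI[where F="\<lambda>f. realize (quantize f) - coord f"])
      (simp_all add: z hscale_one hlinear_sub hlinear_comp[OF realize_hom(1) hlinear_quantize] coord_homD(1) hlinear_hscale hlinear_hfree)
  define Z where "Z = sweedler (\<lambda>f L. eval_one (hfree z f * symmetry L))"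
  have Zb: "hbilinear (\<lambda>f L. eval_one (hfree z f * symmetry L))"
    by (intro hbilinearI hlinear_comp[OF hlinear_eval_one] hlinear_mult_left hlinear_mult_right hlinear_hfree symmetry_homD(1))
  have Z: "hlinear Z" "Z (f \<otimes>\<^sub>h L) = eval_one (hfree z f * symmetry L)" for f L
    by (simp_all add: Z_def hlinear_sweedler sweedler_htens Zb)
  \<comment> \<open>\<open>q\<close> and \<open>p\<close> are \<open>quantize\<close> and
    \<open>norm_symb\<close> tensored with the identity; composing with \<open>q\<close> turns the
    map into an endomorphism of the undeformed module.\<close>
  define q where "q = sweedler (\<lambda>f L. quantize f \<otimes>\<^sub>h (L :: uio_h))"
  have qb: "hbilinear (\<lambda>f L. quantize f \<otimes>\<^sub>h (L :: uio_h))" by (rule htens_bilinear[OF hlinear_quantize hlinear_id])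
  have q: "hlinear q" "q (f \<otimes>\<^sub>h L) = quantize f \<otimes>\<^sub>h L" for f L
    by (simp_all add: q_def hlinear_sweedler sweedler_htens qb)
  define p where "p = sweedler (\<lambda>g L. norm_symb g \<otimes>\<^sub>h (L :: uio_h))"
  have pb: "hbilinear (\<lambda>g L. norm_symb g \<otimes>\<^sub>h (L :: uio_h))" by (rule htens_bilinear[OF hlinear_norm_symb hlinear_id])
  have p: "hlinear p" "p (g \<otimes>\<^sub>h L) = norm_symb g \<otimes>\<^sub>h L" for g L
    by (simp_all add: p_def hlinear_sweedler sweedler_htens pb)
  have qp: "q (p x) = x" for x
    by (rule htensor_eqI[where F="\<lambda>x. q (p x)"]) (simp_all add: hlinear_comp q p)
  have T: "dsr_iso (q w) = w + fps_X *\<^sub>h Z w" for w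
  proof (rule htensor_eqI[where F="\<lambda>w. dsr_iso (q w)"])
    show "hlinear (\<lambda>w. dsr_iso (q w))" by (rule hlinear_comp[OF hlinear_dsr_iso q(1)])
    show "hlinear (\<lambda>w. w + fps_X *\<^sub>h Z w)" by (intro hlinear_plus hlinear_hscale hlinear_id Z)
    fix f L
    have "realize (quantize f) = coord f + fps_X *\<^sub>h hfree z f" using zeta[of f] by (simp add: algebra_simps)
    hence "dsr_iso (q (f \<otimes>\<^sub>h L)) = eval_one (coord f * symmetry L + fps_X *\<^sub>h (hfree z f * symmetry L))"
      by (simp add: q dsr_iso_def dsr_op_htens distrib_right hscale_mult_left)
    also have "\<dots> = f \<otimes>\<^sub>h L + fps_X *\<^sub>h Z (f \<otimes>\<^sub>h L)"
      by (simp add: hlinear_simps[OF hlinear_eval_one] eval_coord_symmetry Z)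
    finally show "dsr_iso (q (f \<otimes>\<^sub>h L)) = f \<otimes>\<^sub>h L + fps_X *\<^sub>h Z (f \<otimes>\<^sub>h L)" .
  qed
  have b: "bij (\<lambda>w. dsr_iso (q w))" unfolding T by (rule bij_perturbation[OF Z(1)])
  show ?thesis
  proof (rule bijI)
    show "inj dsr_iso"
    proof (rule injI)
      fix x y assume "dsr_iso x = dsr_iso y"
      hence "dsr_iso (q (p x)) = dsr_iso (q (p y))" by (simp only: qp)
      from injD[OF bij_is_inj[OF b] this] have "q (p x) = q (p y)" by (rule arg_cong)
      thus "x = y" by (simp only: qp)
    qed
    show "surj dsr_iso"
      using bij_is_surj[OF b] unfolding surj_def by blast
  qed
qed

text \<open>The undeformed product pulled back along the bijection satisfies the description of the
  deformed smash product, by covariance of the realization. This gives existence, and uniqueness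
  identifies the two products.\<close>

lemma dsr_mult: "dsr_iso (dsr_mult x y) = undeformed_mult (dsr_iso x) (dsr_iso y)"
proof -
  define m where "m x y = inv dsr_iso (undeformed_mult (dsr_iso x) (dsr_iso y))" for x y
  have m: "dsr_iso (m x y) = eval_one (dsr_op x * dsr_op y)" for x y
    unfolding m_def undeformed_mult_dsr_iso by (rule surj_f_inv_f[OF bij_is_surj[OF bij_dsr_iso]])
  have inj: "dsr_iso u = dsr_iso v \<Longrightarrow> u = v" for u v
    using bij_is_inj[OF bij_dsr_iso] by (rule injD)
  have mb: "hbilinear m"
    by (intro hbilinearI hlinearI; rule inj)
      (simp_all add: m hlinear_simps[OF hlinear_dsr_iso] hlinear_simps[OF hlinear_dsr_op] hlinear_simps[OF hlinear_eval_one]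
        distrib_left distrib_right hscale_mult_left hscale_mult_right)
  have mf: "m (f \<otimes>\<^sub>h L) (g \<otimes>\<^sub>h M) = sweedler (\<lambda>L1 L2. (f * app (kappa_op L1) g) \<otimes>\<^sub>h (L2 * M)) (kappa_coproduct L)" for f L g M
  proof (rule inj)
    note bl = covariant_bilinear[OF kappa_op_homD(1) realize_hom(1) symmetry_homD(1)]
    have bl': "hbilinear (\<lambda>L1 L2. (f * app (kappa_op L1) g) \<otimes>\<^sub>h (L2 * M))"
      by (intro htens_bilinear hlinear_mult_left hlinear_mult_right[OF hlinear_id] hlinear_comp[OF hlinear_app_left] kappa_op_homD(1))
    have l: "hlinear (\<lambda>b. eval_one (realize f * b * symmetry M))"
      by (intro hlinear_comp[OF hlinear_eval_one] hlinear_mult_right hlinear_mult_left hlinear_id)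
    have "dsr_iso (m (f \<otimes>\<^sub>h L) (g \<otimes>\<^sub>h M)) = eval_one (realize f * (symmetry L * realize g) * symmetry M)"
      by (simp add: m dsr_op_htens mult.assoc)
    also have "\<dots> = sweedler (\<lambda>L1 L2. eval_one (realize f * (realize (app (kappa_op L1) g) * symmetry L2) * symmetry M)) (kappa_coproduct L)"
      using covariant_kappa[of L] hlinear_of_sweedler[OF l bl] by (simp add: covariant_def)
    also have "\<dots> = sweedler (\<lambda>L1 L2. dsr_iso ((f * app (kappa_op L1) g) \<otimes>\<^sub>h (L2 * M))) (kappa_coproduct L)"
      by (simp add: dsr_iso_def dsr_op_htens realize_simps symmetry_simps mult.assoc)
    also have "\<dots> = dsr_iso (sweedler (\<lambda>L1 L2. (f * app (kappa_op L1) g) \<otimes>\<^sub>h (L2 * M)) (kappa_coproduct L))"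
      by (rule hlinear_of_sweedler[OF hlinear_dsr_iso bl', symmetric])
    finally show "dsr_iso (m (f \<otimes>\<^sub>h L) (g \<otimes>\<^sub>h M)) = dsr_iso (sweedler (\<lambda>L1 L2. (f * app (kappa_op L1) g) \<otimes>\<^sub>h (L2 * M)) (kappa_coproduct L))" .
  qed
  have dm: "dsr_mult = m"
    unfolding dsr_mult_def smash_mult_def kappa_action
  proof (rule the_equality)
    show "hbilinear m \<and> (\<forall>f L g M. m (f \<otimes>\<^sub>h L) (g \<otimes>\<^sub>h M)
        = sweedler (\<lambda>L1 L2. (f * app (kappa_op L1) g) \<otimes>\<^sub>h (L2 * M)) (kappa_coproduct L))"
      using mb mf by blast
    fix m' assume "hbilinear m' \<and> (\<forall>f L g M. m' (f \<otimes>\<^sub>h L) (g \<otimes>\<^sub>h M)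
        = sweedler (\<lambda>L1 L2. (f * app (kappa_op L1) g) \<otimes>\<^sub>h (L2 * M)) (kappa_coproduct L))"
    thus "m' = m" by (intro hbilinear_htensor_eqI) (simp_all add: mb mf)
  qed
  show ?thesis by (simp only: dm m undeformed_mult_dsr_iso)
qed

theorem mainTheorem1:
  shows "\<exists>\<phi> :: dsr \<Rightarrow> undeformed.
    halgebra_iso dsr_mult (1 \<otimes>\<^sub>h 1) undeformed_mult (1 \<otimes>\<^sub>h 1) \<phi> \<and> congruent_to_identity \<phi>"
proof (intro exI conjI)
  have "dsr_iso (1 \<otimes>\<^sub>h 1) = 1 \<otimes>\<^sub>h 1"
    by (simp add: dsr_iso_def dsr_op_htens realize_simps symmetry_simps eval_one_def)
  thus "halgebra_iso dsr_mult (1 \<otimes>\<^sub>h 1) undeformed_mult (1 \<otimes>\<^sub>h 1) dsr_iso"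
    by (simp add: halgebra_iso_def halgebra_hom_def hlinear_dsr_iso dsr_mult bij_dsr_iso)
  show "congruent_to_identity dsr_iso"
    unfolding congruent_to_identity_def hcong_iff_hsmall
  proof (intro allI)
    fix \<mu>s L
    \<comment> \<open>On words the congruence is known for operators; right multiplication and
      evaluation at the unit preserve divisibility by \<open>h\<close>.\<close>
    have "hsmall 1 (eval_one ((realize (prod_list (map Xg \<mu>s)) - coord (prod_list (map xg \<mu>s))) * symmetry L))"
      by (intro hsmall_hlinear[OF hlinear_eval_one] hsmall_mult_right hsmall_realize_words)
    thus "hsmall 1 (dsr_iso (prod_list (map Xg \<mu>s) \<otimes>\<^sub>h L) - prod_list (map xg \<mu>s) \<otimes>\<^sub>h L)"
      by (simp add: dsr_iso_def dsr_op_htens left_diff_distrib hlinear_simps[OF hlinear_eval_one] eval_coord_symmetry)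
  qed
qed

end
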